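(* Let $(\mathcal M,X)$ be an irreducible concurrent system equipped with a Markov measure $\nu=(\nu_\alpha)_{\alpha\in X}$. 1. For every test function $\varphi$, there is a constant $k_\varphi\in\mathbb R$ such that the ergodic means $M\varphi$ converge almost surely toward the constant $L=(L_\alpha)_{\alpha\in X}$ where $L_\alpha=k_\varphi$ for all $\alpha\in X$. 2. If $\varphi$ is additive, the limit $k_\varphi$ can be computed as follows. Let $J$ be any final component of $\mathsf{DSC}^+$. Let $Q$ be the restriction to $J$ of the transition matrix $P$ of the Markov chain of state-and-cliques, and let $\pi_J$ be the unique invariant probability distribution of $Q$. Then $$k_\varphi=\Bigl(\sum_{(\alpha,c)\in J}\pi_J(\alpha,c)\,|c|\Bigr)^{-1}\sum_{(\alpha,c)\in J}\pi_J(\alpha,c)\,\varphi_\alpha(c).$$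
   Context: Trace monoids. Let $\Sigma$ be a finite set and $I\subseteq\Sigma\times\Sigma$ irreflexive and symmetric. The trace monoid $\mathcal M=\mathcal M(\Sigma,I)$ is presented by $\langle\Sigma\mid ab=ba\text{ for }(a,b)\in I\rangle$. Its elements are traces, $\varepsilon$ is the unit, $|x|$ is the length of $x$, and $x\leqslant y$ means $y=xz$ for some $z\in\mathcal M$. $\mathcal M$ is irreducible if the graph $(\Sigma,(\Sigma\times\Sigma)\setminus I)$ is connected. A clique is a trace $a_1\cdots a_k$ of letters with $(a_i,a_j)\in I$ for $i\neq j$ (empty trace included); $\mathcal C$ is the set of cliques, identified with subsets of $\Sigma$. For cliques write $c\to d$ if for every letter $b\in d$ there is a letter $a\in c$ with $(a,b)\notin I$. Every trace $x$ has a unique normal form $x=c_1\cdots c_n$ with non-empty cliques $c_i\to c_{i+1}$; put $C_i(x)=c_i$ for $i\leqslant n$ and $C_i(x)=\varepsilon$ for $i>n$. Infinite traces. An infinite trace is a sequence $\omega=(c_i)_{i\geqslant1}$ of non-empty cliques with $c_i\to c_{i+1}$ for all $i$; $C_i(\omega)=c_i$. The set $\partial\mathcal M$ of infinite traces carries its Borel $\sigma$-algebra. For $x\in\mathcal M$, $x\leqslant\omega$ means $x\leqslant C_1(\omega)\cdots C_n(\omega)$ for some $n$, and ${\uparrow}x=\{\omega\in\partial\mathcal M:x\leqslant\omega\}$. Concurrent systems. A concurrent system is a pair $(\mathcal M,X)$, $X$ a finite set of states, with a right monoid action of $\mathcal M$ on $X\sqcup\{\bot\}$, where $\bot\cdot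 x=\bot$ for all $x$. Put $\mathcal M_\alpha=\{x:\alpha\cdot x\neq\bot\}$, $\mathcal M_{\alpha,\beta}=\{x:\alpha\cdot x=\beta\}$, $\mathcal C_\alpha=\mathcal C\cap\mathcal M_\alpha$, and $\partial\mathcal M_\alpha=\{\omega\in\partial\mathcal M: x\in\mathcal M_\alpha\text{ for all }x\in\mathcal M\text{ with }x\leqslant\omega\}$. Non-trivial: $\alpha\cdot a\neq\bot$ for some $\alpha\in X$, $a\in\Sigma$. Transitive: $\mathcal M_{\alpha,\beta}\neq\emptyset$ for all $\alpha,\beta\in X$. Irreducible: (1) transitive and non-trivial; (2) $\mathcal M$ is irreducible; (3) for all $\alpha\in X$, $a\in\Sigma$ there is $u\in\mathcal M$ with $\alpha\cdot(ua)\neq\bot$. Markov measures. A Markov measure is a family $\nu=(\nu_\alpha)_{\alpha\in X}$ of probability measures on $\partial\mathcal M$ with $\nu_\alpha(\partial\mathcal M_\alpha)=1$, $x\in\mathcal M_\alpha\iff\nu_\alpha({\uparrow}x)>0$, and $\nu_\alpha({\uparrow}(xy))=\nu_\alpha({\uparrow}x)\,\nu_{\alpha\cdot x}({\uparrow}y)$ for all $\alpha,x,y$ (right-hand side $0$ if $\alpha\cdot x=\bot$). Test functions. A test function is a family $\varphi=(\varphi_\alpha)_{\alpha\in X}$, $\varphi_\alpha:\mathcal M_\alpha\to\mathbb R$, such that either (i) $\varphi$ is additive: $\varphi_\alpha(xy)=\varphi_\alpha(x)+\varphi_{\alpha\cdot x}(y)$ for all $\alpha\in X$, $x\in\mathcal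 M_\alpha$, $y\in\mathcal M_{\alpha\cdot x}$; or (ii) $\varphi$ is non-negative and $\varphi_\alpha(x)\leqslant\varphi_\alpha(xy)\leqslant\varphi_\alpha(x)+\varphi_{\alpha\cdot x}(y)$ for all such $\alpha,x,y$. The ergodic means are $M\varphi(x)=\varphi_\alpha(x)/|x|$ for non-empty $x\in\mathcal M_\alpha$. They converge almost surely toward $L=(L_\alpha)_{\alpha\in X}$ if for every $\alpha\in X$ and $\nu_\alpha$-almost every $\omega$: for every $\epsilon>0$ there is $x\in\mathcal M_\alpha$ with $x\leqslant\omega$ such that for all non-empty $y\in\mathcal M_\alpha$, $x\leqslant y\leqslant\omega$ implies $|M\varphi(y)-L_\alpha(\omega)|<\epsilon$. State-and-cliques. A state-and-clique is a pair $(\alpha,c)$ with $\alpha\in X$, $c$ a non-empty clique, $\alpha\cdot c\neq\bot$. Write $(\alpha,c)\to(\beta,d)$ if $\beta=\alpha\cdot c$ and $c\to d$; this defines the digraph $\mathsf{DSC}$. $(\alpha,c)$ is stable if there is $x\in\mathcal M_\alpha$ (a protection of $(\alpha,c)$) such that every $z\in\mathcal M_\alpha$ with $x\leqslant z$ satisfies $C_1(z)=c$. $\mathsf{DSC}^+$ is the sub-digraph of $\mathsf{DSC}$ induced on stable state-and-cliques. A final component is a strongly connected component with no edge to another component. Transition matrix. Let $f_\alpha(x)=\nu_\alpha({\uparrow}x)$, let $h_\alpha(c)=\sum_{c'\in\mathcal C,\,c\leqslant c'}(-1)^{|c'|-|c|}f_\alpha(c')$ and $g_\beta(c)=\sum_{d\in\mathcal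 C_\beta,\,c\to d}h_\beta(d)$. For $\alpha\in X$, under $\nu_\alpha$ the process $(\alpha_i,C_{i+1})_{i\geqslant0}$ with $\alpha_0=\alpha$, $\alpha_{i+1}=\alpha_i\cdot C_{i+1}$ is a Markov chain (the Markov chain of state-and-cliques) with initial law $\delta_\alpha\otimes h_\alpha$ and transition matrix $P_{(\alpha,c),(\beta,d)}=\mathbf 1_{\{(\alpha,c)\to(\beta,d)\}}\,h_\beta(d)/g_{\alpha\cdot c}(c)$, defined when $g_{\alpha\cdot c}(c)>0$ (which is the case for stable $(\alpha,c)$). *)

theory Defs
  imports
    "HOL-Algebra.Group"
    "HOL-Probability.Probability"
    "Graph_Theory.Digraph_Component"
begin

text \<open>
  The alphabet and the state set are finite types. Throughout, \<^term>\<open>I :: ('a \<times> 'a) set\<close> is the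
  independence relation; that it is irreflexive and symmetric is part of \<open>concurrent_system\<close>.
\<close>


section \<open>Trace monoids\<close>

text \<open>A trace is a class of words modulo the congruence generated by \<open>ab = ba\<close> for \<open>(a, b) \<in> I\<close>.\<close>

type_synonym 'a trace = "'a list set"

inductive trace_eq :: "('a \<times> 'a) set \<Rightarrow> 'a list \<Rightarrow> 'a list \<Rightarrow> bool" for I where
  swap: "(a, b) \<in> I \<Longrightarrow> trace_eq I [a, b] [b, a]"
| refl: "trace_eq I u u"
| sym: "trace_eq I u v \<Longrightarrow> trace_eq I v u"
| trans: "trace_eq I u v \<Longrightarrow> trace_eq I v w \<Longrightarrow> trace_eq I u w"
| append: "trace_eq I u u' \<Longrightarrow> trace_eq I v v' \<Longrightarrow> trace_eq I (u @ v) (u' @ v')"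

definition trace_of :: "('a \<times> 'a) set \<Rightarrow> 'a list \<Rightarrow> 'a trace" where
  "trace_of I w = {v. trace_eq I w v}"

definition trace_monoid :: "('a \<times> 'a) set \<Rightarrow> 'a trace monoid" where
  "trace_monoid I = \<lparr>carrier = range (trace_of I),
     monoid.mult = (\<lambda>x y. \<Union>u\<in>x. \<Union>v\<in>y. trace_of I (u @ v)),
     one = trace_of I []\<rparr>"

abbreviation trace_mult :: "'a trace \<Rightarrow> ('a \<times> 'a) set \<Rightarrow> 'a trace \<Rightarrow> 'a trace"
    ("(_ \<cdot>\<^bsub>_\<^esub>/ _)" [70, 0, 71] 70) where
  "x \<cdot>\<^bsub>I\<^esub> y \<equiv> x \<otimes>\<^bsub>trace_monoid I\<^esub> y"

definition trace_length :: "'a trace \<Rightarrow> nat" where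
  "trace_length x = length (SOME w. w \<in> x)"

lemma trace_of_eq_iff: "trace_of I u = trace_of I v \<longleftrightarrow> trace_eq I u v"
  unfolding trace_of_def by (auto intro: trace_eq.refl trace_eq.sym trace_eq.trans)

lemma mult_trace_of [simp]: "trace_of I u \<cdot>\<^bsub>I\<^esub> trace_of I v = trace_of I (u @ v)"
  unfolding trace_monoid_def trace_of_def
  by (auto intro: trace_eq.refl trace_eq.append trace_eq.trans)

lemma one_trace_monoid: "\<one>\<^bsub>trace_monoid I\<^esub> = trace_of I []"
  by (simp add: trace_monoid_def)

lemma carrier_trace_monoid: "carrier (trace_monoid I) = range (trace_of I)"
  by (simp add: trace_monoid_def)

lemma monoid_trace_monoid: "monoid (trace_monoid I)"
  by unfold_locales (auto simp: carrier_trace_monoid one_trace_monoid)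

lemma trace_eq_mset: "trace_eq I u v \<Longrightarrow> mset u = mset v"
  by (induction rule: trace_eq.induct) auto

lemma trace_length_trace_of: "trace_length (trace_of I w) = length w"
proof -
  have "trace_eq I w (SOME v. v \<in> trace_of I w)"
    using someI[of "\<lambda>v. v \<in> trace_of I w" w] by (simp add: trace_of_def trace_eq.refl)
  then show ?thesis
    unfolding trace_length_def by (metis trace_eq_mset size_mset)
qed

definition trace_le :: "('a \<times> 'a) set \<Rightarrow> 'a trace \<Rightarrow> 'a trace \<Rightarrow> bool" where
  "trace_le I x y \<longleftrightarrow> (\<exists>z\<in>carrier (trace_monoid I). y = x \<cdot>\<^bsub>I\<^esub> z)"

definition irreducible_monoid :: "('a \<times> 'a) set \<Rightarrow> bool" where
  "irreducible_monoid I \<longleftrightarrow>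
     Digraph_Component.connected (with_proj \<lparr>pverts = UNIV, parcs = UNIV \<times> UNIV - I\<rparr>)"

text \<open>
  Cliques are represented by their sets of letters; \<open>clique_trace\<close> is the corresponding trace,
  whose length is the cardinality of the set.
\<close>

definition clique :: "('a \<times> 'a) set \<Rightarrow> 'a set \<Rightarrow> bool" where
  "clique I c \<longleftrightarrow> pairwise (\<lambda>a b. (a, b) \<in> I) c"

definition clique_trace :: "('a \<times> 'a) set \<Rightarrow> 'a set \<Rightarrow> 'a trace" where
  "clique_trace I c = trace_of I (SOME w. distinct w \<and> set w = c)"

lemma trace_eq_move_front:
  assumes "\<And>b. b \<in> set u \<Longrightarrow> (b, a) \<in> I"
  shows "trace_eq I (u @ a # v) (a # u @ v)"
  using assms
proof (induction u)
  case (Cons b u)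
  have "trace_eq I ([b] @ u @ a # v) ([b] @ a # u @ v)"
    using Cons by (intro trace_eq.append trace_eq.refl) auto
  moreover have "trace_eq I ([b, a] @ u @ v) ([a, b] @ u @ v)"
    using Cons.prems by (intro trace_eq.append trace_eq.refl trace_eq.swap) auto
  ultimately show ?case
    by (auto intro: trace_eq.trans)
qed (simp add: trace_eq.refl)

lemma trace_eq_enumerations:
  assumes "clique I (set u)" "distinct u" "distinct w" "set u = set w"
  shows "trace_eq I u w"
  using assms
proof (induction u arbitrary: w)
  case (Cons a u)
  then obtain p q where w: "w = p @ a # q" by (metis list.set_intros(1) split_list)
  have set_u: "set u = set (p @ q)" using Cons.prems w by auto
  have "trace_eq I u (p @ q)"
    using Cons.prems w set_u by (intro Cons.IH) (auto simp: clique_def pairwise_def)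
  then have "trace_eq I ([a] @ u) ([a] @ p @ q)"
    by (intro trace_eq.append trace_eq.refl)
  moreover have "trace_eq I w (a # p @ q)"
    unfolding w using Cons.prems w
    by (intro trace_eq_move_front) (auto simp: clique_def pairwise_def)
  ultimately show ?case
    by (auto intro: trace_eq.trans trace_eq.sym)
qed (simp add: trace_eq.refl)

lemma clique_trace_eq:
  assumes "clique I (set w)" "distinct w"
  shows "clique_trace I (set w) = trace_of I w"
proof -
  let ?v = "SOME v. distinct v \<and> set v = set w"
  have "distinct ?v \<and> set ?v = set w"
    by (rule someI[of "\<lambda>v. distinct v \<and> set v = set w" w]) (simp add: assms)
  then show ?thesis
    unfolding clique_trace_def trace_of_eq_iff using assms by (intro trace_eq_enumerations) auto
qed

lemma trace_length_clique_trace: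
  fixes c :: "'a::finite set"
  assumes "clique I c"
  shows "trace_length (clique_trace I c) = card c"
proof -
  obtain w where "distinct w" "set w = c"
    using finite_distinct_list[of c] by auto
  then show ?thesis
    using assms clique_trace_eq[of I w] by (auto simp: trace_length_trace_of distinct_card)
qed

definition clique_arrow :: "('a \<times> 'a) set \<Rightarrow> 'a set \<Rightarrow> 'a set \<Rightarrow> bool" where
  "clique_arrow I c d \<longleftrightarrow> (\<forall>b\<in>d. \<exists>a\<in>c. (a, b) \<notin> I)"

definition cliques_prod :: "('a \<times> 'a) set \<Rightarrow> 'a set list \<Rightarrow> 'a trace" where
  "cliques_prod I cs = foldr (\<lambda>c x. clique_trace I c \<cdot>\<^bsub>I\<^esub> x) cs \<one>\<^bsub>trace_monoid I\<^esub>"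

definition normal_form :: "('a \<times> 'a) set \<Rightarrow> 'a trace \<Rightarrow> 'a set list" where
  "normal_form I x = (THE cs. (\<forall>c\<in>set cs. clique I c \<and> c \<noteq> {}) \<and>
     successively (clique_arrow I) cs \<and> cliques_prod I cs = x)"

text \<open>Indices of normal forms start at 0, so that \<open>layer I x i\<close> is $C_{i+1}(x)$.\<close>

definition layer :: "('a \<times> 'a) set \<Rightarrow> 'a trace \<Rightarrow> nat \<Rightarrow> 'a set" where
  "layer I x i = (if i < length (normal_form I x) then normal_form I x ! i else {})"


section \<open>Infinite traces\<close>

text \<open>Again \<open>\<omega> i\<close> is $C_{i+1}(\omega)$.\<close>

definition boundary :: "('a \<times> 'a) set \<Rightarrow> (nat \<Rightarrow> 'a set) set" where
  "boundary I = {\<omega>. \<forall>i. clique I (\<omega> i) \<and> \<omega> i \<noteq> {} \<and> clique_arrow I (\<omega> i) (\<omega> (Suc i))}"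

definition boundary_topology :: "('a \<times> 'a) set \<Rightarrow> (nat \<Rightarrow> 'a set) topology" where
  "boundary_topology I =
     subtopology (product_topology (\<lambda>_. discrete_topology UNIV) UNIV) (boundary I)"

definition boundary_borel :: "('a \<times> 'a) set \<Rightarrow> (nat \<Rightarrow> 'a set) measure" where
  "boundary_borel I = sigma (boundary I) {U. openin (boundary_topology I) U}"

definition le_inf :: "('a \<times> 'a) set \<Rightarrow> 'a trace \<Rightarrow> (nat \<Rightarrow> 'a set) \<Rightarrow> bool" where
  "le_inf I x \<omega> \<longleftrightarrow> (\<exists>n. trace_le I x (cliques_prod I (map \<omega> [0..<n])))"

definition cylinder :: "('a \<times> 'a) set \<Rightarrow> 'a trace \<Rightarrow> (nat \<Rightarrow> 'a set) set" where
  "cylinder I x = {\<omega> \<in> boundary I. le_inf I x \<omega>}"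


section \<open>Concurrent systems\<close>

text \<open>The set $X \sqcup \{\bot\}$ is \<^typ>\<open>'s option\<close>, with \<^const>\<open>None\<close> for $\bot$.\<close>

type_synonym ('a, 's) action = "'s option \<Rightarrow> 'a trace \<Rightarrow> 's option"

definition concurrent_system :: "('a::finite \<times> 'a) set \<Rightarrow> ('a, 's::finite) action \<Rightarrow> bool" where
  "concurrent_system I act \<longleftrightarrow>
     irrefl I \<and> sym I \<and>
     (\<forall>s. act s \<one>\<^bsub>trace_monoid I\<^esub> = s) \<and>
     (\<forall>s. \<forall>x\<in>carrier (trace_monoid I). \<forall>y\<in>carrier (trace_monoid I).
        act s (x \<cdot>\<^bsub>I\<^esub> y) = act (act s x) y) \<and>
     (\<forall>x\<in>carrier (trace_monoid I). act None x = None)"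

definition traces_from :: "('a \<times> 'a) set \<Rightarrow> ('a, 's) action \<Rightarrow> 's \<Rightarrow> 'a trace set" where
  "traces_from I act \<alpha> = {x \<in> carrier (trace_monoid I). act (Some \<alpha>) x \<noteq> None}"

definition traces_between :: "('a \<times> 'a) set \<Rightarrow> ('a, 's) action \<Rightarrow> 's \<Rightarrow> 's \<Rightarrow> 'a trace set" where
  "traces_between I act \<alpha> \<beta> = {x \<in> carrier (trace_monoid I). act (Some \<alpha>) x = Some \<beta>}"

definition cliques_from :: "('a \<times> 'a) set \<Rightarrow> ('a, 's) action \<Rightarrow> 's \<Rightarrow> 'a set set" where
  "cliques_from I act \<alpha> = {c. clique I c \<and> clique_trace I c \<in> traces_from I act \<alpha>}"

definition boundary_from :: "('a \<times> 'a) set \<Rightarrow> ('a, 's) action \<Rightarrow> 's \<Rightarrow> (nat \<Rightarrow> 'a set) set" where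
  "boundary_from I act \<alpha> = {\<omega> \<in> boundary I.
     \<forall>x\<in>carrier (trace_monoid I). le_inf I x \<omega> \<longrightarrow> x \<in> traces_from I act \<alpha>}"

text \<open>
  The state \<open>\<alpha> \<cdot> x\<close>, to be used only for \<open>x \<in> traces_from I act \<alpha>\<close>.
\<close>

abbreviation next_state :: "('a, 's) action \<Rightarrow> 's \<Rightarrow> 'a trace \<Rightarrow> 's" where
  "next_state act \<alpha> x \<equiv> the (act (Some \<alpha>) x)"

definition nontrivial_system :: "('a \<times> 'a) set \<Rightarrow> ('a, 's) action \<Rightarrow> bool" where
  "nontrivial_system I act \<longleftrightarrow> (\<exists>\<alpha> a. act (Some \<alpha>) (trace_of I [a]) \<noteq> None)"

definition transitive_system :: "('a \<times> 'a) set \<Rightarrow> ('a, 's) action \<Rightarrow> bool" where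
  "transitive_system I act \<longleftrightarrow> (\<forall>\<alpha> \<beta>. traces_between I act \<alpha> \<beta> \<noteq> {})"

definition irreducible_system :: "('a::finite \<times> 'a) set \<Rightarrow> ('a, 's::finite) action \<Rightarrow> bool" where
  "irreducible_system I act \<longleftrightarrow>
     concurrent_system I act \<and>
     transitive_system I act \<and> nontrivial_system I act \<and>
     irreducible_monoid I \<and>
     (\<forall>\<alpha> a. \<exists>u\<in>carrier (trace_monoid I). act (Some \<alpha>) (u \<cdot>\<^bsub>I\<^esub> trace_of I [a]) \<noteq> None)"


section \<open>Markov measures\<close>

type_synonym ('a, 's) measure_family = "'s \<Rightarrow> (nat \<Rightarrow> 'a set) measure"

definition markov_measure ::
    "('a \<times> 'a) set \<Rightarrow> ('a, 's) action \<Rightarrow> ('a, 's) measure_family \<Rightarrow> bool" where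
  "markov_measure I act \<nu> \<longleftrightarrow>
     (\<forall>\<alpha>. prob_space (\<nu> \<alpha>) \<and> sets (\<nu> \<alpha>) = sets (boundary_borel I) \<and>
        measure (\<nu> \<alpha>) (boundary_from I act \<alpha>) = 1) \<and>
     (\<forall>\<alpha>. \<forall>x\<in>carrier (trace_monoid I).
        x \<in> traces_from I act \<alpha> \<longleftrightarrow> measure (\<nu> \<alpha>) (cylinder I x) > 0) \<and>
     (\<forall>\<alpha>. \<forall>x\<in>carrier (trace_monoid I). \<forall>y\<in>carrier (trace_monoid I).
        measure (\<nu> \<alpha>) (cylinder I (x \<cdot>\<^bsub>I\<^esub> y)) =
          (case act (Some \<alpha>) x of
             None \<Rightarrow> 0
           | Some \<beta> \<Rightarrow> measure (\<nu> \<alpha>) (cylinder I x) * measure (\<nu> \<beta>) (cylinder I y)))"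


section \<open>Test functions and ergodic means\<close>

text \<open>
  A family of functions $\varphi_\alpha : \mathcal{M}_\alpha \to \mathbb{R}$ is given by total
  functions whose values outside \<open>traces_from I act \<alpha>\<close> are never used.
\<close>

type_synonym ('a, 's) trace_fun = "'s \<Rightarrow> 'a trace \<Rightarrow> real"

definition additive_fun ::
    "('a \<times> 'a) set \<Rightarrow> ('a, 's) action \<Rightarrow> ('a, 's) trace_fun \<Rightarrow> bool" where
  "additive_fun I act \<phi> \<longleftrightarrow>
     (\<forall>\<alpha>. \<forall>x\<in>traces_from I act \<alpha>. \<forall>y\<in>traces_from I act (next_state act \<alpha> x).
        \<phi> \<alpha> (x \<cdot>\<^bsub>I\<^esub> y) = \<phi> \<alpha> x + \<phi> (next_state act \<alpha> x) y)"

definition monotone_subadditive_fun ::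
    "('a \<times> 'a) set \<Rightarrow> ('a, 's) action \<Rightarrow> ('a, 's) trace_fun \<Rightarrow> bool" where
  "monotone_subadditive_fun I act \<phi> \<longleftrightarrow>
     (\<forall>\<alpha>. \<forall>x\<in>traces_from I act \<alpha>. 0 \<le> \<phi> \<alpha> x) \<and>
     (\<forall>\<alpha>. \<forall>x\<in>traces_from I act \<alpha>. \<forall>y\<in>traces_from I act (next_state act \<alpha> x).
        \<phi> \<alpha> x \<le> \<phi> \<alpha> (x \<cdot>\<^bsub>I\<^esub> y) \<and>
        \<phi> \<alpha> (x \<cdot>\<^bsub>I\<^esub> y) \<le> \<phi> \<alpha> x + \<phi> (next_state act \<alpha> x) y)"

definition test_function ::
    "('a \<times> 'a) set \<Rightarrow> ('a, 's) action \<Rightarrow> ('a, 's) trace_fun \<Rightarrow> bool" where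
  "test_function I act \<phi> \<longleftrightarrow> additive_fun I act \<phi> \<or> monotone_subadditive_fun I act \<phi>"

definition ergodic_mean :: "('a, 's) trace_fun \<Rightarrow> 's \<Rightarrow> 'a trace \<Rightarrow> real" where
  "ergodic_mean \<phi> \<alpha> x = \<phi> \<alpha> x / real (trace_length x)"

definition ergodic_means_converge ::
    "('a \<times> 'a) set \<Rightarrow> ('a, 's) action \<Rightarrow> ('a, 's) measure_family \<Rightarrow> ('a, 's) trace_fun \<Rightarrow>
     ('s \<Rightarrow> (nat \<Rightarrow> 'a set) \<Rightarrow> real) \<Rightarrow> bool" where
  "ergodic_means_converge I act \<nu> \<phi> L \<longleftrightarrow>
     (\<forall>\<alpha>. AE \<omega> in \<nu> \<alpha>. \<forall>\<epsilon>>0. \<exists>x\<in>traces_from I act \<alpha>. le_inf I x \<omega> \<and>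
        (\<forall>y\<in>traces_from I act \<alpha>. y \<noteq> \<one>\<^bsub>trace_monoid I\<^esub> \<and> trace_le I x y \<and> le_inf I y \<omega> \<longrightarrow>
           \<bar>ergodic_mean \<phi> \<alpha> y - L \<alpha> \<omega>\<bar> < \<epsilon>))"


section \<open>The digraph of state-and-cliques\<close>

definition DSC :: "('a \<times> 'a) set \<Rightarrow> ('a, 's) action \<Rightarrow> ('s \<times> 'a set) pair_pre_digraph" where
  "DSC I act =
     (let V = {(\<alpha>, c). c \<noteq> {} \<and> c \<in> cliques_from I act \<alpha>} in
      \<lparr>pverts = V,
       parcs = {((\<alpha>, c), (\<beta>, d)) | \<alpha> c \<beta> d. (\<alpha>, c) \<in> V \<and> (\<beta>, d) \<in> V \<and>
         act (Some \<alpha>) (clique_trace I c) = Some \<beta> \<and> clique_arrow I c d}\<rparr>)"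

definition stable :: "('a \<times> 'a) set \<Rightarrow> ('a, 's) action \<Rightarrow> 's \<times> 'a set \<Rightarrow> bool" where
  "stable I act = (\<lambda>(\<alpha>, c). (\<alpha>, c) \<in> pverts (DSC I act) \<and>
     (\<exists>x\<in>traces_from I act \<alpha>. \<forall>z\<in>traces_from I act \<alpha>. trace_le I x z \<longrightarrow> layer I z 0 = c))"

definition DSC_plus ::
    "('a \<times> 'a) set \<Rightarrow> ('a, 's) action \<Rightarrow>
     ('s \<times> 'a set, ('s \<times> 'a set) \<times> ('s \<times> 'a set)) pre_digraph" where
  "DSC_plus I act = with_proj (DSC I act) \<restriction> {v. stable I act v}"

text \<open>Components are given by their vertex sets.\<close>

definition final_component ::
    "('v, 'e) pre_digraph \<Rightarrow> 'v set \<Rightarrow> bool" where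
  "final_component G J \<longleftrightarrow> J \<in> pre_digraph.sccs_verts G \<and>
     (\<forall>J'\<in>pre_digraph.sccs_verts G. J' \<noteq> J \<longrightarrow> (\<forall>u\<in>J. \<forall>v\<in>J'. \<not> u \<rightarrow>\<^bsub>G\<^esub> v))"


section \<open>The Markov chain of state-and-cliques\<close>

definition f_val :: "('a \<times> 'a) set \<Rightarrow> ('a, 's) measure_family \<Rightarrow> 's \<Rightarrow> 'a set \<Rightarrow> real" where
  "f_val I \<nu> \<alpha> c = measure (\<nu> \<alpha>) (cylinder I (clique_trace I c))"

definition h_val :: "('a::finite \<times> 'a) set \<Rightarrow> ('a, 's) measure_family \<Rightarrow> 's \<Rightarrow> 'a set \<Rightarrow> real" where
  "h_val I \<nu> \<alpha> c =
     (\<Sum>c' | clique I c' \<and> trace_le I (clique_trace I c) (clique_trace I c').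
        (-1) ^ (card c' - card c) * f_val I \<nu> \<alpha> c')"

definition g_val ::
    "('a::finite \<times> 'a) set \<Rightarrow> ('a, 's) action \<Rightarrow> ('a, 's) measure_family \<Rightarrow> 's \<Rightarrow> 'a set \<Rightarrow> real" where
  "g_val I act \<nu> \<beta> c = (\<Sum>d | d \<in> cliques_from I act \<beta> \<and> clique_arrow I c d. h_val I \<nu> \<beta> d)"

text \<open>Rows with vanishing denominator, where the matrix is undefined, are filled with zeros.\<close>

definition transition_matrix ::
    "('a::finite \<times> 'a) set \<Rightarrow> ('a, 's) action \<Rightarrow> ('a, 's) measure_family \<Rightarrow>
     's \<times> 'a set \<Rightarrow> 's \<times> 'a set \<Rightarrow> real" where
  "transition_matrix I act \<nu> = (\<lambda>(\<alpha>, c) (\<beta>, d).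
     if ((\<alpha>, c), (\<beta>, d)) \<in> parcs (DSC I act)
     then h_val I \<nu> \<beta> d / g_val I act \<nu> (next_state act \<alpha> (clique_trace I c)) c
     else 0)"

text \<open>
  Only entries of \<open>P\<close> with both indices in \<open>J\<close> matter: invariance refers to the restriction
  of \<open>P\<close> to \<open>J\<close>.
\<close>

definition invariant_distribution :: "('v \<Rightarrow> 'v \<Rightarrow> real) \<Rightarrow> 'v set \<Rightarrow> 'v pmf \<Rightarrow> bool" where
  "invariant_distribution P J \<pi> \<longleftrightarrow>
     set_pmf \<pi> \<subseteq> J \<and> (\<forall>v\<in>J. (\<Sum>u\<in>J. pmf \<pi> u * P u v) = pmf \<pi> v)"

end

theory Submission
  imports Defs "HOL-Real_Asymp.Real_Asymp"
begin

text \<open>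
Traces are handled as words up to the congruence \<open>\<simeq>\<close>, ordered by the prefix relation \<open>\<preceq>\<close>. Write
\<open>f \<alpha> u\<close> for the measure of the cylinder of \<open>u\<close> under \<open>\<nu> \<alpha>\<close>; it is multiplicative along the action.

For the convergence, the idea is to cut a random infinite trace into independent, identically distributed
finite blocks. Some enabled word \<open>w\<close> has, for every letter \<open>b\<close>, a prefix whose unique maximal letter is
\<open>b\<close> whatever is put in front of it (\<open>cutting_word_exists\<close>). Such a word separates the past from the
future: if \<open>y \<preceq> x @ w @ z\<close>, then \<open>y \<preceq> x @ w\<close> or \<open>x \<preceq> y\<close> (\<open>ple_cut\<close>). Fix a state \<open>\<alpha>0\<close> in which \<open>w\<close> is
enabled, let \<open>\<beta>0\<close> be the state that \<open>w\<close> leads to, and call a trace from \<open>\<alpha>\<close> a hit if it ends with a \<open>w\<close>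
started in \<open>\<alpha>0\<close>. Hits below a common trace are comparable, because they have the same unique maximal
letter. Hence almost every infinite trace from \<open>\<alpha>\<close> is, in a unique way, a minimal hit from \<open>\<alpha>\<close> followed by
minimal hits from \<open>\<beta>0\<close>, and by the chain rule of a Markov measure the latter are i.i.d.
(\<open>distr_the_run\<close>). These blocks have finite mean length (\<open>integrable_block_length\<close>): given any possible
first layers, there is a probability bounded below that a hit is completed a bounded number of layers
later (\<open>nohit_decay\<close>). Here one needs a continuation that forces the layers seen so far; it exists since
almost every infinite trace contains all letters (\<open>AE_all_letters\<close>), which follows from the
connectedness of the dependence relation.

Let \<open>R n\<close> be the trace of the first \<open>n\<close> blocks. For a nonnegative, monotone, subadditive test function
\<open>\<phi>\<close>, the subadditive ergodic theorem for i.i.d. sequences (\<open>subadditive_ergodic\<close>) gives limits \<open>\<kappa>\<close> of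
\<open>\<phi> (R n) / n\<close> and \<open>l\<close> of \<open>length (R n) / n\<close>. By the cutting property every long finite trace below \<open>\<omega>\<close> lies
between some \<open>R n\<close> and \<open>R (n + 2)\<close>, so by monotonicity its ergodic mean is close to \<open>\<kappa> / l\<close>
(\<open>sandwich\<close>). Another initial state \<open>\<alpha>\<close> is reached from \<open>\<beta>0\<close> by a fixed trace, which changes \<open>\<phi>\<close> by a
bounded amount only and hence leaves the limit unchanged (\<open>ergodic_from_blocks\<close>). An additive test
function becomes nonnegative and monotone after adding a multiple of the length, which shifts all
ergodic means by the same constant.

For the value of the limit, Moebius inversion identifies \<open>h\<close> with the law of the first layer, and a
state-and-clique is stable iff its weight \<open>h\<close> is positive (\<open>stable_iff\<close>). So on a final component the
transition matrix is stochastic and irreducible, and it has exactly one invariant distribution \<open>\<pi>\<close>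
(\<open>ex1_invariant_distribution\<close>). Now centre an additive \<open>\<phi>\<close> by subtracting \<open>k\<close> times the length. Given
that the chain starts at \<open>u \<in> J\<close>, let \<open>Z n u\<close> be the mean of this centred function over the first \<open>n + 1\<close>
layers. Then \<open>Z (n + 1)\<close> is \<open>Z 0\<close> plus the transition matrix applied to \<open>Z n\<close>, so the \<open>\<pi>\<close>-average of
\<open>Z n\<close> is \<open>n + 1\<close> times the \<open>\<pi>\<close>-average of \<open>Z 0\<close>. By the first part and dominated convergence it is
also \<open>o(n)\<close>. Therefore the \<open>\<pi>\<close>-average of \<open>Z 0\<close> vanishes, and this is the formula
(\<open>stationary_average\<close>).
\<close>

section \<open>Words up to commutation\<close>

locale trace_alphabet =
  fixes I :: "('a::finite \<times> 'a) set"
  assumes irrefl_I: "irrefl I" and sym_I: "sym I"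
begin

abbreviation teq :: "'a list \<Rightarrow> 'a list \<Rightarrow> bool" (infix "\<simeq>" 50) where
  "u \<simeq> v \<equiv> trace_eq I u v"

definition ple :: "'a list \<Rightarrow> 'a list \<Rightarrow> bool" (infix "\<preceq>" 50) where
  "u \<preceq> v \<longleftrightarrow> (\<exists>z. u @ z \<simeq> v)"

abbreviation indep :: "'a list \<Rightarrow> 'a list \<Rightarrow> bool" where
  "indep u v \<equiv> set u \<times> set v \<subseteq> I"

lemma not_I_refl: "(a, a) \<notin> I"
  using irrefl_I by (auto simp: irrefl_def)

lemma I_sym: "(a, b) \<in> I \<Longrightarrow> (b, a) \<in> I"
  using sym_I by (auto simp: sym_def)

lemmas teq_refl = trace_eq.refl
lemmas teq_sym = trace_eq.sym
lemmas teq_trans [trans] = trace_eq.trans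
lemmas teq_append = trace_eq.append

lemma teq_left: "u \<simeq> v \<Longrightarrow> w @ u \<simeq> w @ v"
  by (rule teq_append[OF teq_refl])

lemma teq_right: "u \<simeq> v \<Longrightarrow> u @ w \<simeq> v @ w"
  by (rule teq_append[OF _ teq_refl])

lemma teq_Cons: "u \<simeq> v \<Longrightarrow> a # u \<simeq> a # v"
  using teq_left[of u v "[a]"] by simp

lemma teq_set: "u \<simeq> v \<Longrightarrow> set u = set v"
  by (metis trace_eq_mset set_mset_mset)

lemma teq_length: "u \<simeq> v \<Longrightarrow> length u = length v"
  by (metis trace_eq_mset size_mset)

lemma teq_count: "u \<simeq> v \<Longrightarrow> count_list u a = count_list v a"
  by (metis trace_eq_mset count_mset)

lemma teq_Nil: "u \<simeq> [] \<longleftrightarrow> u = []" "[] \<simeq> u \<longleftrightarrow> u = []"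
  using teq_length teq_refl by fastforce+

lemma teq_remove1: "u \<simeq> v \<Longrightarrow> remove1 a u \<simeq> remove1 a v"
proof (induction rule: trace_eq.induct)
  case (append u u' v v')
  then show ?case
    using teq_set[OF append.hyps(1)] by (auto simp: remove1_append intro: teq_append)
qed (auto intro: trace_eq.intros)

text \<open>
A single commutation exchanges two independent letters, so it leaves the word of all occurrences of
two dependent letters unchanged. These projections are the invariants that control the congruence.
\<close>
lemma teq_filter:
  assumes "u \<simeq> v" "(a, b) \<notin> I"
  shows "filter (\<lambda>x. x = a \<or> x = b) u = filter (\<lambda>x. x = a \<or> x = b) v"
  using assms
proof (induction rule: trace_eq.induct)
  case (swap x y)
  then show ?case using I_sym[of x y] not_I_refl by auto
qed auto

lemma teq_Cons_cancel: "a # u \<simeq> a # v \<Longrightarrow> u \<simeq> v"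
  using teq_remove1[of "a # u" "a # v" a] by simp

lemma teq_cancel: "w @ u \<simeq> w @ v \<Longrightarrow> u \<simeq> v"
  by (induction w) (auto dest: teq_Cons_cancel)

text \<open>
The first \<open>a\<close> of \<open>v\<close> is the initial letter of \<open>a # u\<close>: a letter in front of it that depends on \<open>a\<close> would
show up before \<open>a\<close> in the projection of \<open>v\<close> to these two letters.
\<close>
lemma teq_ConsE:
  assumes "a # u \<simeq> v"
  obtains p q where "v = p @ a # q" "a \<notin> set p" "\<And>b. b \<in> set p \<Longrightarrow> (a, b) \<in> I" "u \<simeq> p @ q"
proof -
  have "a \<in> set v" using teq_set[OF assms] by auto
  then obtain p q where v: "v = p @ a # q" "a \<notin> set p" by (meson split_list_first)
  have "(a, b) \<in> I" if "b \<in> set p" for b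
  proof (rule ccontr)
    assume "(a, b) \<notin> I"
    from teq_filter[OF assms this]
    have *: "a # filter (\<lambda>x. x = a \<or> x = b) u = filter (\<lambda>x. x = a \<or> x = b) p @ filter (\<lambda>x. x = a \<or> x = b) (a # q)"
      by (simp add: v)
    have "filter (\<lambda>x. x = a \<or> x = b) p \<noteq> []" using that by (auto simp: filter_empty_conv)
    with * have "a \<in> set (filter (\<lambda>x. x = a \<or> x = b) p)"
      by (cases "filter (\<lambda>x. x = a \<or> x = b) p") auto
    then show False using v by auto
  qed
  moreover have "u \<simeq> p @ q"
    using teq_remove1[OF assms, of a] v by (simp add: remove1_append)
  ultimately show ?thesis using that v by blast
qed

lemma teq_move_front: "(\<And>b. b \<in> set u \<Longrightarrow> (a, b) \<in> I) \<Longrightarrow> u @ a # v \<simeq> a # u @ v"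
  by (rule trace_eq_move_front) (auto intro: I_sym)

lemma teq_commute: "indep u v \<Longrightarrow> u @ v \<simeq> v @ u"
proof (induction v)
  case (Cons a v)
  have "u @ a # v \<simeq> a # u @ v"
    by (rule teq_move_front) (use Cons.prems in \<open>auto intro: I_sym\<close>)
  also have "\<dots> \<simeq> a # v @ u" by (rule teq_Cons, rule Cons.IH) (use Cons.prems in auto)
  finally show ?case by simp
qed (simp add: teq_refl)

text \<open>
Levi's lemma: two factorisations of a trace have a common refinement. Here \<open>m\<close> is the common part of
\<open>u1\<close> and \<open>u2\<close>, and the parts \<open>p\<close>, \<open>q\<close> that only one of them contains are independent. In the induction, the
first letter of \<open>u1\<close> can be moved to the front of \<open>u2 @ v2\<close>; it comes from \<open>u2\<close>, and then joins \<open>m\<close>, or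
from \<open>v2\<close>, and then joins \<open>p\<close>.
\<close>
lemma levi:
  assumes "u1 @ v1 \<simeq> u2 @ v2"
  shows "\<exists>m p q r. u1 \<simeq> m @ p \<and> u2 \<simeq> m @ q \<and> v1 \<simeq> q @ r \<and> v2 \<simeq> p @ r \<and> indep p q"
  using assms
proof (induction u1 arbitrary: u2 v2)
  case Nil
  have "[] \<simeq> [] @ []" "u2 \<simeq> [] @ u2" "v1 \<simeq> u2 @ v2" "v2 \<simeq> [] @ v2" "indep [] u2"
    using Nil by (auto intro: teq_refl)
  then show ?case by blast
next
  case (Cons a u1)
  from Cons.prems have "a # (u1 @ v1) \<simeq> u2 @ v2" by simp
  then obtain s t where state: "u2 @ v2 = s @ a # t" "a \<notin> set s" "\<And>b. b \<in> set s \<Longrightarrow> (a, b) \<in> I"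
    "u1 @ v1 \<simeq> s @ t" by (rule teq_ConsE) blast
  show ?case
  proof (cases "length s < length u2")
    case True
    then obtain t' where u2: "u2 = s @ a # t'" "t = t' @ v2"
      using state(1) by (auto simp: append_eq_append_conv2 append_eq_Cons_conv)
    have "u1 @ v1 \<simeq> (s @ t') @ v2" using state(4) u2 by simp
    from Cons.IH[OF this] obtain m p q r where
      IH: "u1 \<simeq> m @ p" "s @ t' \<simeq> m @ q" "v1 \<simeq> q @ r" "v2 \<simeq> p @ r" "indep p q" by blast
    have "u2 \<simeq> a # s @ t'" unfolding u2(1) by (rule teq_move_front) (rule state(3))
    also have "\<dots> \<simeq> a # m @ q" by (rule teq_Cons[OF IH(2)])
    finally have "u2 \<simeq> (a # m) @ q" by simp
    moreover have "a # u1 \<simeq> (a # m) @ p" using teq_Cons[OF IH(1)] by simp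
    ultimately show ?thesis using IH by blast
  next
    case False
    then obtain s' where s: "s = u2 @ s'" "v2 = s' @ a # t"
      using state(1) by (auto simp: append_eq_append_conv2 append_eq_Cons_conv)
    have "u1 @ v1 \<simeq> u2 @ (s' @ t)" using state(4) s by simp
    from Cons.IH[OF this] obtain m p q r where
      IH: "u1 \<simeq> m @ p" "u2 \<simeq> m @ q" "v1 \<simeq> q @ r" "s' @ t \<simeq> p @ r" "indep p q" by blast
    have aI: "(a, b) \<in> I" if "b \<in> set m \<union> set q" for b
      using that state(3) teq_set[OF IH(2)] s by auto
    have "a # u1 \<simeq> a # m @ p" by (rule teq_Cons[OF IH(1)])
    also have "\<dots> \<simeq> m @ a # p" by (rule teq_sym, rule teq_move_front) (use aI in auto)
    finally have 1: "a # u1 \<simeq> m @ (a # p)" .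
    have "v2 \<simeq> a # s' @ t" unfolding s(2) by (rule teq_move_front) (use state(3) s in auto)
    also have "\<dots> \<simeq> a # p @ r" by (rule teq_Cons[OF IH(4)])
    finally have 2: "v2 \<simeq> (a # p) @ r" by simp
    have "indep (a # p) q" using aI IH(5) by auto
    with 1 2 IH show ?thesis by blast
  qed
qed

lemma leviE:
  assumes "u1 @ v1 \<simeq> u2 @ v2"
  obtains m p q r where "u1 \<simeq> m @ p" "u2 \<simeq> m @ q" "v1 \<simeq> q @ r" "v2 \<simeq> p @ r" "indep p q"
  using levi[OF assms] by (elim exE conjE) (rule that)

lemma indep_disjoint: "indep u v \<Longrightarrow> set u \<inter> set v = {}"
  using not_I_refl by auto

subsection \<open>Prefix order\<close>

lemma pleI: "u @ z \<simeq> v \<Longrightarrow> u \<preceq> v" by (auto simp: ple_def)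
lemma pleE: "u \<preceq> v \<Longrightarrow> (\<And>z. u @ z \<simeq> v \<Longrightarrow> thesis) \<Longrightarrow> thesis" by (auto simp: ple_def)
lemma ple_teq: "u \<simeq> v \<Longrightarrow> u \<preceq> v" by (rule pleI[of _ "[]"]) simp
lemma ple_refl: "u \<preceq> u" by (rule ple_teq[OF teq_refl])
lemma ple_append: "u \<preceq> u @ v" by (rule pleI[of _ v]) (rule teq_refl)
lemma Nil_ple: "[] \<preceq> u" using ple_append[of "[]" u] by simp

lemma ple_trans [trans]: assumes "u \<preceq> v" "v \<preceq> w" shows "u \<preceq> w"
proof -
  obtain z z' where z: "u @ z \<simeq> v" "v @ z' \<simeq> w" using assms by (auto simp: ple_def)
  have "u @ (z @ z') \<simeq> v @ z'" using teq_right[OF z(1), of z'] by simp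
  with z(2) show ?thesis by (blast intro: pleI teq_trans)
qed

lemma pleI2: assumes "u \<simeq> m" "v \<simeq> m @ q" shows "u \<preceq> v"
  by (rule pleI[of _ q], rule teq_trans[OF teq_right[OF assms(1)] teq_sym[OF assms(2)]])

lemma ple_teq_trans1 [trans]: "u \<simeq> v \<Longrightarrow> v \<preceq> w \<Longrightarrow> u \<preceq> w"
  and ple_teq_trans2 [trans]: "u \<preceq> v \<Longrightarrow> v \<simeq> w \<Longrightarrow> u \<preceq> w"
  by (blast intro: ple_trans ple_teq)+

lemma ple_left: "u \<preceq> v \<Longrightarrow> w @ u \<preceq> w @ v"
  unfolding ple_def by (metis append_assoc teq_left)

lemma ple_cancel: "w @ u \<preceq> w @ v \<Longrightarrow> u \<preceq> v"
  unfolding ple_def by (metis append_assoc teq_cancel)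

lemma ple_length: "u \<preceq> v \<Longrightarrow> length u \<le> length v"
  unfolding ple_def using teq_length by fastforce

lemma ple_set: "u \<preceq> v \<Longrightarrow> set u \<subseteq> set v"
  unfolding ple_def using teq_set by fastforce

lemma ple_length_eq: assumes "u \<preceq> v" "length v \<le> length u" shows "u \<simeq> v"
proof -
  obtain z where z: "u @ z \<simeq> v" using assms by (auto simp: ple_def)
  have "length z = 0" using teq_length[OF z] assms(2) unfolding length_append by linarith
  then show ?thesis using z by simp
qed

lemma ple_antisym: "u \<preceq> v \<Longrightarrow> v \<preceq> u \<Longrightarrow> u \<simeq> v"
  by (rule ple_length_eq) (auto dest: ple_length)

text \<open>
Since \<open>p\<close> and \<open>q\<close> are independent, they can follow \<open>m\<close> in either order; so \<open>m @ p @ q\<close> lies above both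
\<open>u\<close> and \<open>v\<close>.
\<close>
lemma levi_ple:
  assumes "u \<preceq> z" "v \<preceq> z"
  obtains m p q where "u \<simeq> m @ p" "v \<simeq> m @ q" "indep p q" "m @ p @ q \<preceq> z"
proof -
  obtain x y where xy: "u @ x \<simeq> z" "v @ y \<simeq> z" using assms by (auto simp: ple_def)
  then have "u @ x \<simeq> v @ y" by (blast intro: teq_trans teq_sym)
  from leviE[OF this] obtain m p q r where
    *: "u \<simeq> m @ p" "v \<simeq> m @ q" "x \<simeq> q @ r" "y \<simeq> p @ r" "indep p q" .
  have "(m @ p @ q) @ r \<simeq> u @ x" using teq_sym[OF teq_append[OF *(1) *(3)]] by simp
  then have "m @ p @ q \<preceq> z" using xy by (blast intro: pleI teq_trans)
  with * that show ?thesis by blast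
qed

subsection \<open>Traces with a unique maximal letter\<close>

text \<open>
The words with a unique maximal letter, and this letter is \<open>t\<close> (Viennot's pyramids): no nonempty suffix
avoids \<open>t\<close>.
\<close>
definition peaked :: "'a \<Rightarrow> 'a list \<Rightarrow> bool" where
  "peaked t y \<longleftrightarrow> t \<in> set y \<and> (\<forall>u v. y \<simeq> u @ v \<longrightarrow> t \<notin> set v \<longrightarrow> v = [])"

definition strong_top :: "'a \<Rightarrow> 'a list \<Rightarrow> bool" where
  "strong_top t y \<longleftrightarrow> (\<forall>x. peaked t (x @ y))"

lemma peakedD: "peaked t y \<Longrightarrow> y \<simeq> u @ v \<Longrightarrow> t \<notin> set v \<Longrightarrow> v = []"
  by (auto simp: peaked_def)

lemma peaked_teq: "peaked t y \<Longrightarrow> y \<simeq> y' \<Longrightarrow> peaked t y'"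
  unfolding peaked_def by (metis teq_set teq_trans)

text \<open>
The letter \<open>t\<close> linearly orders the traces with peak \<open>t\<close> below a given one. Writing \<open>u1\<close> and \<open>u2\<close> as in
\<open>levi_ple\<close>, the letter \<open>t\<close> cannot occur in both of the independent parts \<open>p\<close> and \<open>q\<close>; by the
assumption on the counts it does not occur in \<open>p\<close>, which is a suffix of \<open>u1\<close> and therefore empty.
\<close>
lemma peaked_ple:
  assumes "u1 \<preceq> z" "u2 \<preceq> z" "peaked t u1" "count_list u1 t \<le> count_list u2 t"
  shows "u1 \<preceq> u2"
proof -
  obtain m p q where *: "u1 \<simeq> m @ p" "u2 \<simeq> m @ q" "indep p q"
    by (rule levi_ple[OF assms(1,2)])
  have "count_list p t \<le> count_list q t"
    using assms(4) teq_count[OF *(1), of t] teq_count[OF *(2), of t] by simp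
  then have "t \<notin> set p"
    using indep_disjoint[OF *(3)] by (metis count_list_0_iff disjoint_iff le_zero_eq)
  then have "p = []" using peakedD[OF assms(3) *(1)] by simp
  then show ?thesis using * pleI2[of u1 m u2 q] by simp
qed

lemma peaked_linear:
  assumes "u1 \<preceq> z" "u2 \<preceq> z" "peaked t u1" "peaked t u2"
  shows "u1 \<preceq> u2 \<or> u2 \<preceq> u1"
  using peaked_ple[OF assms(1,2,3)] peaked_ple[OF assms(2,1,4)] by linarith

text \<open>
The peak \<open>t\<close> of \<open>p\<close> stays below the peak \<open>t'\<close> of \<open>p'\<close>, since the two letters depend on each other.
\<close>
lemma peaked_append:
  assumes "peaked t p" "peaked t' p'" "(t, t') \<notin> I"
  shows "peaked t' (p @ p')"
  unfolding peaked_def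
proof (intro conjI allI impI)
  show "t' \<in> set (p @ p')" using assms(2) by (auto simp: peaked_def)
next
  fix u v assume uv: "p @ p' \<simeq> u @ v" and v: "t' \<notin> set v"
  from leviE[OF uv] obtain m q r s where
    *: "p \<simeq> m @ q" "u \<simeq> m @ r" "p' \<simeq> r @ s" "v \<simeq> q @ s" "indep q r" .
  have "s = []" using peakedD[OF assms(2) *(3)] v teq_set[OF *(4)] by simp
  then have "t' \<in> set r" using assms(2) teq_set[OF *(3)] by (auto simp: peaked_def)
  then have "t \<notin> set q" using *(5) assms(3) by auto
  then have "q = []" using peakedD[OF assms(1) *(1)] by simp
  with \<open>s = []\<close> *(4) show "v = []" by (simp add: teq_Nil)
qed

text \<open>
Nothing in \<open>x\<close> can be moved behind \<open>y\<close>, since \<open>y\<close> contains every letter and no letter is independent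
of itself.
\<close>
lemma strong_topI:
  assumes "peaked t y" "set y = UNIV" shows "strong_top t y"
  unfolding strong_top_def peaked_def
proof (intro conjI allI impI)
  fix x show "t \<in> set (x @ y)" using assms by simp
next
  fix x u v assume uv: "x @ y \<simeq> u @ v" and v: "t \<notin> set v"
  from leviE[OF uv] obtain m q r s where
    *: "x \<simeq> m @ q" "u \<simeq> m @ r" "y \<simeq> r @ s" "v \<simeq> q @ s" "indep q r" .
  have "s = []" using peakedD[OF assms(1) *(3)] v teq_set[OF *(4)] by simp
  then have "set r = UNIV" using assms(2) teq_set[OF *(3)] by simp
  then have "q = []" using *(5) indep_disjoint[OF *(5)] by simp
  with \<open>s = []\<close> *(4) show "v = []" by (simp add: teq_Nil)
qed

lemma strong_top_peaked: "strong_top t p \<Longrightarrow> peaked t (x @ p)" by (simp add: strong_top_def)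

text \<open>
A shortest prefix with at least \<open>n\<close> occurrences of \<open>b\<close> works: removing anything after its last \<open>b\<close>
would give a shorter one.
\<close>
lemma exists_peaked_prefix:
  assumes "n > 0" "n \<le> count_list u b"
  obtains v where "v \<preceq> u" "peaked b v" "count_list v b = n"
proof -
  define P where "P = (\<lambda>v. v \<preceq> u \<and> n \<le> count_list v b)"
  have "P u" using assms ple_refl by (simp add: P_def)
  then obtain v where v: "P v" and min: "\<And>w. P w \<Longrightarrow> length v \<le> length w"
    using ex_has_least_nat[of P u length] by blast
  have less: "\<not> P w" if "w @ s \<simeq> v" "s \<noteq> []" for w s
  proof
    assume "P w"
    then have "length v \<le> length w" by (rule min)
    then have "length s = 0" using teq_length[OF that(1)] unfolding length_append by linarith
    then show False using that(2) by simp
  qed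
  have tv: "s = []" if "v \<simeq> w @ s" "b \<notin> set s" for w s
  proof (rule ccontr)
    assume "s \<noteq> []"
    then have "\<not> P w" using less that(1) teq_sym by blast
    moreover have "w \<preceq> v" using teq_refl that(1) by (rule pleI2)
    then have "w \<preceq> u" using v by (auto simp: P_def intro: ple_trans)
    moreover have "count_list w b = count_list v b" using teq_count[OF that(1), of b] that(2) by simp
    ultimately show False using v by (simp add: P_def)
  qed
  have "b \<in> set v"
  proof (rule ccontr)
    assume "b \<notin> set v"
    then have "count_list v b = 0" by simp
    then show False using v assms(1) by (simp add: P_def)
  qed
  then have top: "peaked b v" using tv by (auto simp: peaked_def)
  have "count_list v b = n"
  proof (rule ccontr)
    assume "count_list v b \<noteq> n"
    then have gt: "count_list v b > n" using v by (simp add: P_def)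
    have ne: "v \<noteq> []" using \<open>b \<in> set v\<close> by auto
    then obtain w c where wc: "v = w @ [c]" by (metis rev_exhaust)
    have "w \<preceq> u" using wc v ple_trans[OF ple_append[of w "[c]"]] by (auto simp: P_def)
    then have "P w" using gt wc by (auto simp: P_def split: if_splits)
    then show False using min[of w] wc by simp
  qed
  with top v that show ?thesis by (auto simp: P_def)
qed

text \<open>
A word \<open>w\<close> which has, for every letter \<open>b\<close>, a prefix with strong peak \<open>b\<close> acts as a barrier. Compare \<open>y\<close>
with \<open>x @ w\<close> by Levi's lemma, and let \<open>p\<close> be the part of \<open>y\<close> outside \<open>x @ w\<close>. If \<open>p\<close> is not empty, then
its first letter \<open>b\<close> is independent of the part \<open>q\<close> of \<open>x @ w\<close> outside \<open>y\<close>, so \<open>q\<close> avoids \<open>b\<close>. A prefix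
\<open>x @ u1\<close> with peak \<open>b\<close> cannot meet \<open>q\<close>; so it lies below \<open>y\<close>.
\<close>
lemma ple_cut:
  assumes w: "\<And>b. \<exists>u1 u2. w = u1 @ u2 \<and> strong_top b u1"
    and y: "y \<preceq> x @ w @ z"
  shows "y \<preceq> x @ w \<or> x \<preceq> y"
proof -
  obtain y' where "y @ y' \<simeq> (x @ w) @ z" using y by (auto simp: ple_def)
  from leviE[OF this] obtain m p q r where
    *: "y \<simeq> m @ p" "x @ w \<simeq> m @ q" "indep p q" .
  show ?thesis
  proof (cases p)
    case Nil
    then show ?thesis using * pleI2[of y m "x @ w" q] by simp
  next
    case (Cons b p')
    obtain u1 u2 where u: "w = u1 @ u2" "strong_top b u1" using w by blast
    have "(x @ u1) @ u2 \<simeq> m @ q" using *(2) u by simp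
    then obtain n s k l where
      **: "x @ u1 \<simeq> n @ s" "m \<simeq> n @ k" "q \<simeq> s @ l" by (rule leviE) (rule that)
    have "b \<notin> set q" using indep_disjoint[OF *(3)] Cons by auto
    then have "b \<notin> set s" by (simp add: teq_set[OF **(3)])
    then have "s = []" using peakedD[OF strong_top_peaked[OF u(2)] **(1)] by simp
    then have "x @ u1 \<simeq> n" using **(1) by simp
    then have "x @ u1 \<preceq> m" using **(2) by (rule pleI2)
    then have "x \<preceq> m" by (rule ple_trans[OF ple_append])
    moreover have "m \<preceq> y" using *(1) teq_refl by (rule pleI2[rotated])
    ultimately have "x \<preceq> y" by (rule ple_trans)
    then show ?thesis by simp
  qed
qed

end

section \<open>Cliques, normal forms and infinite traces\<close>

context trace_alphabet begin

text \<open>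
The minimal letters of a trace. They form its first clique.
\<close>
definition heads :: "'a list \<Rightarrow> 'a set" where
  "heads u = {a. [a] \<preceq> u}"

text \<open>
The enumeration of \<open>c\<close> that \<^const>\<open>clique_trace\<close> uses.
\<close>
definition cw :: "'a set \<Rightarrow> 'a list" where
  "cw c = (SOME w. distinct w \<and> set w = c)"

definition cws :: "'a set list \<Rightarrow> 'a list" where
  "cws cs = concat (map cw cs)"

definition normal :: "'a set list \<Rightarrow> bool" where
  "normal cs \<longleftrightarrow> (\<forall>c\<in>set cs. clique I c \<and> c \<noteq> {}) \<and> successively (clique_arrow I) cs"

lemma cw: "distinct (cw c)" "set (cw c) = c"
proof -
  have "\<exists>w. distinct w \<and> set w = c" using finite_distinct_list[of c] by auto
  from someI_ex[OF this] show "distinct (cw c)" "set (cw c) = c" by (auto simp: cw_def)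
qed

lemma length_cw: "length (cw c) = card c"
  using cw[of c] distinct_card by fastforce

lemma clique_trace_cw: "clique_trace I c = trace_of I (cw c)"
  by (simp add: clique_trace_def cw_def)

lemma cws_simps [simp]: "cws [] = []" "cws (c # cs) = cw c @ cws cs" "cws (cs @ ds) = cws cs @ cws ds"
  by (auto simp: cws_def)

lemma set_cws: "set (cws cs) = \<Union>(set cs)"
  by (induction cs) (auto simp: cw)

lemma cliques_prod_cws: "cliques_prod I cs = trace_of I (cws cs)"
  by (induction cs) (auto simp: cliques_prod_def clique_trace_cw one_trace_monoid)

lemma teq_singleton: "[a] \<simeq> u \<longleftrightarrow> u = [a]"
proof
  assume "[a] \<simeq> u"
  from teq_length[OF this] teq_set[OF this] show "u = [a]"
    by (cases u) auto
qed (simp add: teq_refl)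

lemma heads_teq: "u \<simeq> v \<Longrightarrow> heads u = heads v"
  unfolding heads_def using ple_teq_trans2[of "[_]" u v] ple_teq_trans2[of "[_]" v u] teq_sym[of I u v] by auto

lemma heads_mono: "u \<preceq> v \<Longrightarrow> heads u \<subseteq> heads v"
  by (auto simp: heads_def intro: ple_trans)

lemma heads_subset: "heads u \<subseteq> set u"
  using ple_set by (fastforce simp: heads_def)

lemma singleton_ple_append:
  "[a] \<preceq> u @ v \<longleftrightarrow> [a] \<preceq> u \<or> (a \<notin> set u \<and> [a] \<preceq> v \<and> (\<forall>b\<in>set u. (a, b) \<in> I))" (is "?L \<longleftrightarrow> ?A \<or> ?B")
proof
  assume ?L
  then obtain z where "[a] @ z \<simeq> u @ v" by (rule pleE)
  then obtain m p q r where *: "[a] \<simeq> m @ p" "u \<simeq> m @ q" "z \<simeq> q @ r" "v \<simeq> p @ r" "indep p q"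
    by (rule leviE)
  have mp: "m @ p = [a]" using *(1) by (simp add: teq_singleton)
  show "?A \<or> ?B"
  proof (cases m)
    case Nil
    then have p: "p = [a]" using mp by simp
    have "set u = set q" using teq_set[OF *(2)] Nil by simp
    then have "\<forall>b\<in>set u. (a, b) \<in> I" using *(5) p by auto
    moreover from this have "a \<notin> set u" using not_I_refl by auto
    moreover have "[a] \<preceq> v" using pleI[OF teq_sym[OF *(4)]] p by simp
    ultimately show ?thesis by simp
  next
    case (Cons b m')
    then have "m = [a]" using mp by simp
    then show ?thesis using pleI[OF teq_sym[OF *(2)]] by simp
  qed
next
  assume "?A \<or> ?B"
  then show ?L
  proof
    assume ?A then show ?L by (rule ple_trans[OF _ ple_append])
  next
    assume B: ?B
    then obtain z where z: "[a] @ z \<simeq> v" by (auto elim: pleE)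
    have "[a] @ (u @ z) \<simeq> u @ a # z"
      using teq_move_front[of u a z] B by (auto intro: teq_sym)
    also have "u @ a # z \<simeq> u @ v" using teq_left[OF z, of u] by simp
    finally show ?L by (rule pleI)
  qed
qed

lemma heads_append:
  "a \<in> heads (u @ v) \<longleftrightarrow> a \<in> heads u \<or> (a \<notin> set u \<and> a \<in> heads v \<and> (\<forall>b\<in>set u. (a, b) \<in> I))"
  unfolding heads_def using singleton_ple_append by simp

lemma heads_Nil [simp]: "heads [] = {}"
  using heads_subset[of "[]"] by simp

lemma heads_Cons: "a \<in> heads (a # u)"
  unfolding heads_def using ple_append[of "[a]" u] by simp

lemma heads_nonempty: "u \<noteq> [] \<Longrightarrow> heads u \<noteq> {}"
  using heads_Cons by (cases u) auto

text \<open>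
By Levi's lemma, two different letters below the same trace are independent.
\<close>
lemma clique_heads: "clique I (heads u)"
  unfolding clique_def pairwise_def
proof (intro ballI impI)
  fix a b assume ab: "a \<in> heads u" "b \<in> heads u" "a \<noteq> b"
  then have "[a] \<preceq> u" "[b] \<preceq> u" by (auto simp: heads_def)
  then obtain m p q where *: "[a] \<simeq> m @ p" "[b] \<simeq> m @ q" "indep p q" by (rule levi_ple)
  then have "m @ p = [a]" "m @ q = [b]" by (auto simp: teq_singleton)
  then have "p = [a]" "q = [b]" using ab(3) by (auto simp: append_eq_Cons_conv)
  then show "(a, b) \<in> I" using *(3) by auto
qed

lemma clique_word_ple:
  assumes "distinct w" "clique I (set w)" "set w \<subseteq> heads u" shows "w \<preceq> u"
  using assms
proof (induction w)
  case Nil then show ?case by (simp add: Nil_ple)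
next
  case (Cons a w)
  have "w \<preceq> u" using Cons by (auto simp: clique_def pairwise_def)
  moreover have "[a] \<preceq> u" using Cons.prems by (auto simp: heads_def)
  ultimately obtain m p q where *: "w \<simeq> m @ p" "[a] \<simeq> m @ q" "indep p q" "m @ p @ q \<preceq> u"
    by (rule levi_ple)
  have mq: "m @ q = [a]" using *(2) by (simp add: teq_singleton)
  have "a \<notin> set m" using teq_set[OF *(1)] Cons.prems by auto
  then have "m = []" "q = [a]" using mq by (auto simp: append_eq_Cons_conv)
  then have wp: "w \<simeq> p" "p @ [a] \<preceq> u" using * by auto
  have "(a, b) \<in> I" if "b \<in> set w" for b
    using that Cons.prems by (auto simp: clique_def pairwise_def)
  then have "w @ [a] \<simeq> a # w" using teq_move_front[of w a "[]"] by simp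
  then have "a # w \<preceq> w @ [a]" by (rule ple_teq[OF teq_sym])
  also have "w @ [a] \<simeq> p @ [a]" by (rule teq_right[OF wp(1)])
  also have "p @ [a] \<preceq> u" by (rule wp(2))
  finally show ?case .
qed

lemma heads_clique_word:
  assumes "distinct w" "clique I (set w)" shows "heads w = set w"
proof
  show "set w \<subseteq> heads w"
  proof
    fix a assume "a \<in> set w"
    then obtain p q where w: "w = p @ a # q" by (metis split_list)
    have "w \<simeq> a # p @ q" unfolding w
      by (rule teq_move_front) (use assms w in \<open>auto simp: clique_def pairwise_def\<close>)
    then show "a \<in> heads w" using heads_teq heads_Cons by blast
  qed
qed (rule heads_subset)

lemma heads_cw: "clique I c \<Longrightarrow> heads (cw c) = c"
  using heads_clique_word[OF cw(1)] by (simp add: cw)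

lemma cw_ple_iff: "clique I c \<Longrightarrow> cw c \<preceq> u \<longleftrightarrow> c \<subseteq> heads u"
  using clique_word_ple[OF cw(1), of c u] heads_mono[of "cw c" u] heads_cw[of c] by (auto simp: cw)

lemma clique_subset: "clique I c \<Longrightarrow> d \<subseteq> c \<Longrightarrow> clique I d"
  by (auto simp: clique_def pairwise_def)

subsection \<open>Normal forms\<close>

lemma normal_simps [simp]: "normal []"
  "normal (c # cs) \<longleftrightarrow> clique I c \<and> c \<noteq> {} \<and> normal cs \<and> (cs \<noteq> [] \<longrightarrow> clique_arrow I c (hd cs))"
  by (auto simp: normal_def successively_Cons)

lemma normal_append: "normal (cs @ ds) \<longleftrightarrow> normal cs \<and> normal ds \<and>
   (cs \<noteq> [] \<longrightarrow> ds \<noteq> [] \<longrightarrow> clique_arrow I (last cs) (hd ds))"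
  by (auto simp: normal_def successively_append_iff)

text \<open>
A letter that is minimal in the product but not in \<open>c\<close> would be a minimal letter of the rest, hence in
the second clique, and independent of all of \<open>c\<close>. The arrow from \<open>c\<close> to the second clique excludes this.
\<close>
lemma heads_cws:
  assumes "normal cs" "cs \<noteq> []" shows "heads (cws cs) = hd cs"
  using assms
proof (induction cs)
  case (Cons c cs)
  have "a \<in> c" if a: "a \<in> heads (cw c @ cws cs)" for a
  proof (rule ccontr)
    assume "a \<notin> c"
    then have *: "a \<in> heads (cws cs)" "\<forall>b\<in>c. (a, b) \<in> I"
      using a Cons.prems by (auto simp: heads_append heads_cw cw)
    then have "cs \<noteq> []" by auto
    then have "a \<in> hd cs" "clique_arrow I c (hd cs)" using * Cons by auto
    then show False using *(2) I_sym by (auto simp: clique_arrow_def)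
  qed
  moreover have "c \<subseteq> heads (cw c @ cws cs)" using Cons.prems by (auto simp: heads_append heads_cw)
  ultimately show ?case by auto
qed simp

lemma cws_eq_Nil: "normal cs \<Longrightarrow> cws cs = [] \<longleftrightarrow> cs = []"
proof (cases cs)
  case (Cons c ds)
  assume "normal cs"
  then have "set (cw c) \<noteq> {}" using Cons by (simp add: cw)
  then show ?thesis using Cons by auto
qed simp

text \<open>
Split off the clique of all minimal letters and repeat.
\<close>
lemma normal_form_exists: "\<exists>cs. normal cs \<and> cws cs \<simeq> u"
proof (induction "length u" arbitrary: u rule: less_induct)
  case less
  show ?case
  proof (cases "u = []")
    case True
    then show ?thesis by (intro exI[of _ "[]"]) (simp add: teq_refl)
  next
    case False
    let ?c = "heads u"
    have c: "clique I ?c" "?c \<noteq> {}" using clique_heads heads_nonempty False by auto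
    have "cw ?c \<preceq> u" using cw_ple_iff[OF c(1)] by simp
    then obtain z where z: "cw ?c @ z \<simeq> u" by (rule pleE)
    have "length (cw ?c) > 0" using c(2) by (simp add: length_cw card_gt_0_iff)
    then have "length z < length u" using teq_length[OF z] unfolding length_append by linarith
    from less[OF this] obtain cs where cs: "normal cs" "cws cs \<simeq> z" by blast
    have "clique_arrow I ?c (hd cs)" if "cs \<noteq> []"
      unfolding clique_arrow_def
    proof (rule ballI, rule ccontr)
      fix b assume b: "b \<in> hd cs" and "\<not> (\<exists>a\<in>?c. (a, b) \<notin> I)"
      then have I: "\<forall>a\<in>?c. (b, a) \<in> I" using I_sym by blast
      have "b \<in> heads z" using heads_cws[OF cs(1) that] heads_teq[OF cs(2)] b by simp
      moreover have "b \<notin> ?c" using I not_I_refl by blast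
      ultimately have "b \<in> heads (cw ?c @ z)" using I by (simp add: heads_append cw)
      then have "b \<in> ?c" using heads_teq[OF z] by simp
      then show False using \<open>b \<notin> ?c\<close> by simp
    qed
    then have "normal (?c # cs)" using c cs by simp
    moreover have "cws (?c # cs) \<simeq> u"
      using teq_trans[OF teq_left[OF cs(2), of "cw ?c"] z] by simp
    ultimately show ?thesis by blast
  qed
qed

lemma normal_form_unique:
  "normal cs \<Longrightarrow> normal ds \<Longrightarrow> cws cs \<simeq> cws ds \<Longrightarrow> cs = ds"
proof (induction cs arbitrary: ds)
  case Nil
  then show ?case by (simp add: teq_Nil cws_eq_Nil)
next
  case (Cons c cs)
  show ?case
  proof (cases ds)
    case Nil
    then show ?thesis using Cons.prems cws_eq_Nil[of "c # cs"] teq_Nil(1)[of "cws (c # cs)"] by simp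
  next
    case (Cons d ds')
    have "c = d" using heads_cws[OF \<open>normal (c # cs)\<close>] heads_cws[OF \<open>normal ds\<close>]
        heads_teq[OF Cons.prems(3)] Cons by simp
    moreover have "cws cs \<simeq> cws ds'"
      using Cons.prems(3) \<open>c = d\<close> \<open>ds = d # ds'\<close> teq_cancel[of "cw c"] by simp
    then have "cs = ds'" using Cons.IH Cons.prems \<open>ds = d # ds'\<close> by simp
    ultimately show ?thesis using \<open>ds = d # ds'\<close> by simp
  qed
qed

lemma normal_form_eq:
  assumes "normal cs" "cws cs \<simeq> u" shows "normal_form I (trace_of I u) = cs"
  unfolding normal_form_def
proof (rule the_equality)
  show "(\<forall>c\<in>set cs. clique I c \<and> c \<noteq> {}) \<and> successively (clique_arrow I) cs \<and> cliques_prod I cs = trace_of I u"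
    using assms by (auto simp: normal_def cliques_prod_cws trace_of_eq_iff)
next
  fix ds assume "(\<forall>c\<in>set ds. clique I c \<and> c \<noteq> {}) \<and> successively (clique_arrow I) ds \<and> cliques_prod I ds = trace_of I u"
  then have d: "normal ds" "cws ds \<simeq> u" by (auto simp: normal_def cliques_prod_cws trace_of_eq_iff)
  show "ds = cs" by (rule normal_form_unique[OF d(1) assms(1) teq_trans[OF d(2) teq_sym[OF assms(2)]]])
qed

lemma layer_0: "layer I (trace_of I u) 0 = heads u"
proof -
  obtain cs where cs: "normal cs" "cws cs \<simeq> u" using normal_form_exists by blast
  then show ?thesis using heads_cws[OF cs(1)] heads_teq[OF cs(2)]
    by (cases cs) (auto simp: layer_def normal_form_eq[OF cs])
qed

text \<open>
The first clique of \<open>cs\<close> contains all minimal letters of \<open>u\<close>, so it uses up at least one letter of \<open>u\<close>,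
and the part of \<open>u\<close> that remains lies below the remaining cliques. Therefore \<open>length u\<close> cliques suffice.
\<close>
lemma ple_cws_take:
  "normal cs \<Longrightarrow> u \<preceq> cws cs \<Longrightarrow> u \<preceq> cws (take (length u) cs)"
proof (induction "length u" arbitrary: u cs rule: less_induct)
  case less
  show ?case
  proof (cases "u = [] \<or> cs = []")
    case True
    then show ?thesis using less.prems Nil_ple by auto
  next
    case False
    then obtain c cs' where cs: "cs = c # cs'" by (cases cs) auto
    have c: "clique I c" "normal cs'" using less.prems cs by auto
    have "cw c \<preceq> cws cs" using ple_append cs by simp
    with less.prems(2) obtain m p q where
      *: "u \<simeq> m @ p" "cw c \<simeq> m @ q" "indep p q" "m @ p @ q \<preceq> cws cs" by (rule levi_ple)
    have "m \<noteq> []"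
    proof
      assume m: "m = []"
      obtain a where a: "a \<in> heads u" using heads_nonempty False by blast
      then have "a \<in> c" using heads_mono[OF less.prems(2)] heads_cws[OF less.prems(1)] cs by auto
      then have "a \<in> set q" using teq_set[OF *(2)] m by (simp add: cw)
      moreover have "a \<in> set p" using a heads_subset teq_set[OF *(1)] m by auto
      ultimately show False using indep_disjoint[OF *(3)] by auto
    qed
    then have len: "length p < length u" using teq_length[OF *(1)] by (cases m) auto
    have "indep q p" using *(3) I_sym by auto
    have mpq: "cw c @ p \<simeq> m @ p @ q"
      using teq_trans[OF teq_right[OF *(2), of p]] teq_left[OF teq_commute[OF \<open>indep q p\<close>], of m] by simp
    have "cw c @ p \<preceq> cw c @ cws cs'" using ple_teq_trans1[OF mpq *(4)] cs by simp
    then have "p \<preceq> cws cs'" by (rule ple_cancel)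
    from less.hyps[OF len c(2) this] have "p \<preceq> cws (take (length p) cs')" .
    moreover have "cws (take (length p) cs') \<preceq> cws (take (length u - 1) cs')"
    proof -
      have "take (length u - 1) cs' = take (length p) cs' @ take (length u - 1 - length p) (drop (length p) cs')"
        using len take_add[of "length p" "length u - 1 - length p" cs'] by simp
      then show ?thesis using ple_append by simp
    qed
    ultimately have "p \<preceq> cws (take (length u - 1) cs')" by (rule ple_trans)
    from ple_left[OF this, of "cw c"] have 1: "cw c @ p \<preceq> cws (take (length u) cs)"
      using cs False by (cases u) auto
    have "u \<preceq> m @ p @ q" using *(1) teq_refl[of I "m @ p @ q"] pleI2[of u "m @ p" "m @ p @ q" q] by simp
    also have "m @ p @ q \<simeq> cw c @ p" by (rule teq_sym[OF mpq])
    also note 1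
    finally show ?thesis .
  qed
qed

subsection \<open>Prefixes of infinite traces\<close>

definition pre :: "'a list \<Rightarrow> (nat \<Rightarrow> 'a set) \<Rightarrow> bool" where
  "pre u \<omega> \<longleftrightarrow> le_inf I (trace_of I u) \<omega>"

text \<open>
The word $C_1(\omega)\cdots C_n(\omega)$.
\<close>
definition layers :: "(nat \<Rightarrow> 'a set) \<Rightarrow> nat \<Rightarrow> 'a list" where
  "layers \<omega> n = cws (map \<omega> [0..<n])"

lemma trace_le_iff: "trace_le I (trace_of I u) (trace_of I v) \<longleftrightarrow> u \<preceq> v"
  unfolding trace_le_def carrier_trace_monoid ple_def
  by (auto simp: trace_of_eq_iff intro: teq_sym)

lemma pre_iff: "pre u \<omega> \<longleftrightarrow> (\<exists>n. u \<preceq> layers \<omega> n)"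
  by (simp add: pre_def le_inf_def cliques_prod_cws trace_le_iff layers_def)

lemma layers_0 [simp]: "layers \<omega> 0 = []" by (simp add: layers_def)

lemma layers_add: "layers \<omega> (m + n) = layers \<omega> m @ cws (map \<omega> [m..<m+n])"
  by (simp add: layers_def upt_add_eq_append[of 0 m n, simplified])

lemma layers_Suc: "layers \<omega> (Suc n) = layers \<omega> n @ cw (\<omega> n)"
  by (simp add: layers_def)

lemma layers_mono: "m \<le> n \<Longrightarrow> layers \<omega> m \<preceq> layers \<omega> n"
  using layers_add[of \<omega> m "n - m"] ple_append by simp

lemma layers_shift: "layers \<omega> (Suc n) = cw (\<omega> 0) @ layers (\<lambda>i. \<omega> (Suc i)) n"
proof -
  have "[0..<Suc n] = 0 # map Suc [0..<n]" by (simp add: map_Suc_upt upt_conv_Cons)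
  then show ?thesis by (simp add: layers_def comp_def del: upt_Suc)
qed

lemma pre_layers: "pre (layers \<omega> n) \<omega>" using ple_refl pre_iff by blast

lemma pre_Nil [simp]: "pre [] \<omega>" using Nil_ple pre_iff by blast

lemma pre_ple: "u \<preceq> v \<Longrightarrow> pre v \<omega> \<Longrightarrow> pre u \<omega>"
  unfolding pre_iff using ple_trans by blast

lemma pre_teq: "u \<simeq> v \<Longrightarrow> pre u \<omega> \<longleftrightarrow> pre v \<omega>"
  using pre_ple ple_teq teq_sym by blast

lemma pre_appendD: "pre (u @ v) \<omega> \<Longrightarrow> pre u \<omega>"
  by (rule pre_ple[OF ple_append])

lemma pre_directed:
  assumes "pre u \<omega>" "pre v \<omega>" obtains z where "u \<preceq> z" "v \<preceq> z" "pre z \<omega>"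
proof -
  obtain n m where "u \<preceq> layers \<omega> n" "v \<preceq> layers \<omega> m" using assms by (auto simp: pre_iff)
  then have "u \<preceq> layers \<omega> (max n m)" "v \<preceq> layers \<omega> (max n m)"
    using layers_mono ple_trans by (meson max.cobounded1 max.cobounded2)+
  then show ?thesis using that pre_layers by blast
qed

lemma boundaryD:
  assumes "\<omega> \<in> boundary I"
  shows "clique I (\<omega> i)" "\<omega> i \<noteq> {}" "clique_arrow I (\<omega> i) (\<omega> (Suc i))"
  using assms by (auto simp: boundary_def)

lemma boundary_shift: "\<omega> \<in> boundary I \<Longrightarrow> (\<lambda>i. \<omega> (Suc i)) \<in> boundary I"
  by (simp add: boundary_def)

lemma normal_map:
  assumes "\<omega> \<in> boundary I" shows "normal (map \<omega> [m..<n])"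
  using boundaryD[OF assms]
  by (auto simp: normal_def successively_conv_nth)

lemma length_layers_ge: assumes "\<omega> \<in> boundary I" shows "n \<le> length (layers \<omega> n)"
proof (induction n)
  case (Suc n)
  have "card (\<omega> n) > 0" using boundaryD[OF assms] by (simp add: card_gt_0_iff)
  then show ?case using Suc by (simp add: layers_Suc length_cw)
qed simp

lemma length_layers_le: "length (layers \<omega> n) \<le> n * CARD('a)"
proof (induction n)
  case (Suc n)
  have "card (\<omega> n) \<le> CARD('a)" by (simp add: card_mono)
  then show ?case using Suc by (simp add: layers_Suc length_cw)
qed simp

lemma pre_length:
  assumes "\<omega> \<in> boundary I" "pre u \<omega>" shows "u \<preceq> layers \<omega> (length u)"
proof -
  obtain n where n: "u \<preceq> layers \<omega> n" using assms by (auto simp: pre_iff)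
  from ple_cws_take[OF normal_map[OF assms(1)] n[unfolded layers_def]]
  have "u \<preceq> layers \<omega> (min n (length u))"
    by (cases "n \<le> length u") (simp_all add: layers_def take_map min_def)
  also have "\<dots> \<preceq> layers \<omega> (length u)" by (rule layers_mono) simp
  finally show ?thesis .
qed

text \<open>
For \<open>y\<close> below \<open>\<omega>\<close>, this is the first clique of what remains of \<open>\<omega>\<close> after \<open>y\<close>. It makes events about
layers accessible to cylinders: fixing the layers of \<open>\<omega>\<close> amounts to fixing a finite trace below \<open>\<omega>\<close>
and the next clique after it (\<open>layers_determined\<close>).
\<close>
definition next_clique :: "'a list \<Rightarrow> (nat \<Rightarrow> 'a set) \<Rightarrow> 'a set" where
  "next_clique y \<omega> = {a. pre (y @ [a]) \<omega>}"

lemma next_clique_alt: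
  assumes "y @ x \<preceq> layers \<omega> n" shows "heads x \<subseteq> next_clique y \<omega>"
  using assms ple_left[of "[_]" x y] unfolding next_clique_def heads_def pre_iff by (auto intro: ple_trans)

lemma next_clique_layers:
  assumes "\<omega> \<in> boundary I" shows "next_clique (layers \<omega> n) \<omega> = \<omega> n"
proof
  show "\<omega> n \<subseteq> next_clique (layers \<omega> n) \<omega>"
    using next_clique_alt[of "layers \<omega> n" "cw (\<omega> n)" \<omega> "Suc n"] ple_refl heads_cw boundaryD[OF assms] by (simp add: layers_Suc)
  show "next_clique (layers \<omega> n) \<omega> \<subseteq> \<omega> n"
  proof
    fix a assume "a \<in> next_clique (layers \<omega> n) \<omega>"
    then obtain N where N: "layers \<omega> n @ [a] \<preceq> layers \<omega> N" by (auto simp: next_clique_def pre_iff)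
    then have "layers \<omega> n @ [a] \<preceq> layers \<omega> (n + Suc N)" by (rule ple_trans) (rule layers_mono, simp)
    then have "[a] \<preceq> cws (map \<omega> [n..<n + Suc N])" unfolding layers_add by (rule ple_cancel)
    then have "a \<in> heads (cws (map \<omega> [n..<n + Suc N]))" by (simp add: heads_def)
    then show "a \<in> \<omega> n" using heads_cws[OF normal_map[OF assms, of n "n + Suc N"]]
      by (simp add: hd_map del: upt_Suc)
  qed
qed

lemma pre_shift:
  assumes "\<omega> 0 = c" shows "pre (cw c @ v) \<omega> \<longleftrightarrow> pre v (\<lambda>i. \<omega> (Suc i))"
proof
  assume "pre (cw c @ v) \<omega>"
  then obtain n where "cw c @ v \<preceq> layers \<omega> n" by (auto simp: pre_iff)
  then have "cw c @ v \<preceq> layers \<omega> (Suc n)" using layers_mono[of n "Suc n" \<omega>] ple_trans by auto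
  then have "v \<preceq> layers (\<lambda>i. \<omega> (Suc i)) n" unfolding layers_shift assms by (rule ple_cancel)
  then show "pre v (\<lambda>i. \<omega> (Suc i))" by (auto simp: pre_iff)
next
  assume "pre v (\<lambda>i. \<omega> (Suc i))"
  then obtain n where "v \<preceq> layers (\<lambda>i. \<omega> (Suc i)) n" by (auto simp: pre_iff)
  from ple_left[OF this, of "cw c"] have "cw c @ v \<preceq> layers \<omega> (Suc n)" unfolding layers_shift assms .
  then show "pre (cw c @ v) \<omega>" by (auto simp: pre_iff)
qed

text \<open>
Induction from the front. The first layer of \<open>\<omega>\<close> contains the first clique \<open>c\<close>. A further letter of the
first layer would be independent of all cliques in \<open>c # cs\<close> and hence available after them, that is, it
would belong to \<open>d\<close>; but every letter of \<open>d\<close> depends on a letter of the clique before \<open>d\<close>.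
\<close>
lemma layers_determined:
  assumes "\<omega> \<in> boundary I" "normal (cs @ [d])" "pre (cws cs) \<omega>" "next_clique (cws cs) \<omega> = d"
  shows "map \<omega> [0..<Suc (length cs)] = cs @ [d]"
  using assms
proof (induction cs arbitrary: \<omega>)
  case Nil
  then show ?case using next_clique_layers[of \<omega> 0] by simp
next
  case (Cons c cs)
  let ?\<omega> = "\<lambda>i. \<omega> (Suc i)"
  have D0: "next_clique [] \<omega> = \<omega> 0" using next_clique_layers[of \<omega> 0] Cons.prems by simp
  have c: "clique I c" using Cons.prems by simp
  have "\<omega> 0 = c"
  proof
    have "cw c \<preceq> cws (c # cs)" using ple_append by simp
    then have "pre (cw c) \<omega>" using Cons.prems(3) by (rule pre_ple)
    then show "c \<subseteq> \<omega> 0" unfolding D0[symmetric] using next_clique_alt[of "[]" "cw c" \<omega>] heads_cw[OF c]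
      by (auto simp: pre_iff)
    show "\<omega> 0 \<subseteq> c"
    proof (rule subsetI, rule ccontr)
      fix a assume a: "a \<in> \<omega> 0" "a \<notin> c"
      then have "pre [a] \<omega>" using D0 by (auto simp: next_clique_def)
      with Cons.prems(3) obtain z where z: "cws (c # cs) \<preceq> z" "[a] \<preceq> z" "pre z \<omega>" by (rule pre_directed)
      obtain x where x: "cws (c # cs) @ x \<simeq> z" using z(1) by (rule pleE)
      have "a \<in> heads (cws (c # cs) @ x)" using z(2) heads_teq[OF x] by (simp add: heads_def)
      moreover have "heads (cws (c # cs)) = c"
        using heads_cws[of "c # cs"] Cons.prems(2) normal_append[of "c # cs" "[d]"] by simp
      ultimately have *: "a \<in> heads x" "\<forall>b\<in>set (cws (c # cs)). (a, b) \<in> I"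
        using a(2) heads_append[of a "cws (c # cs)" x] by auto
      have "cws (c # cs) @ [a] \<preceq> cws (c # cs) @ x" using *(1) ple_left by (simp add: heads_def)
      then have "pre (cws (c # cs) @ [a]) \<omega>" using x z(3) pre_ple ple_teq_trans2 by blast
      then have "a \<in> d" using Cons.prems(4) by (auto simp: next_clique_def)
      moreover have "clique_arrow I (last (c # cs)) d" using Cons.prems(2) normal_append[of "c # cs" "[d]"] by simp
      ultimately obtain b where "b \<in> last (c # cs)" "(b, a) \<notin> I" by (auto simp: clique_arrow_def)
      moreover have "last (c # cs) \<subseteq> set (cws (c # cs))" unfolding set_cws by (metis Union_upper last_in_set list.distinct(1))
      ultimately show False using *(2) I_sym by blast
    qed
  qed
  have "pre (cws cs) ?\<omega>" using Cons.prems(3) pre_shift[where \<omega> = \<omega> and c = c, OF \<open>\<omega> 0 = c\<close>] by simp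
  moreover have "next_clique (cws cs) ?\<omega> = d"
    using Cons.prems(4) pre_shift[where \<omega> = \<omega> and c = c, OF \<open>\<omega> 0 = c\<close>] by (simp add: next_clique_def)
  ultimately have "map ?\<omega> [0..<Suc (length cs)] = cs @ [d]"
    using Cons.IH[OF boundary_shift[OF Cons.prems(1)]] Cons.prems(2) by simp
  moreover have "map \<omega> [0..<Suc (length (c # cs))] = c # map ?\<omega> [0..<Suc (length cs)]"
  proof -
    have "[0..<Suc (length (c # cs))] = 0 # map Suc [0..<Suc (length cs)]"
      unfolding map_Suc_upt by (simp add: upt_conv_Cons del: upt_Suc)
    then show ?thesis using \<open>\<omega> 0 = c\<close> by (simp add: comp_def del: upt_Suc)
  qed
  ultimately show ?case by simp
qed

text \<open>
Finitely many letters that can follow \<open>y\<close> separately occur after \<open>y\<close> within a common finite number of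
layers, and minimal letters that form a clique can be taken together.
\<close>
lemma next_clique_ge:
  assumes "pre y \<omega>" "clique I c"
  shows "pre (y @ cw c) \<omega> \<longleftrightarrow> c \<subseteq> next_clique y \<omega>"
proof
  assume "pre (y @ cw c) \<omega>"
  then show "c \<subseteq> next_clique y \<omega>" using next_clique_alt[of y "cw c"] heads_cw[OF assms(2)] by (auto simp: pre_iff)
next
  assume c: "c \<subseteq> next_clique y \<omega>"
  have "\<forall>a\<in>c. \<exists>n. y @ [a] \<preceq> layers \<omega> n" using c by (auto simp: next_clique_def pre_iff)
  then obtain N where N: "\<And>a. a \<in> c \<Longrightarrow> y @ [a] \<preceq> layers \<omega> (N a)" by metis
  obtain n0 where n0: "y \<preceq> layers \<omega> n0" using assms(1) by (auto simp: pre_iff)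
  define M where "M = Max (insert n0 (N ` c))"
  have M: "N a \<le> M" if "a \<in> c" for a using that by (auto simp: M_def)
  have "n0 \<le> M" by (simp add: M_def)
  then have "y \<preceq> layers \<omega> M" using n0 layers_mono ple_trans by blast
  then obtain x where x: "y @ x \<simeq> layers \<omega> M" by (rule pleE)
  have "a \<in> heads x" if "a \<in> c" for a
  proof -
    have "y @ [a] \<preceq> layers \<omega> M" using N[OF that] M[OF that] layers_mono ple_trans by blast
    also have "layers \<omega> M \<simeq> y @ x" by (rule teq_sym[OF x])
    finally show ?thesis using ple_cancel by (simp add: heads_def)
  qed
  then have "cw c \<preceq> x" using cw_ple_iff[OF assms(2)] by auto
  then have "y @ cw c \<preceq> layers \<omega> M" using ple_left x ple_teq_trans2 by blast
  then show "pre (y @ cw c) \<omega>" by (auto simp: pre_iff)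
qed

lemma clique_next_clique: assumes "pre y \<omega>" shows "clique I (next_clique y \<omega>)"
  unfolding clique_def pairwise_def
proof (intro ballI impI)
  fix a b assume ab: "a \<in> next_clique y \<omega>" "b \<in> next_clique y \<omega>" "a \<noteq> b"
  then obtain z where z: "y @ [a] \<preceq> z" "y @ [b] \<preceq> z" by (auto simp: next_clique_def elim: pre_directed)
  have "y \<preceq> z" using z(1) ple_append ple_trans by blast
  then obtain x where x: "y @ x \<simeq> z" by (rule pleE)
  have "a \<in> heads x" "b \<in> heads x" using z ple_teq_trans2[OF _ teq_sym[OF x]] ple_cancel
    by (auto simp: heads_def)
  then show "(a, b) \<in> I" using clique_heads ab(3) by (auto simp: clique_def pairwise_def)
qed

end

section \<open>Markov measures on cylinders\<close>

lemma finite_lists_length: "finite {xs :: 'b::finite list. length xs = n}"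
  using finite_lists_length_eq[of "UNIV :: 'b set" n] by simp

locale markov_system =
  fixes I :: "('a::finite \<times> 'a) set" and act :: "('a, 's::finite) action" and \<nu> :: "('a, 's) measure_family"
  assumes irreducible: "irreducible_system I act" and markov: "markov_measure I act \<nu>"
begin

sublocale trace_alphabet I
  using irreducible by unfold_locales (auto simp: irreducible_system_def concurrent_system_def)

definition state :: "'s \<Rightarrow> 'a list \<Rightarrow> 's option" where
  "state \<alpha> u = act (Some \<alpha>) (trace_of I u)"

definition f :: "'s \<Rightarrow> 'a list \<Rightarrow> real" where
  "f \<alpha> u = measure (\<nu> \<alpha>) (cylinder I (trace_of I u))"

lemma in_carrier [simp]: "trace_of I u \<in> carrier (trace_monoid I)"
  by (simp add: carrier_trace_monoid)

lemma concurrent: "concurrent_system I act"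
  using irreducible by (simp add: irreducible_system_def)

lemma state_Nil [simp]: "state \<alpha> [] = Some \<alpha>"
  using concurrent by (simp add: state_def concurrent_system_def one_trace_monoid)

lemma state_append: "state \<alpha> (u @ v) = (case state \<alpha> u of None \<Rightarrow> None | Some \<beta> \<Rightarrow> state \<beta> v)"
proof -
  have *: "act s (x \<cdot>\<^bsub>I\<^esub> y) = act (act s x) y" "act None x = None"
    if "x \<in> carrier (trace_monoid I)" "y \<in> carrier (trace_monoid I)" for s x y
    using concurrent that by (auto simp: concurrent_system_def)
  have "state \<alpha> (u @ v) = act (state \<alpha> u) (trace_of I v)"
    using *(1)[of "trace_of I u" "trace_of I v" "Some \<alpha>"] by (simp add: state_def)
  then show ?thesis using *(2)[of "trace_of I v" "trace_of I v"]
    by (cases "state \<alpha> u") (simp_all add: state_def)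
qed

lemma state_append_Some: "state \<alpha> u = Some \<beta> \<Longrightarrow> state \<alpha> (u @ v) = state \<beta> v"
  by (simp add: state_append)

lemma state_teq: "u \<simeq> v \<Longrightarrow> state \<alpha> u = state \<alpha> v"
  unfolding state_def trace_of_eq_iff[symmetric] by simp

lemma state_prefix: "state \<alpha> (u @ v) \<noteq> None \<Longrightarrow> \<exists>\<beta>. state \<alpha> u = Some \<beta> \<and> state \<beta> v \<noteq> None"
  by (auto simp: state_append split: option.splits)

lemma state_ple: assumes "u \<preceq> v" "state \<alpha> v \<noteq> None" shows "state \<alpha> u \<noteq> None"
proof -
  obtain z where "u @ z \<simeq> v" using assms(1) by (rule pleE)
  then have "state \<alpha> (u @ z) \<noteq> None" using assms(2) state_teq by simp
  then show ?thesis using state_prefix by fastforce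
qed

lemma traces_from_iff: "trace_of I u \<in> traces_from I act \<alpha> \<longleftrightarrow> state \<alpha> u \<noteq> None"
  by (simp add: traces_from_def state_def)

lemma traces_fromE:
  assumes "x \<in> traces_from I act \<alpha>" obtains u where "x = trace_of I u" "state \<alpha> u \<noteq> None"
  using assms by (auto simp: traces_from_def carrier_trace_monoid state_def)

lemma next_state_eq: "state \<alpha> u = Some \<beta> \<Longrightarrow> next_state act \<alpha> (trace_of I u) = \<beta>"
  by (simp add: state_def)

lemma transitive: obtains r where "state \<alpha> r = Some \<beta>"
proof -
  have "traces_between I act \<alpha> \<beta> \<noteq> {}"
    using irreducible by (simp add: irreducible_system_def transitive_system_def)
  then show ?thesis using that by (auto simp: traces_between_def carrier_trace_monoid state_def)
qed

lemma prob_space_\<nu>: "prob_space (\<nu> \<alpha>)"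
  and sets_\<nu>: "sets (\<nu> \<alpha>) = sets (boundary_borel I)"
  and boundary_from_1: "measure (\<nu> \<alpha>) (boundary_from I act \<alpha>) = 1"
  using markov by (auto simp: markov_measure_def)

sublocale \<nu>: prob_space "\<nu> \<alpha>" for \<alpha>
  by (rule prob_space_\<nu>)

lemma f_pos_iff: "f \<alpha> u > 0 \<longleftrightarrow> state \<alpha> u \<noteq> None"
  using markov in_carrier unfolding markov_measure_def f_def traces_from_iff[symmetric] by blast

lemma f_append: "state \<alpha> u = Some \<beta> \<Longrightarrow> f \<alpha> (u @ v) = f \<alpha> u * f \<beta> v"
proof -
  assume "state \<alpha> u = Some \<beta>"
  moreover have "measure (\<nu> \<alpha>) (cylinder I (trace_of I u \<cdot>\<^bsub>I\<^esub> trace_of I v)) =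
          (case act (Some \<alpha>) (trace_of I u) of None \<Rightarrow> 0
           | Some \<beta> \<Rightarrow> measure (\<nu> \<alpha>) (cylinder I (trace_of I u)) * measure (\<nu> \<beta>) (cylinder I (trace_of I v)))"
    using markov in_carrier unfolding markov_measure_def by blast
  ultimately show ?thesis by (simp add: f_def state_def)
qed

lemma f_nonneg: "0 \<le> f \<alpha> u" by (simp add: f_def)

lemma f_eq_0: "state \<alpha> u = None \<Longrightarrow> f \<alpha> u = 0"
  using f_pos_iff[of \<alpha> u] f_nonneg[of \<alpha> u] by simp

lemma f_le_1: "f \<alpha> u \<le> 1" by (simp add: f_def)

lemma boundary_borel_Pow: "{U. openin (boundary_topology I) U} \<subseteq> Pow (boundary I)"
  by (auto simp: boundary_topology_def openin_subtopology)

lemma space_\<nu>: "space (\<nu> \<alpha>) = boundary I"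
  using sets_eq_imp_space_eq[OF sets_\<nu>[of \<alpha>]] boundary_borel_Pow
  by (simp add: boundary_borel_def space_measure_of)

lemma sets_layer: "{\<omega>\<in>boundary I. \<forall>i<n. \<omega> i = cs i} \<in> sets (\<nu> \<alpha>)"
proof -
  let ?X = "\<lambda>i. if i < n then {cs i} else UNIV"
  have "openin (product_topology (\<lambda>_. discrete_topology UNIV) UNIV) (Pi\<^sub>E UNIV ?X)"
    by (rule product_topology_basis) (auto intro: finite_subset[of _ "{..<n}"] split: if_splits)
  then have "openin (boundary_topology I) (Pi\<^sub>E UNIV ?X \<inter> boundary I)"
    unfolding boundary_topology_def openin_subtopology by blast
  moreover have "Pi\<^sub>E UNIV ?X \<inter> boundary I = {\<omega>\<in>boundary I. \<forall>i<n. \<omega> i = cs i}"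
    by (auto simp: PiE_def Pi_def)
  ultimately show ?thesis
    unfolding sets_\<nu> boundary_borel_def sets_measure_of[OF boundary_borel_Pow] by auto
qed

definition atom :: "'a set list \<Rightarrow> (nat \<Rightarrow> 'a set) set" where
  "atom cs = {\<omega>\<in>boundary I. map \<omega> [0..<length cs] = cs}"

lemma sets_atom: "atom cs \<in> sets (\<nu> \<alpha>)"
proof -
  have "map \<omega> [0..<length cs] = cs \<longleftrightarrow> (\<forall>i<length cs. \<omega> i = cs ! i)" for \<omega> :: "nat \<Rightarrow> 'a set"
    by (rule iffI, metis add_0 length_map minus_nat.diff_0 nth_map_upt, rule nth_equalityI, simp_all)
  then have "atom cs = {\<omega>\<in>boundary I. \<forall>i<length cs. \<omega> i = cs ! i}"
    unfolding atom_def by (simp only:)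
  then show ?thesis by (simp only: sets_layer)
qed

text \<open>
Events that depend on finitely many layers are finite unions of atoms.
\<close>
lemma sets_finite_dep:
  assumes "\<And>\<omega>. P \<omega> \<longleftrightarrow> Q (map \<omega> [0..<n])"
  shows "{\<omega>\<in>boundary I. P \<omega>} \<in> sets (\<nu> \<alpha>)"
proof -
  have fin: "finite {cs :: 'a set list. length cs = n \<and> Q cs}"
    by (rule finite_subset[OF _ finite_lists_length[of n]]) auto
  have "{\<omega>\<in>boundary I. P \<omega>} = (\<Union>cs\<in>{cs. length cs = n \<and> Q cs}. atom cs)"
  proof (rule Set.set_eqI, rule iffI)
    fix \<omega> assume "\<omega> \<in> {\<omega>\<in>boundary I. P \<omega>}"
    then have "\<omega> \<in> atom (map \<omega> [0..<n])" "Q (map \<omega> [0..<n])"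
      using assms[of \<omega>] by (simp_all add: atom_def)
    then show "\<omega> \<in> (\<Union>cs\<in>{cs. length cs = n \<and> Q cs}. atom cs)"
      by (intro UN_I[of "map \<omega> [0..<n]"]) simp_all
  next
    fix \<omega> assume "\<omega> \<in> (\<Union>cs\<in>{cs. length cs = n \<and> Q cs}. atom cs)"
    then obtain cs where cs: "cs \<in> {cs. length cs = n \<and> Q cs}" "\<omega> \<in> atom cs" by (rule UN_E)
    then have "length cs = n" "Q cs" "\<omega> \<in> boundary I" "map \<omega> [0..<length cs] = cs"
      by (simp_all only: atom_def mem_Collect_eq)
    then have "Q (map \<omega> [0..<n])" "\<omega> \<in> boundary I" by metis+
    then show "\<omega> \<in> {\<omega>\<in>boundary I. P \<omega>}" using assms[of \<omega>] by simp
  qed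
  also have "\<dots> \<in> sets (\<nu> \<alpha>)" by (intro sets.finite_UN fin) (rule sets_atom)
  finally show ?thesis .
qed

lemma sets_pre: "{\<omega>\<in>boundary I. pre u \<omega>} \<in> sets (\<nu> \<alpha>)"
proof -
  have "{\<omega>\<in>boundary I. pre u \<omega>} = (\<Union>n. {\<omega>\<in>boundary I. u \<preceq> layers \<omega> n})"
    by (auto simp: pre_iff)
  also have "\<dots> \<in> sets (\<nu> \<alpha>)"
  proof (rule sets.countable_UN, rule image_subsetI)
    fix n show "{\<omega>\<in>boundary I. u \<preceq> layers \<omega> n} \<in> sets (\<nu> \<alpha>)"
      by (rule sets_finite_dep[where n = n and Q = "\<lambda>cs. u \<preceq> cws cs"]) (simp add: layers_def)
  qed
  finally show ?thesis .
qed

lemma f_eq: "f \<alpha> u = measure (\<nu> \<alpha>) {\<omega>\<in>boundary I. pre u \<omega>}"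
  by (simp add: f_def cylinder_def pre_def)

lemma f_Nil [simp]: "f \<alpha> [] = 1"
  using \<nu>.prob_space[of \<alpha>] by (simp add: f_eq space_\<nu>)

lemma AE_boundary: "AE \<omega> in \<nu> \<alpha>. \<omega> \<in> boundary I"
  using AE_space[of "\<nu> \<alpha>"] by (simp add: space_\<nu>)

lemma AE_enabled: "AE \<omega> in \<nu> \<alpha>. \<forall>u. pre u \<omega> \<longrightarrow> state \<alpha> u \<noteq> None"
proof -
  have "measure (\<nu> \<alpha>) (boundary_from I act \<alpha>) = 1" by (rule boundary_from_1)
  from prob_space.AE_prob_1[OF prob_space_\<nu> this] show ?thesis
  proof eventually_elim
    case (elim \<omega>)
    then have "\<forall>x\<in>carrier (trace_monoid I). le_inf I x \<omega> \<longrightarrow> x \<in> traces_from I act \<alpha>"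
      by (simp add: boundary_from_def)
    then show ?case unfolding pre_def traces_from_iff[symmetric] using in_carrier by blast
  qed
qed

end

section \<open>The law of the first layers\<close>

text \<open>
The binomial expansion of $(1-1)^{|A|}$.
\<close>
lemma sum_Pow_alternating:
  assumes "finite A" shows "(\<Sum>X\<in>Pow A. (-1) ^ card X) = (if A = {} then 1 else 0 :: real)"
proof -
  have "(\<Sum>X\<in>Pow A. (-1) ^ card X) = (\<Prod>x\<in>A. (1::real) - 1)"
    using prod_diff_conv_sum[OF assms, of "\<lambda>_. 1" "\<lambda>_. 1 :: real"] by simp
  then show ?thesis using assms by auto
qed

context markov_system begin

subsection \<open>Moebius inversion\<close>

lemma sets_next_clique: "{\<omega>\<in>boundary I. pre y \<omega> \<and> next_clique y \<omega> = c} \<in> sets (\<nu> \<alpha>)"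
proof -
  have "{\<omega>\<in>boundary I. pre y \<omega> \<and> next_clique y \<omega> = c} =
    {\<omega>\<in>boundary I. pre y \<omega>} \<inter> (\<Inter>a\<in>UNIV. if a \<in> c then {\<omega>\<in>boundary I. pre (y @ [a]) \<omega>} else boundary I - {\<omega>\<in>boundary I. pre (y @ [a]) \<omega>})"
    by (auto simp: next_clique_def split: if_splits)
  also have "\<dots> \<in> sets (\<nu> \<alpha>)"
    using sets_pre sets.top[of "\<nu> \<alpha>"]
    by (intro sets.Int sets.finite_INT) (auto simp: space_\<nu> intro!: sets.Diff)
  finally show ?thesis .
qed

text \<open>
For a clique \<open>c'\<close>, the cylinder of \<open>y @ cw c'\<close> is the disjoint union over the cliques \<open>d \<supseteq> c'\<close> of the
events that the next clique after \<open>y\<close> is \<open>d\<close>. Inverting this relation between the measures of the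
cylinders and of the events by inclusion-exclusion gives the weight \<open>h\<close>.
\<close>
lemma measure_next_clique:
  assumes state: "state \<alpha> y = Some \<beta>" and c: "clique I c"
  shows "measure (\<nu> \<alpha>) {\<omega>\<in>boundary I. pre y \<omega> \<and> next_clique y \<omega> = c} = f \<alpha> y * h_val I \<nu> \<beta> c"
proof -
  define m where "m = (\<lambda>d. measure (\<nu> \<alpha>) {\<omega>\<in>boundary I. pre y \<omega> \<and> next_clique y \<omega> = d})"
  have le_iff: "trace_le I (clique_trace I c) (clique_trace I c') \<longleftrightarrow> c \<subseteq> c'" if "clique I c'" for c'
    unfolding clique_trace_cw trace_le_iff using cw_ple_iff[OF c] heads_cw[OF that] by simp
  have fm: "f \<alpha> y * f_val I \<nu> \<beta> c' = (\<Sum>d | clique I d \<and> c' \<subseteq> d. m d)" if c': "clique I c'" for c'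
  proof -
    have "f \<alpha> y * f_val I \<nu> \<beta> c' = f \<alpha> (y @ cw c')"
      unfolding f_append[OF state] by (simp add: f_val_def clique_trace_cw f_def)
    also have "\<dots> = measure (\<nu> \<alpha>) {\<omega>\<in>boundary I. pre (y @ cw c') \<omega>}" by (rule f_eq)
    also have "{\<omega>\<in>boundary I. pre (y @ cw c') \<omega>} = (\<Union>d\<in>{d. clique I d \<and> c' \<subseteq> d}. {\<omega>\<in>boundary I. pre y \<omega> \<and> next_clique y \<omega> = d})"
    proof (rule Set.set_eqI, rule iffI)
      fix \<omega> assume "\<omega> \<in> {\<omega>\<in>boundary I. pre (y @ cw c') \<omega>}"
      then have "\<omega> \<in> boundary I" "pre (y @ cw c') \<omega>" by simp_all
      moreover from this have "pre y \<omega>" by (blast dest: pre_appendD)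
      ultimately show "\<omega> \<in> (\<Union>d\<in>{d. clique I d \<and> c' \<subseteq> d}. {\<omega>\<in>boundary I. pre y \<omega> \<and> next_clique y \<omega> = d})"
        using next_clique_ge[of y \<omega> c'] clique_next_clique[of y \<omega>] c' by (intro UN_I[of "next_clique y \<omega>"]) simp_all
    next
      fix \<omega> assume "\<omega> \<in> (\<Union>d\<in>{d. clique I d \<and> c' \<subseteq> d}. {\<omega>\<in>boundary I. pre y \<omega> \<and> next_clique y \<omega> = d})"
      then show "\<omega> \<in> {\<omega>\<in>boundary I. pre (y @ cw c') \<omega>}"
        using next_clique_ge[of y \<omega> c'] c' by (elim UN_E) simp
    qed
    also have "measure (\<nu> \<alpha>) \<dots> = (\<Sum>d\<in>{d. clique I d \<and> c' \<subseteq> d}. m d)"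
      unfolding m_def
      by (rule \<nu>.finite_measure_finite_Union) (auto simp: disjoint_family_on_def intro: sets_next_clique)
    finally show ?thesis by simp
  qed
  have "f \<alpha> y * h_val I \<nu> \<beta> c = (\<Sum>c' | clique I c' \<and> c \<subseteq> c'. (-1) ^ (card c' - card c) * (f \<alpha> y * f_val I \<nu> \<beta> c'))"
    unfolding h_val_def sum_distrib_left by (rule sum.cong) (auto simp: le_iff)
  also have "\<dots> = (\<Sum>c' | clique I c' \<and> c \<subseteq> c'. \<Sum>d | clique I d \<and> c' \<subseteq> d. (-1) ^ (card c' - card c) * m d)"
    by (rule sum.cong) (auto simp: fm sum_distrib_left)
  also have "\<dots> = (\<Sum>d | clique I d \<and> c \<subseteq> d. \<Sum>c' | c \<subseteq> c' \<and> c' \<subseteq> d. (-1) ^ (card c' - card c) * m d)"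
  proof -
    have "(\<Sum>c' | clique I c' \<and> c \<subseteq> c'. \<Sum>d | clique I d \<and> c' \<subseteq> d. (-1) ^ (card c' - card c) * m d)
      = (\<Sum>c'\<in>{c'. clique I c' \<and> c \<subseteq> c'}. \<Sum>d\<in>{d\<in>Collect (clique I). c' \<subseteq> d}. (-1) ^ (card c' - card c) * m d)"
      by simp
    also have "\<dots> = (\<Sum>d\<in>Collect (clique I). \<Sum>c'\<in>{c'\<in>{c'. clique I c' \<and> c \<subseteq> c'}. c' \<subseteq> d}. (-1) ^ (card c' - card c) * m d)"
      by (rule sum.swap_restrict) auto
    also have "\<dots> = (\<Sum>d\<in>Collect (clique I). \<Sum>c' | c \<subseteq> c' \<and> c' \<subseteq> d. (-1) ^ (card c' - card c) * m d)"
      by (rule sum.cong[OF HOL.refl], rule sum.cong) (auto intro: clique_subset)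
    also have "\<dots> = (\<Sum>d | clique I d \<and> c \<subseteq> d. \<Sum>c' | c \<subseteq> c' \<and> c' \<subseteq> d. (-1) ^ (card c' - card c) * m d)"
    proof (rule sum.mono_neutral_right)
      show "\<forall>d\<in>Collect (clique I) - {d. clique I d \<and> c \<subseteq> d}. (\<Sum>c' | c \<subseteq> c' \<and> c' \<subseteq> d. (-1) ^ (card c' - card c) * m d) = 0"
      proof
        fix d assume "d \<in> Collect (clique I) - {d. clique I d \<and> c \<subseteq> d}"
        then have "{c'. c \<subseteq> c' \<and> c' \<subseteq> d} = {}" by auto
        then show "(\<Sum>c' | c \<subseteq> c' \<and> c' \<subseteq> d. (-1) ^ (card c' - card c) * m d) = 0" by (simp only: sum.empty)
      qed
    qed auto
    finally show ?thesis .
  qed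
  also have "\<dots> = (\<Sum>d | clique I d \<and> c \<subseteq> d. if d = c then m d else 0)"
  proof (rule sum.cong)
    fix d assume "d \<in> {d. clique I d \<and> c \<subseteq> d}"
    then have cd: "c \<subseteq> d" by simp
    have "(\<Sum>c' | c \<subseteq> c' \<and> c' \<subseteq> d. (-1) ^ (card c' - card c) * m d) = (\<Sum>X\<in>Pow (d - c). (-1) ^ card X * m d)"
      by (rule sum.reindex_bij_witness[of _ "\<lambda>X. c \<union> X" "\<lambda>c'. c' - c"])
        (use cd in \<open>auto simp: card_Diff_subset\<close>)
    also have "\<dots> = (if d - c = {} then 1 else 0) * m d"
      using sum_Pow_alternating[of "d - c"] by (simp add: sum_distrib_right[symmetric])
    also have "\<dots> = (if d = c then m d else 0)" using cd by auto
    finally show "(\<Sum>c' | c \<subseteq> c' \<and> c' \<subseteq> d. (-1) ^ (card c' - card c) * m d) = (if d = c then m d else 0)" .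
  qed simp
  also have "\<dots> = m c" using c by (simp add: sum.delta)
  finally show ?thesis by (simp add: m_def)
qed

text \<open>
After the empty prefix the next clique is the first layer.
\<close>
lemma h_val_alt:
  assumes "clique I c" shows "h_val I \<nu> \<beta> c = measure (\<nu> \<beta>) {\<omega>\<in>boundary I. \<omega> 0 = c}"
proof -
  have "{\<omega>\<in>boundary I. pre [] \<omega> \<and> next_clique [] \<omega> = c} = {\<omega>\<in>boundary I. \<omega> 0 = c}"
    using next_clique_layers[of _ 0] by auto
  then show ?thesis using measure_next_clique[of \<beta> "[]" \<beta> c] assms by simp
qed

lemma h_val_nonneg: "clique I c \<Longrightarrow> 0 \<le> h_val I \<nu> \<beta> c"
  and h_val_le_1: "clique I c \<Longrightarrow> h_val I \<nu> \<beta> c \<le> 1"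
  by (simp_all add: h_val_alt)

lemma atom_eq:
  assumes "normal (cs @ [d])"
  shows "atom (cs @ [d]) = {\<omega>\<in>boundary I. pre (cws cs) \<omega> \<and> next_clique (cws cs) \<omega> = d}"
proof (rule Set.set_eqI, rule iffI)
  fix \<omega> assume "\<omega> \<in> atom (cs @ [d])"
  then have b: "\<omega> \<in> boundary I" and m: "map \<omega> [0..<length cs] @ [\<omega> (length cs)] = cs @ [d]"
    by (auto simp: atom_def)
  then have "layers \<omega> (length cs) = cws cs" "\<omega> (length cs) = d" by (auto simp: layers_def)
  then show "\<omega> \<in> {\<omega>\<in>boundary I. pre (cws cs) \<omega> \<and> next_clique (cws cs) \<omega> = d}"
    using next_clique_layers[OF b, of "length cs"] pre_layers[of \<omega> "length cs"] b by simp
next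
  fix \<omega> assume "\<omega> \<in> {\<omega>\<in>boundary I. pre (cws cs) \<omega> \<and> next_clique (cws cs) \<omega> = d}"
  then show "\<omega> \<in> atom (cs @ [d])" using layers_determined[OF _ assms, of \<omega>] by (simp add: atom_def del: upt_Suc)
qed

lemma measure_atom:
  assumes "normal (cs @ [d])" "state \<alpha> (cws cs) = Some \<beta>"
  shows "measure (\<nu> \<alpha>) (atom (cs @ [d])) = f \<alpha> (cws cs) * h_val I \<nu> \<beta> d"
  unfolding atom_eq[OF assms(1)] by (rule measure_next_clique[OF assms(2)]) (use assms(1) in \<open>simp add: normal_append\<close>)

lemma atom_not_normal: "\<not> normal cs \<Longrightarrow> atom cs = {}"
proof (rule ccontr)
  assume "\<not> normal cs" "atom cs \<noteq> {}"
  then obtain \<omega> where "\<omega> \<in> boundary I" "map \<omega> [0..<length cs] = cs" by (auto simp: atom_def)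
  then show False using normal_map[of \<omega> 0 "length cs"] \<open>\<not> normal cs\<close> by simp
qed

lemma measure_atom_disabled:
  assumes "state \<alpha> (cws cs) = None" shows "measure (\<nu> \<alpha>) (atom cs) = 0"
proof -
  have "atom cs \<subseteq> {\<omega>\<in>boundary I. pre (cws cs) \<omega>}"
  proof
    fix \<omega> assume "\<omega> \<in> atom cs"
    then have "\<omega> \<in> boundary I" "map \<omega> [0..<length cs] = cs" by (auto simp: atom_def)
    then show "\<omega> \<in> {\<omega>\<in>boundary I. pre (cws cs) \<omega>}" using pre_layers[of \<omega> "length cs"] by (simp add: layers_def)
  qed
  then have "measure (\<nu> \<alpha>) (atom cs) \<le> f \<alpha> (cws cs)"
    unfolding f_eq by (rule \<nu>.finite_measure_mono) (rule sets_pre)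
  then show ?thesis using f_eq_0[OF assms] by (simp add: measure_le_0_iff)
qed

subsection \<open>Connectedness\<close>

text \<open>
The connectedness of the dependence graph in the form used below: any two letters are joined by a
finite chain of dependent letters.
\<close>
lemma dependence_connected: "(a, b) \<in> {(x, y). (x, y) \<notin> I}\<^sup>*"
proof -
  let ?G = "with_proj (mk_symmetric (with_proj \<lparr>pverts = UNIV, parcs = UNIV \<times> UNIV - I\<rparr>))"
  have "strongly_connected ?G"
    using irreducible unfolding irreducible_system_def irreducible_monoid_def Digraph_Component.connected_def by blast
  then have "(a, b) \<in> rtrancl_on (verts ?G) (arcs_ends ?G)"
    unfolding strongly_connected_def reachable_def by simp
  then show ?thesis
  proof (induction rule: rtrancl_on_induct)
    case (step y z)
    then have "(y, z) \<notin> I" using I_sym by (auto simp: parcs_mk_symmetric)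
    then show ?case using step by (auto intro: rtrancl_into_rtrancl)
  qed simp
qed

end

section \<open>Almost every infinite trace contains all letters\<close>

text \<open>
The form of countable subadditivity that fits unions over sets of words.
\<close>
lemma emeasure_subadditive_count_space:
  assumes sets: "\<And>i. i \<in> J \<Longrightarrow> X i \<in> sets M" and J: "countable J"
  shows "emeasure M (\<Union>i\<in>J. X i) \<le> (\<integral>\<^sup>+i. emeasure M (X i) \<partial>count_space J)"
proof -
  have le: "indicator (\<Union>i\<in>J. X i) x \<le> (\<integral>\<^sup>+i. indicator (X i) x \<partial>count_space J)" for x
  proof (cases "x \<in> (\<Union>i\<in>J. X i)")
    case True
    then obtain j where j: "j \<in> J" "x \<in> X j" by blast
    have "(1::ennreal) = (\<integral>\<^sup>+i. indicator {j} i \<partial>count_space J)" using j(1) by (simp add: one_ennreal_def)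
    also have "\<dots> \<le> (\<integral>\<^sup>+i. indicator (X i) x \<partial>count_space J)"
      using j by (intro nn_integral_mono) (auto split: split_indicator)
    finally show ?thesis using True by simp
  qed simp
  have "(\<Union>i\<in>J. X i) \<in> sets M" by (rule sets.countable_UN''[OF J sets])
  then have "emeasure M (\<Union>i\<in>J. X i) = (\<integral>\<^sup>+x. indicator (\<Union>i\<in>J. X i) x \<partial>M)" by simp
  also have "\<dots> \<le> (\<integral>\<^sup>+x. \<integral>\<^sup>+i. indicator (X i) x \<partial>count_space J \<partial>M)" by (intro nn_integral_mono le)
  also have "\<dots> = (\<integral>\<^sup>+i. \<integral>\<^sup>+x. indicator (X i) x \<partial>M \<partial>count_space J)"
    by (rule nn_integral_count_space_nn_integral[OF J]) (auto intro!: borel_measurable_indicator sets)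
  also have "\<dots> = (\<integral>\<^sup>+i. emeasure M (X i) \<partial>count_space J)"
    using sets by (intro nn_integral_cong) simp
  finally show ?thesis .
qed

context trace_alphabet begin

text \<open>
A canonical word for each trace. With canonical words, a set of traces becomes a countable set of words
in which no trace is counted twice.
\<close>
definition rep :: "'a list \<Rightarrow> 'a list" where
  "rep u = (SOME v. u \<simeq> v)"

lemma rep_teq: "u \<simeq> rep u"
  unfolding rep_def by (rule someI[of _ u]) (rule teq_refl)

lemma rep_eqI: assumes "u \<simeq> v" shows "rep u = rep v"
proof -
  have "(\<lambda>x. u \<simeq> x) = (\<lambda>x. v \<simeq> x)"
    using assms teq_trans teq_sym by (intro ext) blast
  then show ?thesis by (simp add: rep_def)
qed

lemma rep_rep [simp]: "rep (rep u) = rep u"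
  by (rule rep_eqI) (rule teq_sym[OF rep_teq])

text \<open>
The cylinders of such words are pairwise disjoint.
\<close>
definition incompatible :: "'a list set \<Rightarrow> bool" where
  "incompatible U \<longleftrightarrow> (\<forall>u\<in>U. \<forall>v\<in>U. u \<noteq> v \<longrightarrow> \<not> (\<exists>z. u \<preceq> z \<and> v \<preceq> z))"

lemma incompatibleD: "incompatible U \<Longrightarrow> u \<in> U \<Longrightarrow> v \<in> U \<Longrightarrow> u \<preceq> z \<Longrightarrow> v \<preceq> z \<Longrightarrow> u = v"
  by (auto simp: incompatible_def)

text \<open>
If \<open>u @ v\<close> and \<open>u @ v'\<close> lie below the same infinite trace, then so do \<open>v\<close> and \<open>v'\<close> once \<open>u\<close> is cancelled
from an upper bound.
\<close>
lemma pre_append_incompatible: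
  assumes "incompatible V" "v \<in> V" "v' \<in> V" "pre (u @ v) \<omega>" "pre (u @ v') \<omega>"
  shows "v = v'"
proof -
  obtain z where z: "u @ v \<preceq> z" "u @ v' \<preceq> z" by (rule pre_directed[OF assms(4,5)])
  have "u \<preceq> z" using ple_append z(1) by (rule ple_trans)
  then obtain x where x: "u @ x \<simeq> z" by (rule pleE)
  have "v \<preceq> x" "v' \<preceq> x"
    using ple_cancel[OF ple_teq_trans2[OF z(1) teq_sym[OF x]]] ple_cancel[OF ple_teq_trans2[OF z(2) teq_sym[OF x]]] by auto
  then show ?thesis by (rule incompatibleD[OF assms(1-3)])
qed

end

context markov_system begin

lemma emeasure_pre: "emeasure (\<nu> \<alpha>) {\<omega>\<in>boundary I. pre u \<omega>} = ennreal (f \<alpha> u)"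
  by (simp add: f_eq \<nu>.emeasure_eq_measure)

lemma sets_ex_pre: "{\<omega>\<in>boundary I. \<exists>u\<in>U. pre u \<omega>} \<in> sets (\<nu> \<alpha>)"
proof -
  have "{\<omega>\<in>boundary I. \<exists>u\<in>U. pre u \<omega>} = (\<Union>u\<in>U. {\<omega>\<in>boundary I. pre u \<omega>})" by auto
  also have "\<dots> \<in> sets (\<nu> \<alpha>)" by (rule sets.countable_UN'') (use sets_pre in auto)
  finally show ?thesis .
qed

lemma emeasure_ex_pre_append:
  assumes "incompatible V"
  shows "emeasure (\<nu> \<alpha>) {\<omega>\<in>boundary I. \<exists>v\<in>V. pre (u @ v) \<omega>} = (\<integral>\<^sup>+v. ennreal (f \<alpha> (u @ v)) \<partial>count_space V)"
proof -
  have "{\<omega>\<in>boundary I. \<exists>v\<in>V. pre (u @ v) \<omega>} = (\<Union>v\<in>V. {\<omega>\<in>boundary I. pre (u @ v) \<omega>})" by auto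
  also have "emeasure (\<nu> \<alpha>) \<dots> = (\<integral>\<^sup>+v. emeasure (\<nu> \<alpha>) {\<omega>\<in>boundary I. pre (u @ v) \<omega>} \<partial>count_space V)"
  proof (intro emeasure_UN_countable sets_pre)
    show "disjoint_family_on (\<lambda>v. {\<omega>\<in>boundary I. pre (u @ v) \<omega>}) V"
      unfolding disjoint_family_on_def
    proof (intro ballI impI, rule ccontr)
      fix v v' assume v: "v \<in> V" "v' \<in> V" "v \<noteq> v'"
        and "{\<omega>\<in>boundary I. pre (u @ v) \<omega>} \<inter> {\<omega>\<in>boundary I. pre (u @ v') \<omega>} \<noteq> {}"
      then obtain \<omega> where "pre (u @ v) \<omega>" "pre (u @ v') \<omega>" by blast
      then show False using pre_append_incompatible[OF assms v(1,2)] v(3) by blast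
    qed
  qed simp
  finally show ?thesis by (simp add: emeasure_pre)
qed

lemma emeasure_ex_pre:
  assumes "incompatible U"
  shows "emeasure (\<nu> \<alpha>) {\<omega>\<in>boundary I. \<exists>u\<in>U. pre u \<omega>} = (\<integral>\<^sup>+u. ennreal (f \<alpha> u) \<partial>count_space U)"
  using emeasure_ex_pre_append[OF assms, of \<alpha> "[]"] by simp

subsection \<open>Enabled words with a unique maximal letter\<close>

text \<open>
Every letter can be reached from every state; a prefix of the trace that reaches it has it as its peak.
\<close>
lemma reach_letter: obtains p where "state \<alpha> p \<noteq> None" "peaked a p"
proof -
  obtain x where x: "x \<in> carrier (trace_monoid I)" "act (Some \<alpha>) (x \<cdot>\<^bsub>I\<^esub> trace_of I [a]) \<noteq> None"
    using irreducible unfolding irreducible_system_def by blast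
  then obtain u where "x = trace_of I u" by (auto simp: carrier_trace_monoid)
  then have state: "state \<alpha> (u @ [a]) \<noteq> None" using x(2) by (simp add: state_def)
  have "1 \<le> count_list (u @ [a]) a" by simp
  from exists_peaked_prefix[OF _ this] obtain v where "v \<preceq> u @ [a]" "peaked a v" by auto
  then show ?thesis using that state_ple[OF _ state] by blast
qed

text \<open>
Walk from \<open>b\<close> to \<open>c\<close> through dependent letters, appending at each step an enabled trace that has the next
letter as its peak. The same extension works whatever stands in front of \<open>u\<close>.
\<close>
lemma extend_peak:
  assumes "state \<alpha> u \<noteq> None"
  shows "\<exists>u'. state \<alpha> (u @ u') \<noteq> None \<and> (\<forall>x. peaked b (x @ u) \<longrightarrow> peaked c (x @ u @ u'))"
  using dependence_connected[of b c]
proof (induction rule: rtrancl_induct)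
  case base
  show ?case by (rule exI[of _ "[]"]) (use assms in simp)
next
  case (step c d)
  then obtain u' where u': "state \<alpha> (u @ u') \<noteq> None" "\<And>x. peaked b (x @ u) \<Longrightarrow> peaked c (x @ u @ u')" by blast
  then obtain \<beta> where \<beta>: "state \<alpha> (u @ u') = Some \<beta>" by blast
  obtain p where p: "state \<beta> p \<noteq> None" "peaked d p" by (rule reach_letter)
  have "state \<alpha> (u @ u' @ p) \<noteq> None" using p(1) state_append_Some[OF \<beta>, of p] by simp
  moreover have "peaked d (x @ u @ u' @ p)" if "peaked b (x @ u)" for x
    using peaked_append[OF u'(2)[OF that] p(2)] step(2) by simp
  ultimately show ?case by blast
qed

text \<open>
Collect the letters one after the other by \<open>extend_peak\<close>.
\<close>
lemma enabled_all_letters: "\<exists>u b. state \<alpha> u \<noteq> None \<and> peaked b u \<and> set u = UNIV"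
proof -
  have "\<exists>u b. state \<alpha> u \<noteq> None \<and> peaked b u \<and> S \<subseteq> set u" for S :: "'a set"
    using finite[of S]
  proof (induction S rule: finite_induct)
    case empty
    obtain p where "state \<alpha> p \<noteq> None" "peaked undefined p" by (rule reach_letter)
    then show ?case by blast
  next
    case (insert c S)
    then obtain u b where u: "state \<alpha> u \<noteq> None" "peaked b u" "S \<subseteq> set u" by blast
    from extend_peak[OF u(1), of b c] obtain u' where
      u': "state \<alpha> (u @ u') \<noteq> None" "\<And>x. peaked b (x @ u) \<Longrightarrow> peaked c (x @ u @ u')" by blast
    have "peaked c (u @ u')" using u'(2)[of "[]"] u(2) by simp
    moreover from this have "c \<in> set (u @ u')" by (simp add: peaked_def)
    ultimately show ?case using u'(1) u(3) by (intro exI[of _ "u @ u'"] exI[of _ c]) auto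
  qed
  from this[of UNIV] show ?thesis by auto
qed

lemma enabled_pyramid: obtains u where "state \<alpha> u \<noteq> None" "peaked b u" "set u = UNIV"
proof -
  obtain u c where u: "state \<alpha> u \<noteq> None" "peaked c u" "set u = UNIV" using enabled_all_letters by blast
  from extend_peak[OF u(1), of c b] obtain u' where
    u': "state \<alpha> (u @ u') \<noteq> None" "\<And>x. peaked c (x @ u) \<Longrightarrow> peaked b (x @ u @ u')" by blast
  have "peaked b (u @ u')" using u'(2)[of "[]"] u(2) by simp
  moreover have "set (u @ u') = UNIV" using u(3) by simp
  ultimately show ?thesis using that[of "u @ u'"] u'(1) by blast
qed

text \<open>
The words to which \<open>ple_cut\<close> applies exist: start with an enabled word that contains all letters and
has a peak, so that the peak is strong, and move the peak through all letters by \<open>extend_peak\<close>.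
\<close>
lemma cutting_word_exists:
  "\<exists>w t. state \<alpha> w \<noteq> None \<and> strong_top t w \<and> (\<forall>b. \<exists>u1 u2. w = u1 @ u2 \<and> strong_top b u1)"
proof -
  have "\<exists>w t. state \<alpha> w \<noteq> None \<and> strong_top t w \<and> (\<forall>b\<in>S. \<exists>u1 u2. w = u1 @ u2 \<and> strong_top b u1)" for S :: "'a set"
    using finite[of S]
  proof (induction S rule: finite_induct)
    case empty
    obtain u b where "state \<alpha> u \<noteq> None" "peaked b u" "set u = UNIV" using enabled_all_letters by blast
    then show ?case using strong_topI by blast
  next
    case (insert c S)
    then obtain w t where w: "state \<alpha> w \<noteq> None" "strong_top t w" "\<forall>b\<in>S. \<exists>u1 u2. w = u1 @ u2 \<and> strong_top b u1"
      by blast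
    from extend_peak[OF w(1), of t c] obtain u' where
      u': "state \<alpha> (w @ u') \<noteq> None" "\<And>x. peaked t (x @ w) \<Longrightarrow> peaked c (x @ w @ u')" by blast
    have c: "strong_top c (w @ u')" using w(2) u'(2) by (simp add: strong_top_def)
    have "\<exists>u1 u2. w @ u' = u1 @ u2 \<and> strong_top b u1" if "b \<in> insert c S" for b
    proof (cases "b = c")
      case True
      then have "w @ u' = (w @ u') @ []" "strong_top b (w @ u')" using c by simp_all
      then show ?thesis by (intro exI conjI)
    next
      case False
      then have "b \<in> S" using that by simp
      from w(3)[rule_format, OF this] obtain u1 u2 where "w = u1 @ u2" "strong_top b u1" by (elim exE conjE)
      then have "w @ u' = u1 @ (u2 @ u')" "strong_top b u1" by simp_all
      then show ?thesis by (intro exI conjI)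
    qed
    then show ?case using u'(1) c by blast
  qed
  from this[of UNIV] show ?thesis by simp
qed

subsection \<open>Avoiding a letter is unlikely\<close>

text \<open>
The traces with peak \<open>b\<close> that contain \<open>b\<close> exactly \<open>n\<close> times and avoid \<open>a\<close>. The aim is to show that an
infinite trace that contains \<open>b\<close> infinitely often but avoids \<open>a\<close> is unlikely: it would have such a trace
below it for every \<open>n > 0\<close>.
\<close>
definition pyramids :: "'a \<Rightarrow> 'a \<Rightarrow> nat \<Rightarrow> 'a list set" where
  "pyramids a b n = {u. rep u = u \<and> peaked b u \<and> count_list u b = n \<and> a \<notin> set u}"

lemma incompatible_pyramids: "incompatible (pyramids a b n)"
  unfolding incompatible_def
proof (intro ballI impI notI)
  fix u v assume uv: "u \<in> pyramids a b n" "v \<in> pyramids a b n" "u \<noteq> v" and "\<exists>z. u \<preceq> z \<and> v \<preceq> z"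
  then obtain z where z: "u \<preceq> z" "v \<preceq> z" by blast
  have "u \<preceq> v" "v \<preceq> u" using peaked_ple[OF z] peaked_ple[OF z(2,1)] uv by (auto simp: pyramids_def)
  then have "u \<simeq> v" by (rule ple_antisym)
  then have "rep u = rep v" by (rule rep_eqI)
  then show False using uv by (simp add: pyramids_def)
qed

definition avoid :: "'a \<Rightarrow> 'a \<Rightarrow> nat \<Rightarrow> 's \<Rightarrow> ennreal" where
  "avoid a b n \<alpha> = emeasure (\<nu> \<alpha>) {\<omega>\<in>boundary I. \<exists>u\<in>pyramids a b n. pre u \<omega>}"

text \<open>
A trace with peak \<open>b\<close> and \<open>n + m\<close> occurrences of \<open>b\<close> splits, at its shortest prefix with \<open>n\<close> occurrences,
into a trace with \<open>n\<close> and one with \<open>m\<close> occurrences. Both have peak \<open>b\<close>, so the chain rule of the Markov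
measure makes the probability submultiplicative.
\<close>
lemma avoid_add:
  assumes "n > 0" "m > 0" and M: "\<And>\<beta>. avoid a b m \<beta> \<le> M"
  shows "avoid a b (n + m) \<alpha> \<le> avoid a b n \<alpha> * M"
proof -
  have "{\<omega>\<in>boundary I. \<exists>u\<in>pyramids a b (n + m). pre u \<omega>} \<subseteq> (\<Union>v\<in>pyramids a b n. \<Union>z\<in>pyramids a b m. {\<omega>\<in>boundary I. pre (v @ z) \<omega>})"
  proof
    fix \<omega> assume "\<omega> \<in> {\<omega>\<in>boundary I. \<exists>u\<in>pyramids a b (n + m). pre u \<omega>}"
    then obtain u where u: "\<omega> \<in> boundary I" "u \<in> pyramids a b (n + m)" "pre u \<omega>" by blast
    have "n \<le> count_list u b" using u(2) by (simp add: pyramids_def)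
    with assms(1) obtain v where v: "v \<preceq> u" "peaked b v" "count_list v b = n" by (rule exists_peaked_prefix)
    then have "rep v \<preceq> u" using ple_teq_trans1[OF teq_sym[OF rep_teq]] by blast
    then obtain z where z: "rep v @ z \<simeq> u" by (rule pleE)
    have cv: "count_list (rep v) b = n" using teq_count[OF rep_teq[of v], of b] v(3) by simp
    have "a \<notin> set (rep v) \<union> set z" using teq_set[OF z] u(2) by (auto simp: pyramids_def)
    then have "rep v \<in> pyramids a b n" using v peaked_teq[OF v(2) rep_teq] cv by (simp add: pyramids_def)
    have cz: "count_list z b = m" using teq_count[OF z, of b] u(2) cv by (simp add: pyramids_def)
    have "peaked b z"
      unfolding peaked_def
    proof (intro conjI allI impI)
      show "b \<in> set z" using cz assms(2) by (metis count_list_0_iff not_gr_zero)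
    next
      fix x y assume xy: "z \<simeq> x @ y" "b \<notin> set y"
      have "u \<simeq> (rep v @ x) @ y" using teq_trans[OF teq_sym[OF z] teq_left[OF xy(1)]] by simp
      moreover have "peaked b u" using u(2) by (simp add: pyramids_def)
      ultimately show "y = []" using peakedD[of b u "rep v @ x" y] xy(2) by simp
    qed
    then have "rep z \<in> pyramids a b m"
      using peaked_teq[OF _ rep_teq, of b z] teq_count[OF rep_teq[of z], of b] cz teq_set[OF rep_teq[of z]]
        \<open>a \<notin> set (rep v) \<union> set z\<close> by (simp add: pyramids_def)
    moreover have "pre (rep v @ rep z) \<omega>"
      using pre_teq[OF teq_trans[OF teq_left[OF teq_sym[OF rep_teq]] z]] u(3) by simp
    ultimately show "\<omega> \<in> (\<Union>v\<in>pyramids a b n. \<Union>z\<in>pyramids a b m. {\<omega>\<in>boundary I. pre (v @ z) \<omega>})"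
      using \<open>rep v \<in> pyramids a b n\<close> u(1) by blast
  qed
  then have "avoid a b (n + m) \<alpha> \<le> emeasure (\<nu> \<alpha>) (\<Union>v\<in>pyramids a b n. \<Union>z\<in>pyramids a b m. {\<omega>\<in>boundary I. pre (v @ z) \<omega>})"
    unfolding avoid_def by (rule emeasure_mono) (auto intro!: sets.countable_UN'' sets_pre)
  also have "\<dots> \<le> (\<integral>\<^sup>+v. \<integral>\<^sup>+z. ennreal (f \<alpha> (v @ z)) \<partial>count_space (pyramids a b m) \<partial>count_space (pyramids a b n))"
  proof -
    have "emeasure (\<nu> \<alpha>) (\<Union>v\<in>pyramids a b n. \<Union>z\<in>pyramids a b m. {\<omega>\<in>boundary I. pre (v @ z) \<omega>})
      \<le> (\<integral>\<^sup>+v. emeasure (\<nu> \<alpha>) (\<Union>z\<in>pyramids a b m. {\<omega>\<in>boundary I. pre (v @ z) \<omega>}) \<partial>count_space (pyramids a b n))"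
      by (rule emeasure_subadditive_count_space) (auto intro!: sets.countable_UN'' sets_pre)
    also have "\<dots> \<le> (\<integral>\<^sup>+v. \<integral>\<^sup>+z. emeasure (\<nu> \<alpha>) {\<omega>\<in>boundary I. pre (v @ z) \<omega>} \<partial>count_space (pyramids a b m) \<partial>count_space (pyramids a b n))"
      by (intro nn_integral_mono emeasure_subadditive_count_space) (auto intro!: sets_pre)
    finally show ?thesis by (simp add: emeasure_pre)
  qed
  also have "\<dots> \<le> (\<integral>\<^sup>+v. ennreal (f \<alpha> v) * M \<partial>count_space (pyramids a b n))"
  proof (rule nn_integral_mono)
    fix v
    show "(\<integral>\<^sup>+z. ennreal (f \<alpha> (v @ z)) \<partial>count_space (pyramids a b m)) \<le> ennreal (f \<alpha> v) * M"
    proof (cases "state \<alpha> v")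
      case None
      then have "f \<alpha> (v @ z) = 0" for z by (intro f_eq_0) (simp add: state_append)
      then show ?thesis by simp
    next
      case (Some \<beta>)
      have "(\<integral>\<^sup>+z. ennreal (f \<alpha> (v @ z)) \<partial>count_space (pyramids a b m)) = ennreal (f \<alpha> v) * avoid a b m \<beta>"
        unfolding avoid_def emeasure_ex_pre[OF incompatible_pyramids]
        by (simp add: f_append[OF Some] ennreal_mult' f_nonneg nn_integral_cmult)
      then show ?thesis using M by (simp add: mult_left_mono)
    qed
  qed
  also have "\<dots> = avoid a b n \<alpha> * M"
    unfolding avoid_def emeasure_ex_pre[OF incompatible_pyramids] by (simp add: nn_integral_multc)
  finally show ?thesis .
qed

text \<open>
In each state \<open>\<beta>\<close> some trace \<open>u \<beta>\<close> with peak \<open>b\<close> that contains all letters is enabled, so its cylinder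
has positive measure. An infinite trace above \<open>u \<beta>\<close> has below it no trace from \<open>pyramids a b m\<close> with
\<open>m\<close> at least the number of \<open>b\<close> in \<open>u \<beta>\<close>: by \<open>peaked_ple\<close> such a trace would contain \<open>u \<beta>\<close>, hence \<open>a\<close>.
\<close>
lemma avoid_small: "\<exists>m>0. \<exists>M<1. 0 \<le> M \<and> (\<forall>\<beta>. avoid a b m \<beta> \<le> ennreal M)"
proof -
  have "\<forall>\<beta>. \<exists>u. state \<beta> u \<noteq> None \<and> peaked b u \<and> set u = UNIV" using enabled_pyramid by metis
  then obtain u where u: "\<And>\<beta>. state \<beta> (u \<beta>) \<noteq> None" "\<And>\<beta>. peaked b (u \<beta>)" "\<And>\<beta>. set (u \<beta>) = UNIV" by metis
  \<comment> \<open>Any bound on the counts works; the successor makes \<open>m\<close> positive.\<close>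
  define m where "m = Suc (Max (range (\<lambda>\<beta>. count_list (u \<beta>) b)))"
  define M where "M = Max (range (\<lambda>\<beta>. 1 - f \<beta> (u \<beta>)))"
  have cm: "count_list (u \<beta>) b \<le> m" for \<beta>
  proof -
    have "count_list (u \<beta>) b \<le> Max (range (\<lambda>\<beta>. count_list (u \<beta>) b))" by (rule Max_ge) auto
    then show ?thesis unfolding m_def by (rule le_SucI)
  qed
  have fM: "1 - f \<beta> (u \<beta>) \<le> M" for \<beta> unfolding M_def by (rule Max_ge) auto
  have "M \<in> range (\<lambda>\<beta>. 1 - f \<beta> (u \<beta>))" unfolding M_def by (rule Max_in) auto
  then obtain \<beta>0 where "M = 1 - f \<beta>0 (u \<beta>0)" by blast
  then have M1: "M < 1" "0 \<le> M" using f_pos_iff[of \<beta>0 "u \<beta>0"] u(1)[of \<beta>0] f_le_1[of \<beta>0 "u \<beta>0"] by simp_all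
  have "avoid a b m \<beta> \<le> ennreal M" for \<beta>
  proof -
    have "{\<omega>\<in>boundary I. \<exists>v\<in>pyramids a b m. pre v \<omega>} \<subseteq> space (\<nu> \<beta>) - {\<omega>\<in>boundary I. pre (u \<beta>) \<omega>}"
    proof
      fix \<omega> assume "\<omega> \<in> {\<omega>\<in>boundary I. \<exists>v\<in>pyramids a b m. pre v \<omega>}"
      then obtain v where v: "\<omega> \<in> boundary I" "v \<in> pyramids a b m" "pre v \<omega>" by blast
      have "\<not> pre (u \<beta>) \<omega>"
      proof
        assume "pre (u \<beta>) \<omega>"
        with v(3) obtain z where z: "v \<preceq> z" "u \<beta> \<preceq> z" by (rule pre_directed)
        have "u \<beta> \<preceq> v" using peaked_ple[OF z(2,1) u(2)] cm v(2) by (simp add: pyramids_def)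
        then have "a \<in> set v" using ple_set u(3)[of \<beta>] by blast
        then show False using v(2) by (simp add: pyramids_def)
      qed
      then show "\<omega> \<in> space (\<nu> \<beta>) - {\<omega>\<in>boundary I. pre (u \<beta>) \<omega>}" using v(1) by (simp add: space_\<nu>)
    qed
    then have "avoid a b m \<beta> \<le> emeasure (\<nu> \<beta>) (space (\<nu> \<beta>) - {\<omega>\<in>boundary I. pre (u \<beta>) \<omega>})"
      unfolding avoid_def by (rule emeasure_mono) (intro sets.compl_sets sets_pre)
    also have "\<dots> = ennreal (1 - f \<beta> (u \<beta>))"
      unfolding \<nu>.emeasure_eq_measure \<nu>.prob_compl[OF sets_pre] f_eq ..
    also have "\<dots> \<le> ennreal M" using fM by (rule ennreal_leI)
    finally show ?thesis .
  qed
  then show ?thesis using M1 by (intro exI[of _ m]) (auto simp: m_def intro!: exI[of _ M])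
qed

text \<open>
By \<open>avoid_add\<close> and \<open>avoid_small\<close>, the probability of having a trace from \<open>pyramids a b n\<close> below \<open>\<omega>\<close>
decays geometrically in \<open>n\<close>.
\<close>
lemma AE_pyramid:
  "AE \<omega> in \<nu> \<alpha>. (\<forall>n. \<exists>u. pre u \<omega> \<and> n \<le> count_list u b) \<longrightarrow> (\<exists>u. pre u \<omega> \<and> a \<in> set u)"
proof -
  obtain m M where m: "m > 0" "M < 1" "0 \<le> M" "\<And>\<beta>. avoid a b m \<beta> \<le> ennreal M"
    using avoid_small by metis
  have le: "avoid a b (Suc k * m) \<alpha> \<le> ennreal (M ^ Suc k)" for k
  proof (induction k)
    case 0
    then show ?case using m by simp
  next
    case (Suc k)
    have "avoid a b (Suc k * m + m) \<alpha> \<le> avoid a b (Suc k * m) \<alpha> * ennreal M"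
      by (rule avoid_add) (use m in auto)
    also have "\<dots> \<le> ennreal (M ^ Suc k) * ennreal M" by (intro mult_right_mono Suc) simp
    also have "\<dots> = ennreal (M ^ Suc (Suc k))"
      using m(3) by (subst ennreal_mult[symmetric]) (simp_all add: ac_simps)
    finally show ?case by (simp add: ac_simps)
  qed
  define N where "N = (\<Inter>k. {\<omega>\<in>boundary I. \<exists>u\<in>pyramids a b (Suc k * m). pre u \<omega>})"
  have Ns: "N \<in> sets (\<nu> \<alpha>)" unfolding N_def by (rule sets.countable_INT) (use sets_ex_pre in auto)
  have "emeasure (\<nu> \<alpha>) N \<le> ennreal (M ^ Suc k)" for k
  proof -
    have "emeasure (\<nu> \<alpha>) N \<le> avoid a b (Suc k * m) \<alpha>"
      unfolding avoid_def by (rule emeasure_mono[OF _ sets_ex_pre]) (auto simp: N_def)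
    also note le[of k]
    finally show ?thesis .
  qed
  moreover have "(\<lambda>k. ennreal (M ^ Suc k)) \<longlonglongrightarrow> ennreal 0"
    using m by (intro tendsto_ennrealI LIMSEQ_Suc LIMSEQ_power_zero) auto
  ultimately have "emeasure (\<nu> \<alpha>) N \<le> ennreal 0" by (intro LIMSEQ_le_const) auto
  then have "AE \<omega> in \<nu> \<alpha>. \<omega> \<notin> N" using Ns by (intro AE_not_in) (auto simp: null_sets_def)
  with AE_boundary show ?thesis
  proof eventually_elim
    case (elim \<omega>)
    show ?case
    proof (intro impI, rule ccontr)
      assume io: "\<forall>n. \<exists>u. pre u \<omega> \<and> n \<le> count_list u b" and no: "\<not> (\<exists>u. pre u \<omega> \<and> a \<in> set u)"
      have "\<exists>u\<in>pyramids a b (Suc k * m). pre u \<omega>" for k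
      proof -
        obtain u where u: "pre u \<omega>" "Suc k * m \<le> count_list u b" using io by blast
        have "0 < Suc k * m" using m(1) by simp
        from this u(2) obtain v where v: "v \<preceq> u" "peaked b v" "count_list v b = Suc k * m"
          by (rule exists_peaked_prefix)
        have "pre v \<omega>" using v(1) u(1) by (rule pre_ple)
        then have pv: "pre (rep v) \<omega>" using pre_teq[OF rep_teq] by simp
        then have "a \<notin> set (rep v)" using no by blast
        then have "rep v \<in> pyramids a b (Suc k * m)"
          using peaked_teq[OF v(2) rep_teq] teq_count[OF rep_teq[of v], of b] v(3) by (simp add: pyramids_def)
        then show ?thesis using pv by blast
      qed
      then have "\<omega> \<in> N" using elim(1) by (simp add: N_def)
      then show False using elim(2) by simp
    qed
  qed
qed

text \<open>
An infinite trace contains some letter \<open>b\<close> infinitely often, because its finite prefixes are unboundedly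
long. By \<open>AE_pyramid\<close> every other letter then occurs as well.
\<close>
lemma AE_all_letters: "AE \<omega> in \<nu> \<alpha>. \<exists>u. pre u \<omega> \<and> set u = UNIV"
proof -
  have "AE \<omega> in \<nu> \<alpha>. \<forall>b a. (\<forall>n. \<exists>u. pre u \<omega> \<and> n \<le> count_list u b) \<longrightarrow> (\<exists>u. pre u \<omega> \<and> a \<in> set u)"
    unfolding AE_all_countable by (intro allI AE_pyramid)
  with AE_boundary show ?thesis
  proof eventually_elim
    case (elim \<omega>)
    have "\<exists>b. \<forall>n. \<exists>u. pre u \<omega> \<and> n \<le> count_list u b"
    proof (rule ccontr)
      assume "\<not> ?thesis"
      then have "\<forall>b. \<exists>n. \<forall>u. pre u \<omega> \<longrightarrow> count_list u b < n" by (meson not_le)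
      then obtain n where n: "\<And>b u. pre u \<omega> \<Longrightarrow> count_list u b < n b" by metis
      \<comment> \<open>The first \<open>k\<close> layers have at least \<open>k\<close> letters, more than the bounds \<open>n b\<close> allow.\<close>
      define k where "k = Suc (\<Sum>b\<in>UNIV. n b)"
      have "k \<le> length (layers \<omega> k)" by (rule length_layers_ge[OF elim(1)])
      also have "length (layers \<omega> k) = (\<Sum>b\<in>UNIV. count_list (layers \<omega> k) b)"
        by (rule sum_count_set[symmetric]) auto
      also have "\<dots> \<le> (\<Sum>b\<in>UNIV. n b)" by (intro sum_mono less_imp_le n pre_layers)
      finally show False by (simp add: k_def)
    qed
    then have all: "\<exists>u. pre u \<omega> \<and> a \<in> set u" for a using elim(2) by blast
    have "\<exists>u. pre u \<omega> \<and> S \<subseteq> set u" for S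
      using finite[of S]
    proof (induction S rule: finite_induct)
      case empty
      show ?case by (rule exI[of _ "[]"]) simp
    next
      case (insert a S)
      then obtain u where u: "pre u \<omega>" "S \<subseteq> set u" by blast
      obtain v where v: "pre v \<omega>" "a \<in> set v" using all by blast
      from pre_directed[OF u(1) v(1)] obtain z where "u \<preceq> z" "v \<preceq> z" "pre z \<omega>" .
      then show ?case using ple_set u v by blast
    qed
    from this[of UNIV] show ?case by auto
  qed
qed

text \<open>
With positive probability the first layer is \<open>c\<close>, and almost surely all letters occur. So there is an
infinite trace with both properties, and a sufficiently long finite prefix of it contains all letters
and has \<open>c\<close> as its clique of minimal letters.
\<close>
lemma h_pos_protection:
  assumes "clique I c" "h_val I \<nu> \<beta> c > 0"
  obtains y where "state \<beta> y \<noteq> None" "set y = UNIV" "heads y = c"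
proof -
  have pos: "measure (\<nu> \<beta>) {\<omega>\<in>boundary I. \<omega> 0 = c} > 0" using h_val_alt[OF assms(1)] assms(2) by simp
  have notAE: "\<not> (AE \<omega> in \<nu> \<beta>. \<omega> \<notin> {\<omega>\<in>boundary I. \<omega> 0 = c})"
  proof
    assume "AE \<omega> in \<nu> \<beta>. \<omega> \<notin> {\<omega>\<in>boundary I. \<omega> 0 = c}"
    then have "measure (\<nu> \<beta>) {\<omega>\<in>boundary I. \<omega> 0 = c} = measure (\<nu> \<beta>) {}"
      using pos measure_notin_sets[of "{\<omega>\<in>boundary I. \<omega> 0 = c}" "\<nu> \<beta>"]
      by (intro \<nu>.finite_measure_eq_AE) auto
    then show False using pos by simp
  qed
  have AE: "AE \<omega> in \<nu> \<beta>. (\<exists>u. pre u \<omega> \<and> set u = UNIV) \<and> (\<forall>u. pre u \<omega> \<longrightarrow> state \<beta> u \<noteq> None) \<and> \<omega> \<in> boundary I"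
    using AE_all_letters AE_enabled AE_boundary by eventually_elim auto
  have "\<exists>\<omega>. \<omega> \<in> {\<omega>\<in>boundary I. \<omega> 0 = c} \<and> (\<exists>u. pre u \<omega> \<and> set u = UNIV) \<and> (\<forall>u. pre u \<omega> \<longrightarrow> state \<beta> u \<noteq> None)"
  proof (rule ccontr)
    assume no: "\<not> ?thesis"
    have "AE \<omega> in \<nu> \<beta>. \<omega> \<notin> {\<omega>\<in>boundary I. \<omega> 0 = c}"
      using AE
    proof eventually_elim
      case (elim \<omega>)
      then show ?case using no by blast
    qed
    then show False using notAE by blast
  qed
  then obtain \<omega> u where \<omega>: "\<omega> \<in> boundary I" "\<omega> 0 = c" "pre u \<omega>" "set u = UNIV" "\<And>u. pre u \<omega> \<Longrightarrow> state \<beta> u \<noteq> None"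
    by blast
  have "pre (cw c) \<omega>" using pre_layers[of \<omega> 1] \<omega>(2) by (simp add: layers_Suc)
  with \<omega>(3) obtain z where z: "u \<preceq> z" "cw c \<preceq> z" "pre z \<omega>" by (rule pre_directed)
  have "set z = UNIV" using ple_set[OF z(1)] \<omega>(4) by auto
  moreover have "heads z = c"
  proof
    show "c \<subseteq> heads z" using cw_ple_iff[OF assms(1)] z(2) by simp
    have "heads z \<subseteq> next_clique [] \<omega>" using z(3) next_clique_alt[of "[]" z \<omega>] by (auto simp: pre_iff)
    also have "next_clique [] \<omega> = c" using next_clique_layers[OF \<omega>(1), of 0] \<omega>(2) by simp
    finally show "heads z \<subseteq> c" .
  qed
  ultimately show ?thesis using that \<omega>(5)[OF z(3)] by blast
qed

end

context trace_alphabet begin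

text \<open>
Once all letters have occurred, a further letter cannot become minimal. So a word with all letters
protects the first clique in the sense of \<^const>\<open>stable\<close>.
\<close>
lemma heads_all_letters:
  assumes "y \<preceq> z" "set y = UNIV" shows "heads z = heads y"
proof
  show "heads y \<subseteq> heads z" by (rule heads_mono[OF assms(1)])
  obtain x where x: "y @ x \<simeq> z" using assms(1) by (rule pleE)
  show "heads z \<subseteq> heads y" using heads_append[of _ y x] heads_teq[OF x] assms(2) by auto
qed

text \<open>
The analogue of \<open>heads_all_letters\<close> after a prefix \<open>v\<close> of an infinite trace.
\<close>
lemma next_clique_all_letters:
  assumes "pre (v @ y) \<omega>" "set y = UNIV" shows "next_clique v \<omega> = heads y"
proof
  obtain n where "v @ y \<preceq> layers \<omega> n" using assms(1) by (auto simp: pre_iff)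
  then show "heads y \<subseteq> next_clique v \<omega>" by (rule next_clique_alt)
  show "next_clique v \<omega> \<subseteq> heads y"
  proof
    fix a assume "a \<in> next_clique v \<omega>"
    then have "pre (v @ [a]) \<omega>" by (simp add: next_clique_def)
    with assms(1) obtain z where z: "v @ y \<preceq> z" "v @ [a] \<preceq> z" by (rule pre_directed)
    have "v \<preceq> z" using z(1) ple_append ple_trans by blast
    then obtain x where x: "v @ x \<simeq> z" by (rule pleE)
    have "y \<preceq> x" "[a] \<preceq> x"
      using ple_cancel ple_teq_trans2[OF z(1) teq_sym[OF x]] ple_teq_trans2[OF z(2) teq_sym[OF x]] by blast+
    then show "a \<in> heads y" using heads_all_letters[OF _ assms(2)] by (auto simp: heads_def)
  qed
qed

end

section \<open>Regeneration\<close>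

text \<open>
Each value of \<open>i div B\<close> is taken \<open>B\<close> times, so this is \<open>B\<close> times a geometric series.
\<close>
lemma summable_power_div:
  fixes q :: real assumes "0 \<le> q" "q < 1" "B > 0" shows "summable (\<lambda>i. q ^ (i div B))"
proof (rule summableI_nonneg_bounded[where x = "real B * (1 / (1 - q))"])
  fix n
  have "(\<Sum>i<n. q ^ (i div B)) \<le> (\<Sum>i<n * B. q ^ (i div B))"
    using assms by (intro sum_mono2) auto
  also have "\<dots> = (\<Sum>k<n. \<Sum>i\<in>{k * B..<k * B + B}. q ^ (i div B))" by (rule sum.nat_group[symmetric])
  also have "\<dots> = (\<Sum>k<n. \<Sum>i\<in>{k * B..<k * B + B}. q ^ k)"
  proof (intro sum.cong HOL.refl)
    fix k i assume "i \<in> {k * B..<k * B + B}"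
    then have "i div B = k" using assms(3) by (intro div_nat_eqI) (auto simp: ac_simps)
    then show "q ^ (i div B) = q ^ k" by simp
  qed
  also have "\<dots> = real B * (\<Sum>k<n. q ^ k)" by (simp add: sum_distrib_left)
  also have "\<dots> \<le> real B * (1 / (1 - q))"
    using assms sum_le_suminf[of "\<lambda>k. q ^ k" "{..<n}"] by (intro mult_left_mono) (auto simp: suminf_geometric)
  finally show "(\<Sum>i<n. q ^ (i div B)) \<le> real B * (1 / (1 - q))" .
qed (use assms in auto)

context trace_alphabet begin

lemma pre_layers_length:
  assumes "\<omega> \<in> boundary I" "pre (layers \<omega> k @ Y) \<omega>"
  shows "layers \<omega> k @ Y \<preceq> layers \<omega> (k + length Y)"
proof -
  obtain N where "layers \<omega> k @ Y \<preceq> layers \<omega> N" using assms(2) by (auto simp: pre_iff)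
  also have "layers \<omega> N \<preceq> layers \<omega> (k + (length Y + N))" by (rule layers_mono) simp
  finally have "Y \<preceq> cws (map \<omega> [k..<k + (length Y + N)])" unfolding layers_add by (rule ple_cancel)
  from ple_cws_take[OF normal_map[OF assms(1)] this]
  have "Y \<preceq> cws (map \<omega> [k..<k + length Y])" by (simp add: take_map)
  then show ?thesis unfolding layers_add by (rule ple_left)
qed

end

text \<open>
From now on \<open>w\<close> is a cutting word that is enabled in \<open>\<alpha>0\<close> and leads to \<open>\<beta>0\<close>. The state after \<open>w\<close> is
always \<open>\<beta>0\<close>, so an infinite trace starts afresh each time \<open>w\<close> has been executed from \<open>\<alpha>0\<close>.
\<close>
locale regeneration = markov_system I act \<nu>
  for I :: "('a::finite \<times> 'a) set" and act :: "('a, 's::finite) action" and \<nu> :: "('a, 's) measure_family" +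
  fixes \<alpha>0 :: 's and w :: "'a list" and t :: 'a and \<beta>0 :: 's
  assumes state_w: "state \<alpha>0 w = Some \<beta>0"
    and top_w: "strong_top t w"
    and cut_w: "\<And>b. \<exists>u1 u2. w = u1 @ u2 \<and> strong_top b u1"
begin

definition hit :: "'s \<Rightarrow> 'a list set" where
  "hit \<alpha> = {u. \<exists>x. u \<simeq> x @ w \<and> state \<alpha> x = Some \<alpha>0}"

text \<open>
The minimal hits. Canonical words are taken so that a sum over blocks counts each trace once.
\<close>
definition block :: "'s \<Rightarrow> 'a list set" where
  "block \<alpha> = {u. rep u = u \<and> u \<in> hit \<alpha> \<and> (\<forall>v z. u \<simeq> v @ z \<longrightarrow> v \<in> hit \<alpha> \<longrightarrow> z = [])}"

lemma hit_teq: "u \<in> hit \<alpha> \<Longrightarrow> u \<simeq> v \<Longrightarrow> v \<in> hit \<alpha>"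
  unfolding hit_def using teq_trans[OF teq_sym] by blast

lemma hitI: "state \<alpha> x = Some \<alpha>0 \<Longrightarrow> x @ w \<in> hit \<alpha>"
  using teq_refl by (auto simp: hit_def)

lemma hit_state: "u \<in> hit \<alpha> \<Longrightarrow> state \<alpha> u = Some \<beta>0"
  unfolding hit_def using state_teq state_append_Some state_w by auto

lemma hit_peaked: assumes "u \<in> hit \<alpha>" shows "peaked t u"
proof -
  obtain x where "u \<simeq> x @ w" using assms by (auto simp: hit_def)
  then show ?thesis using peaked_teq[OF strong_top_peaked[OF top_w, of x] teq_sym] by simp
qed

lemma hit_linear: "u \<in> hit \<alpha> \<Longrightarrow> v \<in> hit \<alpha> \<Longrightarrow> u \<preceq> z \<Longrightarrow> v \<preceq> z \<Longrightarrow> u \<preceq> v \<or> v \<preceq> u"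
  by (rule peaked_linear) (auto intro: hit_peaked)

lemma block_hit: "u \<in> block \<alpha> \<Longrightarrow> u \<in> hit \<alpha>" by (simp add: block_def)

lemma block_state: "u \<in> block \<alpha> \<Longrightarrow> state \<alpha> u = Some \<beta>0" using block_hit hit_state by blast

text \<open>
Hits have the common peak \<open>t\<close>, so hits below a common trace are comparable, and the minimal one is the
least one.
\<close>
lemma block_least:
  assumes "u \<in> block \<alpha>" "v \<in> hit \<alpha>" "u \<preceq> z" "v \<preceq> z" shows "u \<preceq> v"
proof -
  from hit_linear[OF block_hit[OF assms(1)] assms(2-4)] show ?thesis
  proof
    assume "v \<preceq> u"
    then obtain x where x: "v @ x \<simeq> u" by (rule pleE)
    then have "x = []" using assms(1,2) teq_sym[OF x] by (auto simp: block_def)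
    then show ?thesis using x by (simp add: ple_teq teq_sym)
  qed
qed

lemma block_incompatible: "incompatible (block \<alpha>)"
  unfolding incompatible_def
proof (intro ballI impI notI)
  fix u v assume uv: "u \<in> block \<alpha>" "v \<in> block \<alpha>" "u \<noteq> v" and "\<exists>z. u \<preceq> z \<and> v \<preceq> z"
  then obtain z where z: "u \<preceq> z" "v \<preceq> z" by blast
  have "u \<preceq> v" "v \<preceq> u" using block_least uv z block_hit by blast+
  then have "rep u = rep v" by (intro rep_eqI ple_antisym)
  then show False using uv by (simp add: block_def)
qed

lemma hit_block: assumes "u \<in> hit \<alpha>" obtains v where "v \<in> block \<alpha>" "v \<preceq> u"
proof -
  define P where "P = (\<lambda>v. v \<preceq> u \<and> v \<in> hit \<alpha>)"
  have "P u" using assms ple_refl by (simp add: P_def)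
  then obtain v where v: "P v" and min: "\<And>w. P w \<Longrightarrow> length v \<le> length w"
    using ex_has_least_nat[of P u length] by blast
  have "z = []" if x: "rep v \<simeq> x @ z" "x \<in> hit \<alpha>" for x z
  proof -
    have vx: "v \<simeq> x @ z" using teq_trans[OF rep_teq x(1)] .
    have "x \<preceq> v" by (rule pleI[OF teq_sym[OF vx]])
    then have "P x" using v x(2) by (auto simp: P_def intro: ple_trans)
    then have "length v \<le> length x" by (rule min)
    then have "length z = 0" using teq_length[OF vx] unfolding length_append by linarith
    then show ?thesis by simp
  qed
  then have "rep v \<in> block \<alpha>" using v hit_teq[OF _ rep_teq, of v] by (simp add: block_def P_def)
  moreover have "rep v \<preceq> u" using v ple_teq_trans1[OF teq_sym[OF rep_teq], of v u] by (simp add: P_def)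
  ultimately show ?thesis by (rule that)
qed

lemma block_nonempty: "u \<in> block \<alpha> \<Longrightarrow> u \<noteq> []"
  using hit_peaked[OF block_hit, of u \<alpha>] unfolding peaked_def by (metis list.set(1) empty_iff)

text \<open>
Let \<open>v\<close> and \<open>v'\<close> be the next pieces after \<open>R\<close>, and write \<open>v'\<close> as \<open>x @ w\<close>. By the cutting property of the
final \<open>w\<close>, a trace \<open>y\<close> below the same trace contains \<open>R @ v @ x\<close>, and so \<open>R @ v\<close>, or lies below
\<open>R @ v @ v'\<close>.
\<close>
lemma regeneration_cut:
  assumes v': "v' \<in> block \<beta>" and z: "R @ v @ v' \<preceq> z" and y: "y \<preceq> z" and n: "\<not> R @ v \<preceq> y"
  shows "y \<preceq> R @ v @ v'"
proof -
  obtain x where x: "v' \<simeq> x @ w" using block_hit[OF v'] by (auto simp: hit_def)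
  have e: "(R @ v) @ v' \<simeq> (R @ v @ x) @ w" using teq_left[OF x, of "R @ v"] by simp
  obtain z' where "(R @ v @ v') @ z' \<simeq> z" using z by (rule pleE)
  moreover have "(R @ v @ v') @ z' \<simeq> (R @ v @ x) @ w @ z'" using teq_right[OF e, of z'] by simp
  ultimately have "z \<simeq> (R @ v @ x) @ w @ z'" by (meson teq_trans teq_sym)
  with y have "y \<preceq> (R @ v @ x) @ w @ z'" by (rule ple_teq_trans2)
  from ple_cut[OF cut_w this] have "y \<preceq> (R @ v @ x) @ w"
  proof
    assume "R @ v @ x \<preceq> y"
    then have "(R @ v) @ x \<preceq> y" by simp
    then have "R @ v \<preceq> y" by (rule ple_trans[OF ple_append])
    then show ?thesis using n by simp
  qed
  then show ?thesis using ple_teq_trans2[OF _ teq_sym[OF e]] by simp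
qed

subsection \<open>Geometric tail of the first regeneration\<close>

definition nohit :: "'s \<Rightarrow> nat \<Rightarrow> (nat \<Rightarrow> 'a set) set" where
  "nohit \<alpha> n = {\<omega>\<in>boundary I. \<not> (\<exists>v\<in>hit \<alpha>. v \<preceq> layers \<omega> n)}"

lemma sets_nohit: "nohit \<alpha> n \<in> sets (\<nu> \<beta>)"
  unfolding nohit_def
  by (rule sets_finite_dep[where n = n and Q = "\<lambda>cs. \<not> (\<exists>v\<in>hit \<alpha>. v \<preceq> cws cs)"]) (simp add: layers_def)

lemma nohit_antimono: "m \<le> n \<Longrightarrow> nohit \<alpha> n \<subseteq> nohit \<alpha> m"
  unfolding nohit_def using ple_trans[OF _ layers_mono] by blast

text \<open>
A continuation \<open>Y\<close> that forces the clique \<open>c\<close> as next layer and also completes a hit: a protection of \<open>c\<close>,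
followed by a path to \<open>\<alpha>0\<close> and by \<open>w\<close>.
\<close>
lemma protected_hit:
  assumes "clique I c" "h_val I \<nu> \<beta> c > 0"
  obtains Y x where "state \<beta> x = Some \<alpha>0" "Y = x @ w" "\<And>v \<omega>. pre (v @ Y) \<omega> \<Longrightarrow> next_clique v \<omega> = c"
proof -
  obtain y where y: "state \<beta> y \<noteq> None" "set y = UNIV" "heads y = c" by (rule h_pos_protection[OF assms])
  then obtain \<gamma> where \<gamma>: "state \<beta> y = Some \<gamma>" by blast
  obtain z where "state \<gamma> z = Some \<alpha>0" by (rule transitive)
  then have "state \<beta> (y @ z) = Some \<alpha>0" using state_append_Some[OF \<gamma>] by simp
  moreover have "next_clique v \<omega> = c" if "pre (v @ (y @ z) @ w) \<omega>" for v \<omega>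
  proof -
    have "pre (v @ y) \<omega>" using that pre_appendD[of "v @ y" "z @ w"] by simp
    then show ?thesis using next_clique_all_letters[OF _ y(2)] y(3) by simp
  qed
  ultimately show ?thesis using that by blast
qed

text \<open>
Condition on the first \<open>n + 1\<close> layers \<open>cs @ [c]\<close>. If they have positive probability, then the weight \<open>h\<close>
of \<open>c\<close> after \<open>cs\<close> is positive, so \<open>protected_hit\<close> provides a continuation \<open>y\<close> after \<open>cs\<close> that forces
these layers and completes a hit. Its conditional probability is at least that of \<open>y\<close>, since the atom is
contained in the cylinder of \<open>cws cs\<close>. There are finitely many pairs of a state and a clique to consider,
which makes the bound \<open>\<delta>\<close> and the number \<open>m\<close> of additional layers uniform.
\<close>
lemma nohit_decay:
  "\<exists>m>0. \<exists>q<1. 0 \<le> q \<and> (\<forall>\<alpha> n. measure (\<nu> \<alpha>) (nohit \<alpha> (Suc n + m)) \<le> q * measure (\<nu> \<alpha>) (nohit \<alpha> (Suc n)))"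
proof -
  define S where "S = {(\<beta>, c). clique I c \<and> h_val I \<nu> \<beta> c > 0}"
  have "\<forall>bc\<in>S. \<exists>Y x. state (fst bc) x = Some \<alpha>0 \<and> Y = x @ w \<and> (\<forall>v \<omega>. pre (v @ Y) \<omega> \<longrightarrow> next_clique v \<omega> = snd bc)"
  proof
    fix bc assume "bc \<in> S"
    then have "clique I (snd bc)" "h_val I \<nu> (fst bc) (snd bc) > 0" by (auto simp: S_def)
    then show "\<exists>Y x. state (fst bc) x = Some \<alpha>0 \<and> Y = x @ w \<and> (\<forall>v \<omega>. pre (v @ Y) \<omega> \<longrightarrow> next_clique v \<omega> = snd bc)"
      by (rule protected_hit) blast
  qed
  from bchoice[OF this] obtain Y where
    Y: "\<forall>bc\<in>S. \<exists>x. state (fst bc) x = Some \<alpha>0 \<and> Y bc = x @ w \<and> (\<forall>v \<omega>. pre (v @ Y bc) \<omega> \<longrightarrow> next_clique v \<omega> = snd bc)"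
    by blast
  \<comment> \<open>A continuation of length at most \<open>m\<close> occupies at most \<open>m\<close> further layers; the successor makes
    \<open>m\<close> positive.\<close>
  define m where "m = Suc (Max (insert 0 ((\<lambda>bc. length (Y bc)) ` S)))"
  define \<delta> where "\<delta> = Min (insert 1 ((\<lambda>bc. f (fst bc) (Y bc)) ` S))"
  have finS: "finite S" by simp
  have m: "length (Y bc) \<le> m" if "bc \<in> S" for bc
  proof -
    have "length (Y bc) \<le> Max (insert 0 ((\<lambda>bc. length (Y bc)) ` S))" using that finS by (intro Max_ge) auto
    then show ?thesis unfolding m_def by (rule le_SucI)
  qed
  have \<delta>: "\<delta> \<le> f (fst bc) (Y bc)" if "bc \<in> S" for bc
    unfolding \<delta>_def using that finS by (intro Min_le) auto
  have "f (fst bc) (Y bc) > 0" if "bc \<in> S" for bc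
  proof -
    from bspec[OF Y that] obtain x where x: "state (fst bc) x = Some \<alpha>0" "Y bc = x @ w" by (elim exE conjE)
    then have "state (fst bc) (Y bc) = Some \<beta>0" using state_append_Some[OF x(1), of w] state_w by simp
    then show ?thesis by (simp add: f_pos_iff)
  qed
  then have \<delta>0: "\<delta> > 0" unfolding \<delta>_def using finS by (subst Min_gr_iff) auto
  have \<delta>1: "\<delta> \<le> 1" unfolding \<delta>_def using finS by (intro Min_le) auto
  have "measure (\<nu> \<alpha>) (nohit \<alpha> (Suc n + m)) \<le> (1 - \<delta>) * measure (\<nu> \<alpha>) (nohit \<alpha> (Suc n))" for \<alpha> n
  proof -
    define T where "T = {ds :: 'a set list. length ds = Suc n \<and> \<not> (\<exists>v\<in>hit \<alpha>. v \<preceq> cws ds)}"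
    have finT: "finite T"
      unfolding T_def by (rule finite_subset[OF _ finite_lists_length[of "Suc n"]]) auto
    have disj: "disjoint_family_on atom T"
      unfolding disjoint_family_on_def
    proof (intro ballI impI)
      fix ds es assume d: "ds \<in> T" "es \<in> T" "ds \<noteq> es"
      then have l: "length ds = length es" by (simp add: T_def)
      show "atom ds \<inter> atom es = {}"
      proof (rule ccontr)
        assume "atom ds \<inter> atom es \<noteq> {}"
        then obtain \<omega> where "map \<omega> [0..<length ds] = ds" "map \<omega> [0..<length es] = es"
          unfolding atom_def by blast
        then show False using d(3) l by metis
      qed
    qed
    have in_atom: "\<omega> \<in> atom (map \<omega> [0..<k])" if "\<omega> \<in> boundary I" for \<omega> k using that by (simp add: atom_def)
    have U: "nohit \<alpha> (Suc n) = (\<Union>ds\<in>T. atom ds)"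
    proof (rule Set.set_eqI, rule iffI)
      fix \<omega> assume "\<omega> \<in> nohit \<alpha> (Suc n)"
      then have "\<omega> \<in> boundary I" "map \<omega> [0..<Suc n] \<in> T" by (simp_all add: nohit_def T_def layers_def del: upt_Suc)
      then show "\<omega> \<in> (\<Union>ds\<in>T. atom ds)" using in_atom by blast
    next
      fix \<omega> assume "\<omega> \<in> (\<Union>ds\<in>T. atom ds)"
      then obtain ds where ds: "ds \<in> T" "\<omega> \<in> atom ds" by (rule UN_E)
      then have "layers \<omega> (Suc n) = cws ds" "\<omega> \<in> boundary I" unfolding atom_def T_def layers_def by (simp_all del: upt_Suc)
      then show "\<omega> \<in> nohit \<alpha> (Suc n)" using ds(1) by (simp add: nohit_def T_def)
    qed
    have atom_le: "measure (\<nu> \<alpha>) (atom ds \<inter> nohit \<alpha> (Suc n + m)) \<le> (1 - \<delta>) * measure (\<nu> \<alpha>) (atom ds)"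
      if ds: "ds \<in> T" for ds
    proof (cases "measure (\<nu> \<alpha>) (atom ds) = 0")
      case True
      have "measure (\<nu> \<alpha>) (atom ds \<inter> nohit \<alpha> (Suc n + m)) \<le> measure (\<nu> \<alpha>) (atom ds)"
        by (rule \<nu>.finite_measure_mono) (auto intro: sets_atom)
      then show ?thesis using True by simp
    next
      case False
      from ds obtain cs c where dsc: "ds = cs @ [c]" "length cs = n"
        unfolding T_def by (cases ds rule: rev_cases) auto
      have nds: "normal (cs @ [c])" using False atom_not_normal[of ds] dsc by fastforce
      have "state \<alpha> (cws cs) \<noteq> None"
      proof
        assume "state \<alpha> (cws cs) = None"
        then have "state \<alpha> (cws ds) = None" by (simp add: dsc state_append)
        then show False using False measure_atom_disabled by simp
      qed
      then obtain \<beta> where \<beta>: "state \<alpha> (cws cs) = Some \<beta>" by blast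
      have mds: "measure (\<nu> \<alpha>) (atom ds) = f \<alpha> (cws cs) * h_val I \<nu> \<beta> c"
        using measure_atom[OF nds \<beta>] dsc by simp
      have cc: "clique I c" using nds by (simp add: normal_append)
      then have "h_val I \<nu> \<beta> c > 0" using False mds h_val_nonneg[OF cc, of \<beta>] by (simp add: less_le)
      then have bc: "(\<beta>, c) \<in> S" using cc by (simp add: S_def)
      define y where "y = Y (\<beta>, c)"
      obtain x where x: "state \<beta> x = Some \<alpha>0" "y = x @ w" "\<And>v \<omega>. pre (v @ y) \<omega> \<Longrightarrow> next_clique v \<omega> = c"
        using bspec[OF Y bc] by (auto simp: y_def)
      let ?C = "{\<omega>\<in>boundary I. pre (cws cs @ y) \<omega>}"
      have sub: "?C \<subseteq> atom ds"
        unfolding dsc(1) atom_eq[OF nds] using x(3) pre_appendD by blast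
      have "cws cs @ y \<in> hit \<alpha>"
        using hitI[of \<alpha> "cws cs @ x"] state_append_Some[OF \<beta>, of x] x(1,2) by simp
      have "atom ds \<inter> nohit \<alpha> (Suc n + m) \<subseteq> atom ds - ?C"
      proof
        fix \<omega> assume \<omega>: "\<omega> \<in> atom ds \<inter> nohit \<alpha> (Suc n + m)"
        have "\<omega> \<notin> ?C"
        proof
          assume C: "\<omega> \<in> ?C"
          have "map \<omega> [0..<length cs] @ [\<omega> (length cs)] = cs @ [c]"
            using \<omega> unfolding dsc(1) atom_def by simp
          then have pcn: "layers \<omega> n = cws cs" unfolding layers_def using dsc(2) by simp
          have "layers \<omega> n @ y \<preceq> layers \<omega> (n + length y)"
            by (rule pre_layers_length) (use C pcn in auto)
          also have "layers \<omega> (n + length y) \<preceq> layers \<omega> (Suc n + m)"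
            using m[OF bc] by (intro layers_mono) (simp add: y_def)
          finally have "cws cs @ y \<preceq> layers \<omega> (Suc n + m)" by (simp add: pcn)
          then show False using \<omega> \<open>cws cs @ y \<in> hit \<alpha>\<close> by (auto simp: nohit_def)
        qed
        then show "\<omega> \<in> atom ds - ?C" using \<omega> by blast
      qed
      then have "measure (\<nu> \<alpha>) (atom ds \<inter> nohit \<alpha> (Suc n + m)) \<le> measure (\<nu> \<alpha>) (atom ds - ?C)"
        by (rule \<nu>.finite_measure_mono) (intro sets.Diff sets_atom sets_pre)
      also have "\<dots> = measure (\<nu> \<alpha>) (atom ds) - f \<alpha> (cws cs @ y)"
        unfolding f_eq by (rule \<nu>.finite_measure_Diff[OF sets_atom sets_pre sub])
      also have "f \<alpha> (cws cs @ y) = f \<alpha> (cws cs) * f \<beta> y" by (rule f_append[OF \<beta>])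
      also have "measure (\<nu> \<alpha>) (atom ds) - f \<alpha> (cws cs) * f \<beta> y \<le> (1 - \<delta>) * measure (\<nu> \<alpha>) (atom ds)"
      proof -
        have "measure (\<nu> \<alpha>) (atom ds) \<le> f \<alpha> (cws cs)"
          unfolding mds using h_val_le_1[OF cc, of \<beta>] f_nonneg[of \<alpha> "cws cs"] mult_left_le by blast
        moreover have "\<delta> \<le> f \<beta> y" using \<delta>[OF bc] by (simp add: y_def)
        ultimately have "measure (\<nu> \<alpha>) (atom ds) * \<delta> \<le> f \<alpha> (cws cs) * f \<beta> y"
          using \<delta>0 f_nonneg by (intro mult_mono) auto
        then show ?thesis by (simp add: algebra_simps)
      qed
      finally show ?thesis .
    qed
    have "nohit \<alpha> (Suc n + m) = (\<Union>ds\<in>T. atom ds \<inter> nohit \<alpha> (Suc n + m))"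
      using nohit_antimono[of "Suc n" "Suc n + m" \<alpha>] U by auto
    then have "measure (\<nu> \<alpha>) (nohit \<alpha> (Suc n + m)) = measure (\<nu> \<alpha>) (\<Union>ds\<in>T. atom ds \<inter> nohit \<alpha> (Suc n + m))" by simp
    also have "\<dots> = (\<Sum>ds\<in>T. measure (\<nu> \<alpha>) (atom ds \<inter> nohit \<alpha> (Suc n + m)))"
      using disj by (intro \<nu>.finite_measure_finite_Union finT)
        (auto simp: disjoint_family_on_def intro!: sets.Int sets_atom sets_nohit)
    also have "\<dots> \<le> (\<Sum>ds\<in>T. (1 - \<delta>) * measure (\<nu> \<alpha>) (atom ds))" by (rule sum_mono) (rule atom_le)
    also have "\<dots> = (1 - \<delta>) * measure (\<nu> \<alpha>) (nohit \<alpha> (Suc n))"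
      unfolding U sum_distrib_left[symmetric]
      by (subst \<nu>.finite_measure_finite_Union[OF finT _ disj]) (auto intro: sets_atom)
    finally show ?thesis .
  qed
  then show ?thesis using \<delta>0 \<delta>1
    by (intro exI[of _ m] conjI exI[of _ "1 - \<delta>"]) (auto simp: m_def)
qed

lemma nohit_geometric:
  obtains m q where "m > 0" "0 \<le> q" "q < 1" "\<And>\<alpha> k. measure (\<nu> \<alpha>) (nohit \<alpha> (Suc (k * m))) \<le> q ^ k"
proof -
  obtain m q where m: "m > 0" "q < 1" "0 \<le> q"
    "\<And>\<alpha> n. measure (\<nu> \<alpha>) (nohit \<alpha> (Suc n + m)) \<le> q * measure (\<nu> \<alpha>) (nohit \<alpha> (Suc n))"
    using nohit_decay by blast
  have "measure (\<nu> \<alpha>) (nohit \<alpha> (Suc (k * m))) \<le> q ^ k" for \<alpha> k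
  proof (induction k)
    case (Suc k)
    have "measure (\<nu> \<alpha>) (nohit \<alpha> (Suc (Suc k * m))) \<le> q * measure (\<nu> \<alpha>) (nohit \<alpha> (Suc (k * m)))"
      using m(4)[of \<alpha> "k * m"] by (simp add: add.commute)
    also have "\<dots> \<le> q * q ^ k" using Suc m(3) by (intro mult_left_mono)
    finally show ?case by simp
  qed simp
  then show ?thesis using that m by blast
qed

lemma AE_block: "AE \<omega> in \<nu> \<alpha>. \<exists>v\<in>block \<alpha>. pre v \<omega>"
proof -
  obtain m q where m: "m > 0" "0 \<le> q" "q < 1" "\<And>\<alpha> k. measure (\<nu> \<alpha>) (nohit \<alpha> (Suc (k * m))) \<le> q ^ k"
    by (rule nohit_geometric) blast
  define N where "N = (\<Inter>n. nohit \<alpha> n)"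
  have Ns: "N \<in> sets (\<nu> \<alpha>)" unfolding N_def by (rule sets.countable_INT) (use sets_nohit in auto)
  have "measure (\<nu> \<alpha>) N \<le> q ^ k" for k
  proof -
    have "measure (\<nu> \<alpha>) N \<le> measure (\<nu> \<alpha>) (nohit \<alpha> (Suc (k * m)))"
      by (rule \<nu>.finite_measure_mono[OF _ sets_nohit]) (auto simp: N_def)
    also note m(4)
    finally show ?thesis .
  qed
  moreover have "(\<lambda>k. q ^ k) \<longlonglongrightarrow> 0" using m by (intro LIMSEQ_power_zero) auto
  ultimately have "measure (\<nu> \<alpha>) N \<le> 0" by (intro LIMSEQ_le_const) auto
  then have "emeasure (\<nu> \<alpha>) N = 0" by (simp add: \<nu>.emeasure_eq_measure measure_le_0_iff)
  then have "AE \<omega> in \<nu> \<alpha>. \<omega> \<notin> N" using Ns by (intro AE_not_in) (auto simp: null_sets_def)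
  with AE_boundary show ?thesis
  proof eventually_elim
    case (elim \<omega>)
    then obtain n v where v: "v \<in> hit \<alpha>" "v \<preceq> layers \<omega> n" by (auto simp: N_def nohit_def)
    obtain u where "u \<in> block \<alpha>" "u \<preceq> v" using hit_block[OF v(1)] .
    then show ?case using v(2) pre_ple[OF _ pre_layers] ple_trans by blast
  qed
qed

lemma block_sum: "(\<integral>\<^sup>+v. ennreal (f \<alpha> v) \<partial>count_space (block \<alpha>)) = 1"
proof -
  have "(\<integral>\<^sup>+v. ennreal (f \<alpha> v) \<partial>count_space (block \<alpha>)) = emeasure (\<nu> \<alpha>) {\<omega>\<in>boundary I. \<exists>v\<in>block \<alpha>. pre v \<omega>}"
    by (rule emeasure_ex_pre[OF block_incompatible, symmetric])
  also have "\<dots> = 1"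
  proof (rule \<nu>.emeasure_eq_1_AE[OF sets_ex_pre])
    show "AE \<omega> in \<nu> \<alpha>. \<omega> \<in> {\<omega>\<in>boundary I. \<exists>v\<in>block \<alpha>. pre v \<omega>}"
      using AE_block[of \<alpha>] AE_boundary[of \<alpha>] by eventually_elim simp
  qed
  finally show ?thesis .
qed

text \<open>
The law of the first block from \<open>\<beta>0\<close>; the weights add up to 1 since almost surely there is a hit.
\<close>
definition block_pmf :: "'a list pmf" where
  "block_pmf = embed_pmf (\<lambda>v. if v \<in> block \<beta>0 then f \<beta>0 v else 0)"

lemma pmf_block_pmf: "pmf block_pmf v = (if v \<in> block \<beta>0 then f \<beta>0 v else 0)"
  unfolding block_pmf_def
proof (rule pmf_embed_pmf)
  fix v show "0 \<le> (if v \<in> block \<beta>0 then f \<beta>0 v else 0)" by (simp add: f_nonneg)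
next
  have "(\<integral>\<^sup>+v. ennreal (if v \<in> block \<beta>0 then f \<beta>0 v else 0) \<partial>count_space UNIV)
    = (\<integral>\<^sup>+v. ennreal (f \<beta>0 v) * indicator (block \<beta>0) v \<partial>count_space UNIV)"
    by (rule nn_integral_cong) (simp split: split_indicator)
  also have "\<dots> = 1" using block_sum[of \<beta>0] by (simp add: nn_integral_count_space_indicator)
  finally show "(\<integral>\<^sup>+v. ennreal (if v \<in> block \<beta>0 then f \<beta>0 v else 0) \<partial>count_space UNIV) = 1" .
qed

lemma set_block_pmf: "set_pmf block_pmf = block \<beta>0"
proof (rule Set.set_eqI)
  fix v
  have "f \<beta>0 v \<noteq> 0" if "v \<in> block \<beta>0" using f_pos_iff[of \<beta>0 v] block_state[OF that] by simp
  then show "v \<in> set_pmf block_pmf \<longleftrightarrow> v \<in> block \<beta>0" by (auto simp: set_pmf_iff pmf_block_pmf)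
qed

text \<open>
A layer has at most \<open>CARD('a)\<close> letters, so a block with more than \<open>n * CARD('a)\<close> letters is not complete
after \<open>n\<close> layers; and there is no earlier hit, since the block is the least one.
\<close>
lemma block_tail:
  "emeasure (measure_pmf block_pmf) {v. n * CARD('a) < length v} \<le> ennreal (measure (\<nu> \<beta>0) (nohit \<beta>0 n))"
proof -
  define U where "U = {v \<in> block \<beta>0. n * CARD('a) < length v}"
  have inc: "incompatible U" using block_incompatible[of \<beta>0] by (auto simp: incompatible_def U_def)
  have "emeasure (measure_pmf block_pmf) {v. n * CARD('a) < length v} = emeasure (measure_pmf block_pmf) U"
    by (rule emeasure_eq_AE) (auto simp: U_def AE_measure_pmf_iff set_block_pmf)
  also have "\<dots> = (\<integral>\<^sup>+v. ennreal (pmf block_pmf v) \<partial>count_space U)" by (rule nn_integral_pmf[symmetric])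
  also have "\<dots> = (\<integral>\<^sup>+v. ennreal (f \<beta>0 v) \<partial>count_space U)"
    by (rule nn_integral_cong) (simp add: pmf_block_pmf U_def)
  also have "\<dots> = emeasure (\<nu> \<beta>0) {\<omega>\<in>boundary I. \<exists>v\<in>U. pre v \<omega>}" by (rule emeasure_ex_pre[OF inc, symmetric])
  also have "\<dots> \<le> emeasure (\<nu> \<beta>0) (nohit \<beta>0 n)"
  proof (rule emeasure_mono[OF _ sets_nohit])
    show "{\<omega>\<in>boundary I. \<exists>v\<in>U. pre v \<omega>} \<subseteq> nohit \<beta>0 n"
    proof
      fix \<omega> assume "\<omega> \<in> {\<omega>\<in>boundary I. \<exists>v\<in>U. pre v \<omega>}"
      then obtain v where v: "\<omega> \<in> boundary I" "v \<in> U" "pre v \<omega>" by blast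
      have "\<not> (\<exists>u\<in>hit \<beta>0. u \<preceq> layers \<omega> n)"
      proof
        assume "\<exists>u\<in>hit \<beta>0. u \<preceq> layers \<omega> n"
        then obtain u where u: "u \<in> hit \<beta>0" "u \<preceq> layers \<omega> n" by blast
        have "pre u \<omega>" using u(2) pre_layers by (rule pre_ple)
        with v(3) obtain z where z: "v \<preceq> z" "u \<preceq> z" by (rule pre_directed)
        have "v \<preceq> u" using block_least[OF _ u(1) z] v(2) by (simp add: U_def)
        then have "length v \<le> length (layers \<omega> n)" using ple_length[OF ple_trans[OF _ u(2)]] by blast
        also have "\<dots> \<le> n * CARD('a)" by (rule length_layers_le)
        finally show False using v(2) by (simp add: U_def)
      qed
      then show "\<omega> \<in> nohit \<beta>0 n" using v(1) by (simp add: nohit_def)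
    qed
  qed
  finally show ?thesis by (simp add: \<nu>.emeasure_eq_measure)
qed

text \<open>
The mean length is the sum of the tail probabilities, which decay geometrically.
\<close>
lemma integrable_block_length: "integrable (measure_pmf block_pmf) (\<lambda>v. real (length v))"
proof -
  obtain m q where m: "m > 0" "0 \<le> q" "q < 1" "\<And>\<alpha> k. measure (\<nu> \<alpha>) (nohit \<alpha> (Suc (k * m))) \<le> q ^ k"
    by (rule nohit_geometric) blast
  define c where "c = CARD('a)"
  have c0: "c > 0" by (simp add: c_def)
  define e where "e = (\<lambda>i. emeasure (measure_pmf block_pmf) {v. i < length v})"
  have e: "e (i + c) \<le> ennreal (q ^ (i div (m * c)))" for i
  proof -
    define k where "k = i div (m * c)"
    have "k * (m * c) \<le> i" unfolding k_def by (rule div_times_less_eq_dividend)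
    then have "Suc (k * m) * c \<le> i + c" by (simp add: algebra_simps)
    then have "e (i + c) \<le> emeasure (measure_pmf block_pmf) {v. Suc (k * m) * c < length v}"
      unfolding e_def by (intro emeasure_mono) auto
    also have "\<dots> \<le> ennreal (measure (\<nu> \<beta>0) (nohit \<beta>0 (Suc (k * m))))" unfolding c_def by (rule block_tail)
    also have "\<dots> \<le> ennreal (q ^ k)" by (intro ennreal_leI m(4))
    finally show ?thesis by (simp add: k_def)
  qed
  have "(\<integral>\<^sup>+v. ennreal (real (length v)) \<partial>measure_pmf block_pmf) = (\<Sum>i. e i)"
    unfolding e_def using nn_integral_nat_function[of length "measure_pmf block_pmf"] by (simp add: ennreal_of_nat_eq_real_of_nat)
  also have "\<dots> = (\<Sum>i. e (i + c)) + (\<Sum>i<c. e i)" by (rule suminf_offset) simp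
  also have "\<dots> < \<infinity>"
  proof -
    have "(\<Sum>i. e (i + c)) \<le> (\<Sum>i. ennreal (q ^ (i div (m * c))))" by (intro suminf_le e) auto
    also have "\<dots> = ennreal (\<Sum>i. q ^ (i div (m * c)))"
      using m c0 by (intro suminf_ennreal2 summable_power_div) auto
    also have "\<dots> < \<infinity>" by simp
    finally have "(\<Sum>i. e (i + c)) < \<infinity>" .
    moreover have "(\<Sum>i<c. e i) < \<infinity>" unfolding e_def by (simp add: measure_pmf.emeasure_eq_measure)
    ultimately show ?thesis by simp
  qed
  finally show ?thesis by (intro integrableI_bounded) auto
qed

end

section \<open>The subadditive ergodic theorem for i.i.d. sequences\<close>

lemma sum_lessThan_add: "(\<Sum>i<k + n. f i) = (\<Sum>i<k. f i) + (\<Sum>i<n. f (k + i))" for f :: "nat \<Rightarrow> real"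
  by (induction n) (simp_all add: ac_simps)

locale iid_stream =
  fixes p :: "'b::countable pmf"
begin

abbreviation SS :: "'b stream measure" where "SS \<equiv> stream_space (measure_pmf p)"

lemma sets_SS: "sets SS = sets (stream_space (count_space UNIV))"
  by (rule sets_stream_space_cong) simp

lemma space_SS [simp]: "space SS = UNIV"
  by (simp add: space_stream_space)

sublocale SS: prob_space SS
  by (rule prob_space.prob_space_stream_space[OF measure_pmf.prob_space_axioms])

lemma distr_stl: "distr SS SS stl = SS"
proof (rule measure_eqI)
  fix A assume "A \<in> sets (distr SS SS stl)"
  then have A: "A \<in> sets SS" by simp
  have "stl -` A \<in> sets SS" using measurable_sets[OF measurable_stl A] by simp
  then have "emeasure SS (stl -` A) = emeasure SS A"
    by (subst prob_space.emeasure_stream_space[OF measure_pmf.prob_space_axioms])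
      (simp_all add: measure_pmf.emeasure_space_1[simplified])
  then show "emeasure (distr SS SS stl) A = emeasure SS A"
    using A by (simp add: emeasure_distr)
qed simp

lemma distr_sdrop: "distr SS SS (sdrop n) = SS"
proof (induction n)
  case 0
  show ?case by (simp add: distr_id)
next
  case (Suc n)
  have "sdrop (Suc n) = sdrop n \<circ> (stl :: 'b stream \<Rightarrow> _)" by auto
  then have "distr SS SS (sdrop (Suc n)) = distr (distr SS SS stl) SS (sdrop n)"
    by (simp add: distr_distr)
  then show ?case by (simp only: Suc distr_stl)
qed

lemma integral_sdrop:
  fixes f :: "'b stream \<Rightarrow> real"
  assumes [measurable]: "f \<in> borel_measurable SS"
  shows "(\<integral>s. f (sdrop n s) \<partial>SS) = (\<integral>s. f s \<partial>SS)"
proof -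
  have "(\<integral>s. f s \<partial>SS) = (\<integral>s. f s \<partial>distr SS SS (sdrop n))" by (simp add: distr_sdrop)
  also have "\<dots> = (\<integral>s. f (sdrop n s) \<partial>SS)" by (rule integral_distr) auto
  finally show ?thesis by simp
qed

lemma integrable_sdrop:
  fixes f :: "'b stream \<Rightarrow> real"
  assumes "integrable SS f" shows "integrable SS (\<lambda>s. f (sdrop n s))"
  using integrable_distr_eq[OF measurable_sdrop borel_measurable_integrable[OF assms], of n] assms
  by (simp add: distr_sdrop)

text \<open>
The first element of the stream is independent of the rest.
\<close>
lemma emeasure_Cons:
  assumes "Y \<in> sets SS"
  shows "emeasure SS {s. shd s = a \<and> stl s \<in> Y} = ennreal (pmf p a) * emeasure SS Y"
proof -
  have [measurable]: "Measurable.pred SS (\<lambda>s. s \<in> Y)" using assms by simp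
  have "{s\<in>space SS. shd s = a \<and> stl s \<in> Y} \<in> sets SS" using assms by measurable
  then have m: "{s. shd s = a \<and> stl s \<in> Y} \<in> sets SS" by simp
  have "emeasure SS {s. shd s = a \<and> stl s \<in> Y} = (\<integral>\<^sup>+t. emeasure SS Y * indicator {a} t \<partial>p)"
    proof (subst prob_space.emeasure_stream_space[OF measure_pmf.prob_space_axioms m], rule nn_integral_cong)
    fix t show "emeasure SS {x \<in> space SS. t ## x \<in> {s. shd s = a \<and> stl s \<in> Y}} = emeasure SS Y * indicator {a} t"
      by (cases "t = a") auto
  qed
  also have "\<dots> = emeasure SS Y * ennreal (pmf p a)"
    by (subst nn_integral_cmult_indicator) (auto simp: emeasure_pmf_single)
  finally show ?thesis by (simp add: mult.commute)
qed

lemma sstart_Cons: "sstart UNIV (a # xs) = {s. shd s = a \<and> stl s \<in> sstart UNIV xs}"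
  by auto

lemma sets_sstart_SS: "sstart UNIV xs \<in> sets SS"
  by (simp add: sets_SS)

lemma emeasure_sstart: "emeasure SS (sstart UNIV xs) = ennreal (\<Prod>x\<leftarrow>xs. pmf p x)"
proof (induction xs)
  case Nil
  then show ?case using SS.emeasure_space_1 by simp
next
  case (Cons a xs)
  then show ?case
    by (simp add: sstart_Cons emeasure_Cons[OF sets_sstart_SS] ennreal_mult' del: in_sstart)
qed

text \<open>
A zero-one law for events \<open>E\<close> with \<open>stl -` E \<subseteq> E\<close>. By stationarity \<open>E\<close> and \<open>stl -` E\<close> have the same measure,
so they agree almost surely. Hence \<open>E\<close> is independent of every finite initial segment. If \<open>E\<close> has
positive measure, then the law of the stream conditioned on \<open>E\<close> assigns the same probabilities to initial
segments as the unconditioned law; so both laws agree, and \<open>E\<close> has measure 1.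
\<close>
lemma zero_one:
  assumes E: "E \<in> sets SS" and inv: "\<And>s. stl s \<in> E \<Longrightarrow> s \<in> E"
  shows "(AE s in SS. s \<in> E) \<or> (AE s in SS. s \<notin> E)"
proof (cases "emeasure SS E = 0")
  case True
  then have "AE s in SS. s \<notin> E" using E by (intro AE_not_in) auto
  then show ?thesis ..
next
  case False
  have Es: "stl -` E \<in> sets SS" using measurable_sets[OF measurable_stl E] by simp
  have "emeasure SS (stl -` E) = emeasure SS E"
    using emeasure_distr[of stl SS SS E] E distr_stl by simp
  then have eq: "AE s in SS. stl s \<in> E \<longleftrightarrow> s \<in> E"
  proof -
    assume 1: "emeasure SS (stl -` E) = emeasure SS E"
    have "emeasure SS (E - stl -` E) = emeasure SS E - emeasure SS (stl -` E)"
      using E Es inv by (intro emeasure_Diff) auto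
    then have "emeasure SS (E - stl -` E) = 0" using 1 by (simp add: ennreal_minus_eq_0)
    then have "AE s in SS. s \<notin> E - stl -` E" using E Es by (intro AE_not_in) auto
    then show ?thesis using inv by (auto elim!: eventually_mono)
  qed
  have ind: "emeasure SS (E \<inter> sstart UNIV xs) = emeasure SS E * emeasure SS (sstart UNIV xs)" for xs
  proof (induction xs)
    case Nil
    then show ?case using SS.emeasure_space_1 by simp
  next
    case (Cons a xs)
    have m: "E \<inter> sstart UNIV xs \<in> sets SS" using E sets_sstart_SS by auto
    have "{s. shd s = a} \<in> sets SS"
      using measurable_sets[OF measurable_shd, of "{a}" "measure_pmf p"] by (simp add: vimage_def)
    moreover have "stl -` (E \<inter> sstart UNIV xs) \<in> sets SS"
      using measurable_sets[OF measurable_stl m] by simp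
    ultimately have "{s. shd s = a} \<inter> stl -` (E \<inter> sstart UNIV xs) \<in> sets SS" by (rule sets.Int)
    then have m2: "{s. shd s = a \<and> stl s \<in> E \<inter> sstart UNIV xs} \<in> sets SS"
      by (simp add: Int_def vimage_def)
    have "emeasure SS (E \<inter> sstart UNIV (a # xs)) = emeasure SS {s. shd s = a \<and> stl s \<in> E \<inter> sstart UNIV xs}"
      by (rule emeasure_eq_AE) (use eq E m2 sets_sstart_SS in auto)
    also have "\<dots> = ennreal (pmf p a) * (emeasure SS E * emeasure SS (sstart UNIV xs))"
      by (simp only: emeasure_Cons[OF m] Cons.IH)
    also have "\<dots> = emeasure SS E * emeasure SS (sstart UNIV (a # xs))"
      by (simp add: sstart_Cons emeasure_Cons[OF sets_sstart_SS] ac_simps)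
    finally show ?case .
  qed
  have fin: "emeasure SS E \<noteq> \<infinity>" by (simp add: SS.emeasure_eq_measure)
  interpret U: prob_space "uniform_measure SS E"
    by (rule prob_space_uniform_measure) (use False fin in auto)
  have "SS = uniform_measure SS E"
  proof (rule stream_space_eq_sstart[of UNIV])
    fix xs :: "'b list"
    show "emeasure SS (sstart UNIV xs) = emeasure (uniform_measure SS E) (sstart UNIV xs)"
      using E False fin
      by (subst emeasure_uniform_measure)
        (auto simp: sets_sstart_SS ind mult_divide_eq_ennreal mult.commute[of "emeasure SS E"])
  qed (auto simp: sets_SS SS.prob_space_axioms U.prob_space_axioms)
  moreover have "AE s in uniform_measure SS E. s \<in> E"
    by (rule AE_uniform_measureI) (use E in auto)
  ultimately have "AE s in SS. s \<in> E" by metis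
  then show ?thesis ..
qed

lemma integrable_subadditive:
  fixes F :: "nat \<Rightarrow> 'b stream \<Rightarrow> real"
  assumes [measurable]: "\<And>n. F n \<in> borel_measurable SS"
    and nonneg: "\<And>n s. 0 \<le> F n s"
    and sub: "\<And>m n s. F (m + n) s \<le> F m s + F n (sdrop m s)"
    and int1: "integrable SS (F 1)" and n: "n \<ge> 1"
  shows "integrable SS (F n)"
  using n
proof (induction n rule: nat_induct_at_least)
  case base
  show ?case by (rule int1)
next
  case (Suc n)
  have "integrable SS (\<lambda>s. F n s + F 1 (sdrop n s))"
    using Suc integrable_sdrop[OF int1] by auto
  then show ?case
    by (rule Bochner_Integration.integrable_bound) (use sub[of n 1] nonneg in \<open>auto simp: abs_of_nonneg\<close>)
qed

text \<open>
The lower bound, by a covering argument. Suppose that \<open>F n < c * n\<close> with a small margin happens for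
infinitely many \<open>n\<close> with positive probability, hence almost surely by the zero-one law. Then from almost
every position \<open>i\<close> of the stream there is a \<open>k\<close> with \<open>F k < c * k\<close> for the stream dropped by \<open>i\<close>, and \<open>k\<close>
can be bounded by a fixed \<open>m\<close> except for a set of small probability. Covering \<open>{..<n}\<close> greedily by such
intervals and by single exceptional positions, subadditivity bounds the mean of \<open>F n\<close> by \<open>c * n\<close> plus a
small multiple of \<open>n\<close>, below the lower bound \<open>\<gamma> * n\<close>.
\<close>
lemma subadditive_liminf:
  fixes F :: "nat \<Rightarrow> 'b stream \<Rightarrow> real"
  assumes meas [measurable]: "\<And>n. F n \<in> borel_measurable SS"
    and nonneg: "\<And>n s. 0 \<le> F n s"
    and sub: "\<And>m n s. F (m + n) s \<le> F m s + F n (sdrop m s)"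
    and int1: "integrable SS (F 1)"
    and \<gamma>: "\<And>n. n \<ge> 1 \<Longrightarrow> \<gamma> * real n \<le> (\<integral>s. F n s \<partial>SS)"
    and c: "c < \<gamma>"
  shows "AE s in SS. eventually (\<lambda>n. c * real n \<le> F n s) sequentially"
proof -
  \<comment> \<open>The margin \<open>1 / Suc i\<close> absorbs the effect of dropping the first element of the stream; this makes
    the zero-one law applicable to \<open>E c\<close>.\<close>
  define E where "E = (\<lambda>c. {s. \<exists>i::nat. frequently (\<lambda>n. F n s < (c - 1 / real (Suc i)) * real n) sequentially})"
  have Em: "E c \<in> sets SS" for c
  proof -
    have "{s \<in> space SS. \<exists>i::nat. \<forall>N::nat. \<exists>n\<ge>N. F n s < (c - 1 / real (Suc i)) * real n} \<in> sets SS"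
      by measurable
    then show ?thesis by (simp add: E_def frequently_sequentially)
  qed
  have Einv: "s \<in> E c" if s: "stl s \<in> E c" for s c
  proof -
    obtain i where i: "frequently (\<lambda>n. F n (stl s) < (c - 1 / real (Suc i)) * real n) sequentially"
      using s by (auto simp: E_def)
    define \<delta> where "\<delta> = 1 / real (Suc i) - 1 / real (Suc (Suc i))"
    have \<delta>: "\<delta> > 0" unfolding \<delta>_def by (simp add: frac_less2)
    have "frequently (\<lambda>n. F (Suc n) s < (c - 1 / real (Suc (Suc i))) * real (Suc n)) sequentially"
    proof -
      have "eventually (\<lambda>n. real n > (F 1 s + \<bar>c - 1 / real (Suc (Suc i))\<bar>) / \<delta>) sequentially"
        by (rule filterlim_at_top_dense[THEN iffD1, rule_format, OF filterlim_real_sequentially])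
      then have "eventually (\<lambda>n. F n (stl s) < (c - 1 / real (Suc i)) * real n \<longrightarrow>
           F (Suc n) s < (c - 1 / real (Suc (Suc i))) * real (Suc n)) sequentially"
      proof eventually_elim
        case (elim n)
        have "F 1 s + \<bar>c - 1 / real (Suc (Suc i))\<bar> < \<delta> * real n"
          using elim \<delta> by (simp add: pos_divide_less_eq mult.commute)
        moreover have "F (Suc n) s \<le> F 1 s + F n (stl s)" using sub[of 1 n s] by simp
        moreover have "\<delta> * real n = (c - 1 / real (Suc (Suc i))) * real n - (c - 1 / real (Suc i)) * real n"
          by (simp add: \<delta>_def algebra_simps)
        moreover have "(c - 1 / real (Suc (Suc i))) * real (Suc n)
            = (c - 1 / real (Suc (Suc i))) * real n + (c - 1 / real (Suc (Suc i)))"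
          by (simp only: of_nat_Suc distrib_left mult_1_right)
        ultimately show ?case by linarith
      qed
      with i show ?thesis by (rule frequently_rev_mp)
    qed
    then have "frequently (\<lambda>n. F n s < (c - 1 / real (Suc (Suc i))) * real n) sequentially"
      unfolding frequently_sequentially by (meson le_SucI)
    then show ?thesis unfolding E_def by blast
  qed
  have int: "integrable SS (F n)" if "n \<ge> 1" for n
    by (rule integrable_subadditive[OF meas nonneg sub int1 that])
  have Fsum: "F n s \<le> (\<Sum>i<n. F 1 (sdrop i s))" if "n \<ge> 1" for n s
    using that
  proof (induction n rule: nat_induct_at_least)
    case (Suc n)
    then show ?case using sub[of n 1 s] by simp
  qed simp
  have main: "AE s in SS. s \<notin> E c" if c: "c < \<gamma>" for c
  proof (rule ccontr)
    assume "\<not> (AE s in SS. s \<notin> E c)"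
    with zero_one[OF Em Einv] have AE: "AE s in SS. s \<in> E c" by blast
    have ex: "AE s in SS. \<exists>n\<ge>1. F n s < c * real n"
      using AE
    proof eventually_elim
      case (elim s)
      then obtain i where i: "frequently (\<lambda>n. F n s < (c - 1 / real (Suc i)) * real n) sequentially"
        by (auto simp: E_def)
      then obtain n where n: "n \<ge> 1" "F n s < (c - 1 / real (Suc i)) * real n"
        by (auto simp: frequently_sequentially)
      have "(c - 1 / real (Suc i)) * real n \<le> c * real n" by (intro mult_right_mono) auto
      with n show ?case by (intro exI[of _ n]) (auto intro: less_le_trans)
    qed
    have c0: "c > 0"
    proof -
      have "AE s in SS. 0 < c"
        using ex
      proof eventually_elim
        case (elim s)
        then obtain n where n: "n \<ge> 1" "F n s < c * real n" by blast
        then have "0 < c * real n" using nonneg[of n s] by linarith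
        then show ?case using n(1) by (simp add: zero_less_mult_iff)
      qed
      then show ?thesis by simp
    qed
    \<comment> \<open>The exceptional positions: no interval of length at most \<open>m\<close> can be chosen.\<close>
    define Bad where "Bad = (\<lambda>m. {s. \<forall>n\<in>{1..m}. c * real n \<le> F n s})"
    have Badm [measurable]: "Bad m \<in> sets SS" for m
    proof -
      have "{s\<in>space SS. \<forall>n\<in>{1..m}. c * real n \<le> F n s} \<in> sets SS" by measurable
      then show ?thesis by (simp add: Bad_def)
    qed
    define G where "G = (\<lambda>m s. F 1 s * indicator (Bad m) s)"
    have Gm [measurable]: "G m \<in> borel_measurable SS" for m unfolding G_def by measurable
    have Gint: "integrable SS (G m)" for m
      unfolding G_def using int1 by (intro integrable_real_mult_indicator) auto
    have "(\<lambda>m. \<integral>s. G m s \<partial>SS) \<longlonglongrightarrow> (\<integral>s. 0 \<partial>SS)"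
    proof (rule integral_dominated_convergence[where w = "F 1"])
      show "AE s in SS. (\<lambda>m. G m s) \<longlonglongrightarrow> 0"
        using ex
      proof eventually_elim
        case (elim s)
        then obtain n where n: "n \<ge> 1" "F n s < c * real n" by blast
        have "eventually (\<lambda>m. G m s = 0) sequentially"
          using eventually_ge_at_top[of n]
        proof eventually_elim
          case (elim m)
          then have "s \<notin> Bad m" using n by (auto simp: Bad_def not_le intro!: bexI[of _ n])
          then show ?case by (simp add: G_def)
        qed
        then show ?case by (rule tendsto_eventually)
      qed
    qed (use int1 nonneg in \<open>auto simp: G_def split: split_indicator\<close>)
    then have "(\<lambda>m. \<integral>s. G m s \<partial>SS) \<longlonglongrightarrow> 0" by simp
    then have "eventually (\<lambda>m. (\<integral>s. G m s \<partial>SS) < (\<gamma> - c) / 2) sequentially"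
      by (rule order_tendstoD) (use c in simp)
    then obtain m where m: "(\<integral>s. G m s \<partial>SS) < (\<gamma> - c) / 2"
      unfolding eventually_sequentially by blast
    \<comment> \<open>Greedy covering: from a position that is not exceptional advance by some \<open>k \<le> m\<close> with
      \<open>F k < c * k\<close>, from an exceptional one by a single step at the cost \<open>G m\<close>. The last sum
      accounts for the at most \<open>m\<close> positions at the end where the interval may not fit.\<close>
    have cover: "F n s \<le> c * real n + (\<Sum>i<n. G m (sdrop i s)) + (\<Sum>i\<in>{n-m..<n}. F 1 (sdrop i s))"
      if "n \<ge> 1" for n s
      using that
    proof (induction n arbitrary: s rule: less_induct)
      case (less n)
      have G0: "0 \<le> G m s" for s by (auto simp: G_def nonneg split: split_indicator)
      have shift: "F k s + F (n - k) (sdrop k s) \<le> c * real n + (\<Sum>i<n. G m (sdrop i s)) + (\<Sum>i\<in>{n-m..<n}. F 1 (sdrop i s))"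
        if k: "1 \<le> k" "k < n" and Fk: "F k s \<le> c * real k + (\<Sum>i<k. G m (sdrop i s))" for k
      proof -
        have "F (n - k) (sdrop k s) \<le> c * real (n - k) + (\<Sum>i<n-k. G m (sdrop i (sdrop k s)))
            + (\<Sum>i\<in>{n-k-m..<n-k}. F 1 (sdrop i (sdrop k s)))"
          by (rule less.IH) (use k in auto)
        moreover have "(\<Sum>i<k. G m (sdrop i s)) + (\<Sum>i<n-k. G m (sdrop i (sdrop k s))) = (\<Sum>i<n. G m (sdrop i s))"
        proof -
          have "(\<Sum>i<n. G m (sdrop i s)) = (\<Sum>i<k + (n-k). G m (sdrop i s))" using k by simp
          also have "\<dots> = (\<Sum>i<k. G m (sdrop i s)) + (\<Sum>i<n-k. G m (sdrop (k + i) s))"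
            by (rule sum_lessThan_add)
          finally show ?thesis by (simp add: sdrop_add add.commute)
        qed
        moreover have "(\<Sum>i\<in>{n-k-m..<n-k}. F 1 (sdrop i (sdrop k s))) \<le> (\<Sum>i\<in>{n-m..<n}. F 1 (sdrop i s))"
        proof -
          have "(\<Sum>i\<in>{n-k-m..<n-k}. F 1 (sdrop i (sdrop k s))) = (\<Sum>i\<in>{n-k-m+k..<n-k+k}. F 1 (sdrop i s))"
            unfolding sum.shift_bounds_nat_ivl by (simp add: sdrop_add add.commute)
          also have "\<dots> \<le> (\<Sum>i\<in>{n-m..<n}. F 1 (sdrop i s))"
            using k by (intro sum_mono2) (auto simp: nonneg)
          finally show ?thesis .
        qed
        moreover have "c * real k + c * real (n - k) = c * real n" using k by (simp add: of_nat_diff algebra_simps)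
        ultimately show ?thesis using Fk by linarith
      qed
      show ?case
      proof (cases "n \<le> m")
        case True
        have "F n s \<le> (\<Sum>i<n. F 1 (sdrop i s))" by (rule Fsum[OF less.prems])
        moreover have "{n - m..<n} = {..<n}" using True by auto
        moreover have "0 \<le> c * real n" "0 \<le> (\<Sum>i<n. G m (sdrop i s))" using c0 G0 by (auto intro: sum_nonneg)
        ultimately show ?thesis by simp
      next
        case nm: False
        show ?thesis
        proof (cases "s \<in> Bad m")
          case True
          have "F 1 s \<le> c * real 1 + (\<Sum>i<1. G m (sdrop i s))" using True c0 by (simp add: G_def)
          moreover have "F n s \<le> F 1 s + F (n - 1) (sdrop 1 s)"
            using sub[of 1 "n - 1" s] less.prems by simp
          ultimately show ?thesis
          proof (cases "n = 1")
            case True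
            have "F 1 s \<le> (\<Sum>i<n. G m (sdrop i s))" using \<open>s \<in> Bad m\<close> True by (simp add: G_def)
            moreover have "0 \<le> (\<Sum>i\<in>{n-m..<n}. F 1 (sdrop i s))" by (intro sum_nonneg nonneg)
            ultimately show ?thesis using c0 True by simp
          next
            case False
            then have "1 < n" using less.prems by simp
            from order_trans[OF \<open>F n s \<le> F 1 s + F (n - 1) (sdrop 1 s)\<close>
                shift[OF order_refl this \<open>F 1 s \<le> c * real 1 + (\<Sum>i<1. G m (sdrop i s))\<close>]]
            show ?thesis .
          qed
        next
          case False
          then obtain k where k: "1 \<le> k" "k \<le> m" "F k s < c * real k" by (auto simp: Bad_def not_le)
          have "0 \<le> (\<Sum>i<k. G m (sdrop i s))" using G0 by (auto intro: sum_nonneg)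
          then have "F k s \<le> c * real k + (\<Sum>i<k. G m (sdrop i s))" using k by linarith
          then have "F k s + F (n - k) (sdrop k s) \<le> c * real n + (\<Sum>i<n. G m (sdrop i s)) + (\<Sum>i\<in>{n-m..<n}. F 1 (sdrop i s))"
            using shift[of k] k nm by simp
          moreover have "F n s \<le> F k s + F (n - k) (sdrop k s)" using sub[of k "n - k" s] k nm by simp
          ultimately show ?thesis by linarith
        qed
      qed
    qed
    have "real n * ((\<gamma> - c) / 2) \<le> real m * (\<integral>s. F 1 s \<partial>SS)" if n: "n \<ge> 1" for n
    proof -
      have "\<gamma> * real n \<le> (\<integral>s. F n s \<partial>SS)" by (rule \<gamma>[OF n])
      also have "\<dots> \<le> (\<integral>s. c * real n + (\<Sum>i<n. G m (sdrop i s)) + (\<Sum>i\<in>{n-m..<n}. F 1 (sdrop i s)) \<partial>SS)"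
        using cover[OF n] int[OF n] integrable_sdrop[OF int1] integrable_sdrop[OF Gint]
        by (intro integral_mono) auto
      also have "\<dots> = c * real n + real n * (\<integral>s. G m s \<partial>SS) + real (n - (n - m)) * (\<integral>s. F 1 s \<partial>SS)"
        using int1 Gint integrable_sdrop[OF int1] integrable_sdrop[OF Gint[of m]]
        by (simp add: integral_sdrop SS.prob_space[simplified])
      also have "\<dots> \<le> c * real n + real n * ((\<gamma> - c) / 2) + real m * (\<integral>s. F 1 s \<partial>SS)"
      proof -
        have "0 \<le> (\<integral>s. F 1 s \<partial>SS)" by (intro integral_nonneg_AE AE_I2 nonneg)
        then have "real (n - (n - m)) * (\<integral>s. F 1 s \<partial>SS) \<le> real m * (\<integral>s. F 1 s \<partial>SS)"
          by (intro mult_right_mono) auto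
        moreover have "real n * (\<integral>s. G m s \<partial>SS) \<le> real n * ((\<gamma> - c) / 2)"
          using m by (intro mult_left_mono) auto
        ultimately show ?thesis by linarith
      qed
      finally show ?thesis by (simp add: field_simps)
    qed
    moreover have "eventually (\<lambda>n. real n > real m * (\<integral>s. F 1 s \<partial>SS) / ((\<gamma> - c) / 2)) sequentially"
      by (rule filterlim_at_top_dense[THEN iffD1, rule_format, OF filterlim_real_sequentially])
    then obtain N where "\<And>n. n \<ge> N \<Longrightarrow> real n > real m * (\<integral>s. F 1 s \<partial>SS) / ((\<gamma> - c) / 2)"
      by (auto simp: eventually_sequentially)
    then have "real (Suc N) > real m * (\<integral>s. F 1 s \<partial>SS) / ((\<gamma> - c) / 2)" by (meson le_Suc_eq le_refl)
    then have "real (Suc N) * ((\<gamma> - c) / 2) > real m * (\<integral>s. F 1 s \<partial>SS)"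
      using c by (subst (asm) pos_divide_less_eq) auto
    ultimately show False using leD[of "real (Suc N) * ((\<gamma> - c) / 2)"] by fastforce
  qed
  \<comment> \<open>The event \<open>E c'\<close> with \<open>c < c' < \<gamma>\<close> leaves room for the margin.\<close>
  define c' where "c' = (c + \<gamma>) / 2"
  obtain i where i: "1 / real (Suc i) < c' - c"
    using reals_Archimedean[of "c' - c"] c by (auto simp: c'_def inverse_eq_divide)
  have "c' < \<gamma>" using c by (simp add: c'_def)
  from main[OF this] show ?thesis
  proof eventually_elim
    case (elim s)
    then have "\<not> frequently (\<lambda>n. F n s < (c' - 1 / real (Suc i)) * real n) sequentially"
      unfolding E_def by blast
    then have "eventually (\<lambda>n. (c' - 1 / real (Suc i)) * real n \<le> F n s) sequentially"
      by (simp only: not_frequently not_less)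
    then show ?case
    proof eventually_elim
      case (elim n)
      have "c * real n \<le> (c' - 1 / real (Suc i)) * real n" using i by (intro mult_right_mono) auto
      then show ?case using elim by simp
    qed
  qed
qed

text \<open>
The upper half of the strong law for Birkhoff averages, by the same covering argument with the
inequalities reversed.
\<close>
lemma average_limsup:
  fixes g :: "'b stream \<Rightarrow> real"
  assumes nonneg: "\<And>s. 0 \<le> g s" and int: "integrable SS g"
    and c: "(\<integral>s. g s \<partial>SS) < c"
  shows "AE s in SS. eventually (\<lambda>n. (\<Sum>i<n. g (sdrop i s)) \<le> c * real n) sequentially"
proof -
  define A where "A = (\<lambda>n s. \<Sum>i<n. g (sdrop i s))"
  have gm [measurable]: "g \<in> borel_measurable SS" using int by auto
  have Am [measurable]: "A n \<in> borel_measurable SS" for n unfolding A_def by measurable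
  have A_add: "A (k + n) s = A k s + A n (sdrop k s)" for k n s
    unfolding A_def sum_lessThan_add by (simp add: sdrop_add add.commute)
  have A_nonneg: "0 \<le> A n s" for n s unfolding A_def by (intro sum_nonneg nonneg)
  define E where "E = (\<lambda>c. {s. \<exists>i::nat. frequently (\<lambda>n. (c + 1 / real (Suc i)) * real n < A n s) sequentially})"
  have Em: "E c \<in> sets SS" for c
  proof -
    have "{s \<in> space SS. \<exists>i::nat. \<forall>N::nat. \<exists>n\<ge>N. (c + 1 / real (Suc i)) * real n < A n s} \<in> sets SS"
      by measurable
    then show ?thesis by (simp add: E_def frequently_sequentially)
  qed
  have Einv: "s \<in> E c" if s: "stl s \<in> E c" for s c
  proof -
    obtain i where i: "frequently (\<lambda>n. (c + 1 / real (Suc i)) * real n < A n (stl s)) sequentially"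
      using s unfolding E_def by blast
    define \<delta> where "\<delta> = 1 / real (Suc i) - 1 / real (Suc (Suc i))"
    have \<delta>: "\<delta> > 0" unfolding \<delta>_def by (simp add: frac_less2)
    have "frequently (\<lambda>n. (c + 1 / real (Suc (Suc i))) * real (Suc n) < A (Suc n) s) sequentially"
    proof -
      have "eventually (\<lambda>n. real n > \<bar>c + 1 / real (Suc (Suc i))\<bar> / \<delta>) sequentially"
        by (rule filterlim_at_top_dense[THEN iffD1, rule_format, OF filterlim_real_sequentially])
      then have "eventually (\<lambda>n. (c + 1 / real (Suc i)) * real n < A n (stl s) \<longrightarrow>
           (c + 1 / real (Suc (Suc i))) * real (Suc n) < A (Suc n) s) sequentially"
      proof eventually_elim
        case (elim n)
        have "\<bar>c + 1 / real (Suc (Suc i))\<bar> < \<delta> * real n"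
          using elim \<delta> by (simp add: pos_divide_less_eq mult.commute)
        moreover have "A n (stl s) \<le> A (Suc n) s" using A_add[of 1 n s] A_nonneg[of 1 s] by simp
        moreover have "\<delta> * real n = (c + 1 / real (Suc i)) * real n - (c + 1 / real (Suc (Suc i))) * real n"
          by (simp add: \<delta>_def algebra_simps)
        moreover have "(c + 1 / real (Suc (Suc i))) * real (Suc n)
            = (c + 1 / real (Suc (Suc i))) + (c + 1 / real (Suc (Suc i))) * real n"
          by (simp only: of_nat_Suc distrib_left mult_1_right)
        ultimately show ?case by linarith
      qed
      with i show ?thesis by (rule frequently_rev_mp)
    qed
    then have "frequently (\<lambda>n. (c + 1 / real (Suc (Suc i))) * real n < A n s) sequentially"
      unfolding frequently_sequentially by (meson le_SucI)
    then show ?thesis unfolding E_def by blast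
  qed
  have main: "AE s in SS. s \<notin> E c" if c: "(\<integral>s. g s \<partial>SS) < c" for c
  proof (rule ccontr)
    assume "\<not> (AE s in SS. s \<notin> E c)"
    with zero_one[OF Em Einv] have AE: "AE s in SS. s \<in> E c" by blast
    have "0 \<le> (\<integral>s. g s \<partial>SS)" by (intro integral_nonneg_AE AE_I2 nonneg)
    then have c0: "c > 0" using c by linarith
    have ex: "AE s in SS. \<exists>n\<ge>1. c * real n < A n s"
      using AE
    proof eventually_elim
      case (elim s)
      then obtain i where i: "frequently (\<lambda>n. (c + 1 / real (Suc i)) * real n < A n s) sequentially"
        unfolding E_def by blast
      then obtain n where n: "n \<ge> 1" "(c + 1 / real (Suc i)) * real n < A n s"
        by (auto simp: frequently_sequentially)
      have "c * real n \<le> (c + 1 / real (Suc i)) * real n" by (intro mult_right_mono) auto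
      with n show ?case by (intro exI[of _ n] conjI) linarith+
    qed
    \<comment> \<open>The exceptional positions: no interval of length at most \<open>m\<close> has an average above \<open>c\<close>.\<close>
    define Bad where "Bad = (\<lambda>m. {s. \<forall>n\<in>{1..m}. A n s \<le> c * real n})"
    have Badm [measurable]: "Bad m \<in> sets SS" for m
    proof -
      have "{s\<in>space SS. \<forall>n\<in>{1..m}. A n s \<le> c * real n} \<in> sets SS" by measurable
      then show ?thesis by (simp add: Bad_def)
    qed
    define G where "G = (\<lambda>m s. indicator (Bad m) s :: real)"
    have Gm [measurable]: "G m \<in> borel_measurable SS" for m unfolding G_def by measurable
    have G01: "0 \<le> G m s" "G m s \<le> 1" for m s by (auto simp: G_def split: split_indicator)
    have Gint: "integrable SS (G m)" for m
      by (rule SS.integrable_const_bound[of _ 1]) (use G01 in auto)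
    have "(\<lambda>m. \<integral>s. G m s \<partial>SS) \<longlonglongrightarrow> (\<integral>s. 0 \<partial>SS)"
    proof (rule integral_dominated_convergence[where w = "\<lambda>_. 1"])
      show "AE s in SS. (\<lambda>m. G m s) \<longlonglongrightarrow> 0"
        using ex
      proof eventually_elim
        case (elim s)
        then obtain n where n: "n \<ge> 1" "c * real n < A n s" by blast
        have "eventually (\<lambda>m. G m s = 0) sequentially"
          using eventually_ge_at_top[of n]
        proof eventually_elim
          case (elim m)
          then have "s \<notin> Bad m" using n by (auto simp: Bad_def not_le intro!: bexI[of _ n])
          then show ?case by (simp add: G_def)
        qed
        then show ?case by (rule tendsto_eventually)
      qed
    qed (use G01 in auto)
    then have "(\<lambda>m. \<integral>s. G m s \<partial>SS) \<longlonglongrightarrow> 0" by simp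
    moreover define \<epsilon> where "\<epsilon> = (c - (\<integral>s. g s \<partial>SS)) / (2 * c)"
    have \<epsilon>: "\<epsilon> > 0" using c c0 by (simp add: \<epsilon>_def)
    ultimately have "eventually (\<lambda>m. (\<integral>s. G m s \<partial>SS) < \<epsilon>) sequentially"
      by (intro order_tendstoD)
    then obtain m where m: "(\<integral>s. G m s \<partial>SS) < \<epsilon>"
      unfolding eventually_sequentially by blast
    have cover: "c * (real n - real m - (\<Sum>i<n. G m (sdrop i s))) \<le> A n s" for n s
    proof (induction n arbitrary: s rule: less_induct)
      case (less n)
      have shift: "c * (real n - real m - (\<Sum>i<n. G m (sdrop i s))) \<le> A n s"
        if k: "1 \<le> k" "k \<le> n" and Ak: "c * (real k - (\<Sum>i<k. G m (sdrop i s))) \<le> A k s" for k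
      proof -
        have "c * (real (n - k) - real m - (\<Sum>i<n-k. G m (sdrop i (sdrop k s)))) \<le> A (n - k) (sdrop k s)"
          by (rule less.IH) (use k in auto)
        moreover have "(\<Sum>i<n. G m (sdrop i s)) = (\<Sum>i<k. G m (sdrop i s)) + (\<Sum>i<n-k. G m (sdrop i (sdrop k s)))"
          using k sum_lessThan_add[of "\<lambda>i. G m (sdrop i s)" k "n - k"] by (simp add: sdrop_add add.commute)
        moreover have "A n s = A k s + A (n - k) (sdrop k s)" using A_add[of k "n - k" s] k by simp
        moreover have "real (n - k) = real n - real k" using k by simp
        ultimately show ?thesis using Ak by (simp add: algebra_simps)
      qed
      show ?case
      proof (cases "n \<le> m")
        case True
        have "0 \<le> (\<Sum>i<n. G m (sdrop i s))" by (intro sum_nonneg G01)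
        then have "c * (real n - real m - (\<Sum>i<n. G m (sdrop i s))) \<le> 0"
          using True c0 by (intro mult_nonneg_nonpos) auto
        then show ?thesis using A_nonneg[of n s] by linarith
      next
        case nm: False
        show ?thesis
        proof (cases "s \<in> Bad m")
          case True
          then have "c * (real 1 - (\<Sum>i<1. G m (sdrop i s))) \<le> A 1 s" using A_nonneg[of 1 s] by (simp add: G_def)
          then show ?thesis using shift[of 1] nm by simp
        next
          case False
          then obtain k where k: "1 \<le> k" "k \<le> m" "c * real k < A k s" by (auto simp: Bad_def not_le)
          have "0 \<le> (\<Sum>i<k. G m (sdrop i s))" by (intro sum_nonneg G01)
          then have "c * (real k - (\<Sum>i<k. G m (sdrop i s))) \<le> c * real k" using c0 by (intro mult_left_mono) auto
          then show ?thesis using shift[of k] k nm by simp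
        qed
      qed
    qed
    have EA: "(\<integral>s. A n s \<partial>SS) = real n * (\<integral>s. g s \<partial>SS)" for n
      unfolding A_def using integrable_sdrop[OF int] by (simp add: integral_sdrop)
    have intA: "integrable SS (A n)" for n
      unfolding A_def using integrable_sdrop[OF int] by auto
    have "real n * (c - (\<integral>s. g s \<partial>SS)) / 2 \<le> c * real m" for n
    proof -
      have "c * (real n - real m - real n * (\<integral>s. G m s \<partial>SS)) =
          (\<integral>s. c * (real n - real m - (\<Sum>i<n. G m (sdrop i s))) \<partial>SS)"
        using integrable_sdrop[OF Gint[of m]] by (simp add: integral_sdrop SS.prob_space[simplified])
      also have "\<dots> \<le> (\<integral>s. A n s \<partial>SS)"
        using cover[of n] integrable_sdrop[OF Gint[of m]] intA by (intro integral_mono) auto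
      also have "\<dots> = real n * (\<integral>s. g s \<partial>SS)" by (rule EA)
      finally have 1: "c * (real n - real m - real n * (\<integral>s. G m s \<partial>SS)) \<le> real n * (\<integral>s. g s \<partial>SS)" .
      have "c * (real n * (\<integral>s. G m s \<partial>SS)) \<le> c * (real n * \<epsilon>)"
        using m c0 by (intro mult_left_mono) auto
      also have "\<dots> = real n * (c - (\<integral>s. g s \<partial>SS)) / 2" using c0 by (simp add: \<epsilon>_def field_simps)
      finally show ?thesis using 1 by (simp add: algebra_simps)
    qed
    moreover have "eventually (\<lambda>n. real n > c * real m / ((c - (\<integral>s. g s \<partial>SS)) / 2)) sequentially"
      by (rule filterlim_at_top_dense[THEN iffD1, rule_format, OF filterlim_real_sequentially])
    then obtain N where N: "real N > c * real m / ((c - (\<integral>s. g s \<partial>SS)) / 2)"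
      unfolding eventually_sequentially by blast
    then have "real N * (c - (\<integral>s. g s \<partial>SS)) / 2 > c * real m"
      using c by (subst (asm) pos_divide_less_eq) auto
    ultimately show False using not_less by blast
  qed
  define c' where "c' = (c + (\<integral>s. g s \<partial>SS)) / 2"
  obtain i where i: "1 / real (Suc i) < c - c'"
    using reals_Archimedean[of "c - c'"] c by (auto simp: c'_def inverse_eq_divide)
  have "(\<integral>s. g s \<partial>SS) < c'" using c by (simp add: c'_def)
  from main[OF this] show ?thesis
  proof eventually_elim
    case (elim s)
    then have "\<not> frequently (\<lambda>n. (c' + 1 / real (Suc i)) * real n < A n s) sequentially"
      unfolding E_def by blast
    then have "eventually (\<lambda>n. A n s \<le> (c' + 1 / real (Suc i)) * real n) sequentially"
      by (simp only: not_frequently not_less)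
    then show ?case
    proof eventually_elim
      case (elim n)
      have "(c' + 1 / real (Suc i)) * real n \<le> c * real n" using i by (intro mult_right_mono) auto
      then show ?case using elim by (simp add: A_def)
    qed
  qed
qed

text \<open>
The limit \<open>\<gamma>\<close> is the infimum of the normalised means. For the upper bound choose \<open>m\<close> with mean of \<open>F m\<close>
close to \<open>\<gamma> * m\<close> and cut \<open>{..<n}\<close> into intervals of length \<open>m\<close>. Averaging over the \<open>m\<close> possible offsets
turns the sum over these intervals into a full Birkhoff sum of \<open>F m\<close>, to which \<open>average_limsup\<close> applies,
so that ergodicity of the shift by \<open>m\<close> is not an issue. Monotonicity serves to round \<open>n\<close> up to a
multiple of \<open>m\<close>.
\<close>
theorem subadditive_ergodic:
  fixes F :: "nat \<Rightarrow> 'b stream \<Rightarrow> real"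
  assumes meas [measurable]: "\<And>n. F n \<in> borel_measurable SS"
    and nonneg: "\<And>n s. 0 \<le> F n s"
    and mono: "\<And>m n s. F m s \<le> F (m + n) s"
    and sub: "\<And>m n s. F (m + n) s \<le> F m s + F n (sdrop m s)"
    and int1: "integrable SS (F 1)"
  obtains \<gamma> where "AE s in SS. (\<lambda>n. F n s / real n) \<longlonglongrightarrow> \<gamma>"
    and "\<And>n. n \<ge> 1 \<Longrightarrow> \<gamma> * real n \<le> (\<integral>s. F n s \<partial>SS)"
proof -
  define \<gamma> where "\<gamma> = (INF n\<in>{1..}. (\<integral>s. F n s \<partial>SS) / real n)"
  have int: "integrable SS (F n)" if "n \<ge> 1" for n
    by (rule integrable_subadditive[OF meas nonneg sub int1 that])
  have E0: "0 \<le> (\<integral>s. F n s \<partial>SS)" for n using nonneg by (intro integral_nonneg_AE) auto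
  have bdd: "bdd_below ((\<lambda>n. (\<integral>s. F n s \<partial>SS) / real n) ` {1..})"
    by (rule bdd_belowI[of _ 0]) (auto simp: E0)
  have \<gamma>: "\<gamma> * real n \<le> (\<integral>s. F n s \<partial>SS)" if "n \<ge> 1" for n
  proof -
    have "\<gamma> \<le> (\<integral>s. F n s \<partial>SS) / real n"
      unfolding \<gamma>_def using that by (intro cINF_lower[OF bdd]) auto
    then show ?thesis using that by (simp add: pos_le_divide_eq)
  qed
  have lower: "AE s in SS. eventually (\<lambda>n. c * real n \<le> F n s) sequentially" if "c < \<gamma>" for c
    by (rule subadditive_liminf[where \<gamma> = \<gamma>]) (rule meas nonneg sub int1 \<gamma> that | assumption)+
  have upper: "AE s in SS. eventually (\<lambda>n. F n s < c * real n) sequentially" if c: "\<gamma> < c" for c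
  proof -
    define c' where "c' = (\<gamma> + c) / 2"
    have c': "\<gamma> < c'" "c' < c" using c by (auto simp: c'_def)
    have "\<exists>n\<in>{1..}. (\<integral>s. F n s \<partial>SS) / real n < c'"
      using c' cINF_less_iff[OF _ bdd] by (auto simp: \<gamma>_def)
    then obtain m where m: "m \<ge> 1" "(\<integral>s. F m s \<partial>SS) < c' * real m"
      by (auto simp: pos_divide_less_eq)
    have "AE s in SS. eventually (\<lambda>n. (\<Sum>i<n. F m (sdrop i s)) \<le> (c' * real m) * real n) sequentially"
      by (rule average_limsup) (use nonneg int[OF m(1)] m(2) in auto)
    then show ?thesis
    proof eventually_elim
      case (elim s)
      then obtain N where N: "\<And>n. n \<ge> N \<Longrightarrow> (\<Sum>i<n. F m (sdrop i s)) \<le> (c' * real m) * real n"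
        by (auto simp: eventually_sequentially)
      define C where "C = (\<Sum>r<m. F r s)"
      have blocks: "F (r + k * m) s \<le> F r s + (\<Sum>j<k. F m (sdrop (j * m + r) s))" for r k
      proof (induction k)
        case (Suc k)
        have "F (r + Suc k * m) s = F ((r + k * m) + m) s" by (simp add: ac_simps)
        also have "\<dots> \<le> F (r + k * m) s + F m (sdrop (r + k * m) s)" by (rule sub)
        finally show ?case using Suc by (simp add: ac_simps)
      qed simp
      \<comment> \<open>For each offset \<open>r < m\<close>, \<open>F (k * m)\<close> is at most \<open>F (r + k * m)\<close>, which splits into \<open>F r\<close> and \<open>k\<close>
        intervals of length \<open>m\<close>. Summing over \<open>r\<close> reaches every starting position exactly once.\<close>
      have km: "real m * F (k * m) s \<le> C + (\<Sum>i<k * m. F m (sdrop i s))" for k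
      proof -
        have "real m * F (k * m) s = (\<Sum>r<m. F (k * m) s)" by simp
        also have "\<dots> \<le> (\<Sum>r<m. F r s + (\<Sum>j<k. F m (sdrop (j * m + r) s)))"
          by (intro sum_mono order_trans[OF _ blocks]) (use mono[of "k * m"] in \<open>simp add: add.commute\<close>)
        also have "\<dots> = C + (\<Sum>j<k. \<Sum>r<m. F m (sdrop (j * m + r) s))"
        proof -
          have "(\<Sum>r<m. \<Sum>j<k. F m (sdrop (j * m + r) s)) = (\<Sum>j<k. \<Sum>r<m. F m (sdrop (j * m + r) s))"
            by (rule sum.swap)
          then show ?thesis by (simp add: sum.distrib C_def)
        qed
        also have "(\<Sum>j<k. \<Sum>r<m. F m (sdrop (j * m + r) s)) = (\<Sum>i<k * m. F m (sdrop i s))"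
        proof (induction k)
          case (Suc k)
          then show ?case
            using sum_lessThan_add[of "\<lambda>i. F m (sdrop i s)" "k * m" m] by (simp add: add.commute[of m])
        qed simp
        finally show ?thesis .
      qed
      have c'0: "0 \<le> c'" by (rule ccontr) (use E0[of m] m mult_neg_pos[of c' "real m"] in auto)
      have "eventually (\<lambda>n. real n > (C / real m + c' * real m) / (c - c')) sequentially"
        by (rule filterlim_at_top_dense[THEN iffD1, rule_format, OF filterlim_real_sequentially])
      then show ?case using eventually_ge_at_top[of N]
      proof eventually_elim
        case (elim n)
        \<comment> \<open>Round up: \<open>k * m\<close> is the least multiple of \<open>m\<close> above \<open>n\<close>.\<close>
        define k where "k = n div m + 1"
        have kn: "n \<le> k * m" "k * m \<le> n + m"
        proof -
          have "n = n div m * m + n mod m" "n mod m < m" using m(1) by (simp_all add: mod_less_divisor)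
          moreover have "k * m = n div m * m + m" unfolding k_def by (simp add: distrib_right)
          ultimately show "n \<le> k * m" "k * m \<le> n + m" by linarith+
        qed
        have "n + (k * m - n) = k * m" using kn(1) by (rule le_add_diff_inverse)
        with mono[of n s "k * m - n"] have "F n s \<le> F (k * m) s" by (simp only:)
        then have 1: "real m * F n s \<le> real m * F (k * m) s" by (rule mult_left_mono) (rule of_nat_0_le_iff)
        have "k * m \<ge> N" using kn(1) elim(2) by linarith
        then have 2: "(\<Sum>i<k * m. F m (sdrop i s)) \<le> (c' * real m) * real (k * m)" by (rule N)
        have 3: "(c' * real m) * real (k * m) \<le> (c' * real m) * real (n + m)"
          using kn(2) c'0 by (intro mult_left_mono) (simp_all only: of_nat_le_iff mult_nonneg_nonneg of_nat_0_le_iff)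
        have 4: "C + (c' * real m) * real (n + m) = real m * (C / real m + c' * (real n + real m))"
          using m(1) by (simp add: field_simps)
        have "real m * F n s \<le> real m * (C / real m + c' * (real n + real m))"
          using 1 2 3 4 km[of k] by linarith
        then have "F n s \<le> C / real m + c' * (real n + real m)" using m(1) by simp
        moreover have "C / real m + c' * real m < (c - c') * real n"
          using elim(1) c'(2) by (simp add: pos_divide_less_eq mult.commute)
        ultimately show ?case by (simp add: algebra_simps)
      qed
    qed
  qed
  have "AE s in SS. \<forall>i::nat. eventually (\<lambda>n. (\<gamma> - 1 / real (Suc i)) * real n \<le> F n s) sequentially \<and>
      eventually (\<lambda>n. F n s < (\<gamma> + 1 / real (Suc i)) * real n) sequentially"
    unfolding AE_all_countable by (intro allI AE_conjI lower upper) auto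
  then have "AE s in SS. (\<lambda>n. F n s / real n) \<longlonglongrightarrow> \<gamma>"
  proof eventually_elim
    case (elim s)
    show ?case
    proof (rule tendstoI)
      fix e :: real assume "e > 0"
      then obtain i where i: "1 / real (Suc i) < e"
        using reals_Archimedean[of e] by (auto simp: inverse_eq_divide)
      show "eventually (\<lambda>n. dist (F n s / real n) \<gamma> < e) sequentially"
        using elim[rule_format, of i, THEN conjunct1] elim[rule_format, of i, THEN conjunct2] eventually_gt_at_top[of 0]
      proof eventually_elim
        case (elim n)
        then have "\<gamma> - 1 / real (Suc i) \<le> F n s / real n" "F n s / real n < \<gamma> + 1 / real (Suc i)"
          by (simp_all add: pos_le_divide_eq pos_divide_less_eq)
        then show ?case using i unfolding dist_real_def by linarith
      qed
    qed
  qed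
  from that[OF this \<gamma>] show ?thesis .
qed

end

section \<open>Decomposition of infinite traces into i.i.d. blocks\<close>

context regeneration begin

sublocale blocks: iid_stream block_pmf .

definition run :: "'a list \<Rightarrow> (nat \<Rightarrow> 'a set) \<Rightarrow> 'a list stream \<Rightarrow> bool" where
  "run u \<omega> s \<longleftrightarrow> (\<forall>n. s !! n \<in> block \<beta>0) \<and> (\<forall>n. pre (u @ concat (stake n s)) \<omega>)"

lemma state_blocks: "state \<alpha> u = Some \<beta>0 \<Longrightarrow> set xs \<subseteq> block \<beta>0 \<Longrightarrow> state \<alpha> (u @ concat xs) = Some \<beta>0"
proof (induction xs arbitrary: u)
  case (Cons x xs)
  have "state \<alpha> (u @ x) = Some \<beta>0" using state_append_Some[OF Cons.prems(1), of x] block_state[of x \<beta>0] Cons.prems(2) by simp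
  from Cons.IH[OF this] show ?case using Cons.prems(2) by simp
qed simp

lemma f_blocks:
  "state \<alpha> u = Some \<beta>0 \<Longrightarrow> set xs \<subseteq> block \<beta>0 \<Longrightarrow> f \<alpha> (u @ concat xs) = f \<alpha> u * (\<Prod>x\<leftarrow>xs. pmf block_pmf x)"
proof (induction xs arbitrary: u)
  case (Cons x xs)
  have "state \<alpha> (u @ x) = Some \<beta>0" using state_append_Some[OF Cons.prems(1), of x] block_state[of x \<beta>0] Cons.prems(2) by simp
  from Cons.IH[OF this] show ?case using Cons.prems(2) f_append[OF Cons.prems(1), of x] by (simp add: pmf_block_pmf)
qed simp

text \<open>
The block that follows is unique at each step, because blocks are incompatible.
\<close>
lemma run_stake:
  assumes r: "run u \<omega> s"
  shows "set xs \<subseteq> block \<beta>0 \<Longrightarrow> pre (u @ concat xs) \<omega> \<Longrightarrow> stake (length xs) s = xs"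
proof (induction xs rule: rev_induct)
  case (snoc x xs)
  have "pre (u @ concat xs) \<omega>" using snoc.prems(2) pre_appendD[of "u @ concat xs" x \<omega>] by simp
  then have IH: "stake (length xs) s = xs" using snoc by simp
  have "pre (u @ concat (stake (Suc (length xs)) s)) \<omega>" using r unfolding run_def by blast
  then have 1: "pre ((u @ concat xs) @ s !! length xs) \<omega>" unfolding stake_Suc by (simp add: IH)
  have 2: "pre ((u @ concat xs) @ x) \<omega>" using snoc.prems(2) by simp
  have "s !! length xs = x"
    by (rule pre_append_incompatible[OF block_incompatible _ _ 1 2]) (use r snoc.prems(1) in \<open>auto simp: run_def\<close>)
  then have "stake (Suc (length xs)) s = xs @ [x]" unfolding stake_Suc by (simp add: IH)
  then show ?case by simp
qed simp

lemma run_set_stake: "run u \<omega> s \<Longrightarrow> set (stake n s) \<subseteq> block \<beta>0"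
  unfolding run_def by (induction n) (auto simp: stake_Suc simp del: stake.simps(2))

lemma run_unique: assumes "run u \<omega> s" "run u \<omega> s'" shows "s = s'"
proof -
  have "stake n s = stake n s'" for n
    using run_stake[OF assms(2) run_set_stake[OF assms(1)], of n] assms(1)
    unfolding run_def by simp
  then have "s !! n = s' !! n" for n using stake_Suc[of n s] stake_Suc[of n s']
    by (metis append1_eq_conv)
  then have "snth s = snth s'" by (rule ext)
  then show ?thesis using stream_smap_nats[of s] stream_smap_nats[of s'] by simp
qed

text \<open>
The infinite traces above \<open>u\<close> in which every finite sequence of blocks can be continued by a further block.
Quantifying over all finite sequences makes the set visibly measurable.
\<close>
definition good :: "'a list \<Rightarrow> (nat \<Rightarrow> 'a set) set" where
  "good u = {\<omega>\<in>boundary I. pre u \<omega> \<and> (\<forall>xs\<in>lists (block \<beta>0). pre (u @ concat xs) \<omega> \<longrightarrow> (\<exists>v\<in>block \<beta>0. pre (u @ concat xs @ v) \<omega>))}"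

lemma sets_good: "good u \<in> sets (\<nu> \<alpha>)"
proof -
  have "good u = {\<omega>\<in>boundary I. pre u \<omega>} \<inter>
    (\<Inter>xs\<in>lists (block \<beta>0) \<union> {[]}. (boundary I - {\<omega>\<in>boundary I. pre (u @ concat xs) \<omega>}) \<union> (\<Union>v\<in>block \<beta>0. {\<omega>\<in>boundary I. pre (u @ concat xs @ v) \<omega>}))"
    unfolding good_def by blast
  also have "\<dots> \<in> sets (\<nu> \<alpha>)"
  proof (rule sets.Int[OF sets_pre], rule sets.countable_INT')
    have "(boundary I - {\<omega>\<in>boundary I. pre v \<omega>}) \<in> sets (\<nu> \<alpha>)" for v
      using sets.compl_sets[OF sets_pre[of v \<alpha>]] by (simp add: space_\<nu>)
    moreover have "(\<Union>v\<in>block \<beta>0. {\<omega>\<in>boundary I. pre (u @ concat xs @ v) \<omega>}) \<in> sets (\<nu> \<alpha>)" for xs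
      by (rule sets.countable_UN'') (use sets_pre in auto)
    ultimately show "(\<lambda>xs. (boundary I - {\<omega>\<in>boundary I. pre (u @ concat xs) \<omega>}) \<union> (\<Union>v\<in>block \<beta>0. {\<omega>\<in>boundary I. pre (u @ concat xs @ v) \<omega>})) ` (lists (block \<beta>0) \<union> {[]}) \<subseteq> sets (\<nu> \<alpha>)"
      by blast
  qed auto
  finally show ?thesis .
qed

text \<open>
By the chain rule and \<open>block_sum\<close>, the cylinders of \<open>u @ v\<close> for the blocks \<open>v\<close> exhaust the cylinder of \<open>u\<close>.
\<close>
lemma AE_next_block:
  assumes "state \<alpha> u = Some \<beta>0"
  shows "AE \<omega> in \<nu> \<alpha>. pre u \<omega> \<longrightarrow> (\<exists>v\<in>block \<beta>0. pre (u @ v) \<omega>)"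
proof -
  let ?A = "{\<omega>\<in>boundary I. pre u \<omega>}" and ?B = "{\<omega>\<in>boundary I. \<exists>v\<in>block \<beta>0. pre (u @ v) \<omega>}"
  have B: "?B \<in> sets (\<nu> \<alpha>)"
  proof -
    have "?B = (\<Union>v\<in>block \<beta>0. {\<omega>\<in>boundary I. pre (u @ v) \<omega>})" by auto
    also have "\<dots> \<in> sets (\<nu> \<alpha>)" by (rule sets.countable_UN'') (use sets_pre in auto)
    finally show ?thesis .
  qed
  have "emeasure (\<nu> \<alpha>) ?B = (\<integral>\<^sup>+v. ennreal (f \<alpha> u) * ennreal (f \<beta>0 v) \<partial>count_space (block \<beta>0))"
    unfolding emeasure_ex_pre_append[OF block_incompatible] f_append[OF assms]
    by (simp add: ennreal_mult' f_nonneg)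
  also have "\<dots> = ennreal (f \<alpha> u)" by (simp add: nn_integral_cmult block_sum)
  finally have eq: "emeasure (\<nu> \<alpha>) ?B = emeasure (\<nu> \<alpha>) ?A" by (simp add: emeasure_pre)
  have "?B \<subseteq> ?A" using pre_appendD by blast
  then have "emeasure (\<nu> \<alpha>) (?A - ?B) = emeasure (\<nu> \<alpha>) ?A - emeasure (\<nu> \<alpha>) ?B"
    by (intro emeasure_Diff B sets_pre) simp
  then have "emeasure (\<nu> \<alpha>) (?A - ?B) = 0" using eq by (simp add: ennreal_minus_eq_0)
  then have "AE \<omega> in \<nu> \<alpha>. \<omega> \<notin> ?A - ?B" by (intro AE_not_in) (use B sets_pre in \<open>auto simp: null_sets_def\<close>)
  with AE_boundary show ?thesis by eventually_elim blast
qed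

lemma AE_good: assumes "state \<alpha> u = Some \<beta>0" shows "AE \<omega> in \<nu> \<alpha>. pre u \<omega> \<longrightarrow> \<omega> \<in> good u"
proof -
  have "AE \<omega> in \<nu> \<alpha>. \<forall>xs. xs \<in> lists (block \<beta>0) \<longrightarrow> pre (u @ concat xs) \<omega> \<longrightarrow> (\<exists>v\<in>block \<beta>0. pre ((u @ concat xs) @ v) \<omega>)"
    unfolding AE_all_countable
  proof
    fix xs
    show "AE \<omega> in \<nu> \<alpha>. xs \<in> lists (block \<beta>0) \<longrightarrow> pre (u @ concat xs) \<omega> \<longrightarrow> (\<exists>v\<in>block \<beta>0. pre ((u @ concat xs) @ v) \<omega>)"
    proof (cases "xs \<in> lists (block \<beta>0)")
      case True
      then have "state \<alpha> (u @ concat xs) = Some \<beta>0" using state_blocks[OF assms, of xs] by (simp add: in_lists_conv_set subset_iff)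
      from AE_next_block[OF this] show ?thesis by eventually_elim simp
    qed simp
  qed
  with AE_boundary show ?thesis by eventually_elim (simp add: good_def)
qed

lemma good_run: assumes "\<omega> \<in> good u" shows "\<exists>s. run u \<omega> s"
proof -
  have nx: "\<exists>v\<in>block \<beta>0. pre (u @ concat xs @ v) \<omega>" if "xs \<in> lists (block \<beta>0)" "pre (u @ concat xs) \<omega>" for xs
    using assms that unfolding good_def by blast
  define g where "g = (\<lambda>xs. SOME v. v \<in> block \<beta>0 \<and> pre (u @ concat xs @ v) \<omega>)"
  have g: "g xs \<in> block \<beta>0" "pre (u @ concat xs @ g xs) \<omega>" if "xs \<in> lists (block \<beta>0)" "pre (u @ concat xs) \<omega>" for xs
    using someI_ex[of "\<lambda>v. v \<in> block \<beta>0 \<and> pre (u @ concat xs @ v) \<omega>"] nx[OF that] unfolding g_def by blast+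
  \<comment> \<open>The blocks found so far; \<open>g\<close> chooses the next one.\<close>
  define X where "X = rec_nat [] (\<lambda>_ xs. xs @ [g xs])"
  have X: "X 0 = []" "\<And>n. X (Suc n) = X n @ [g (X n)]" by (simp_all add: X_def)
  define s where "s = to_stream (\<lambda>n. g (X n))"
  have sn: "s !! n = g (X n)" for n by (simp add: s_def to_stream_def)
  have sX: "stake n s = X n" for n by (induction n) (simp_all add: X stake_Suc sn del: stake.simps(2))
  have XX: "X n \<in> lists (block \<beta>0) \<and> pre (u @ concat (X n)) \<omega>" for n
  proof (induction n)
    case 0
    then show ?case using assms by (simp add: X good_def)
  next
    case (Suc n)
    then show ?case using g[of "X n"] by (simp add: X(2))
  qed
  have "run u \<omega> s" unfolding run_def sX sn using g XX by blast
  then show ?thesis ..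
qed

text \<open>
Outside \<open>good u\<close> a constant value is chosen to make the function measurable.
\<close>
definition the_run :: "'a list \<Rightarrow> (nat \<Rightarrow> 'a set) \<Rightarrow> 'a list stream" where
  "the_run u \<omega> = (if \<omega> \<in> good u then (THE s. run u \<omega> s) else sconst [])"

lemma the_run: "\<omega> \<in> good u \<Longrightarrow> run u \<omega> (the_run u \<omega>)"
  unfolding the_run_def using good_run run_unique by (simp, metis theI)

lemma measurable_the_run: "the_run u \<in> measurable (\<nu> \<alpha>) blocks.SS"
proof (rule measurable_stream_space2)
  fix n
  have "(\<lambda>\<omega>. the_run u \<omega> !! n) \<in> measurable (\<nu> \<alpha>) (count_space UNIV)"
  proof (subst measurable_count_space_eq_countable, simp, intro conjI ballI)
    fix a :: "'a list"
    let ?J = "{xs. length xs = n \<and> set (xs @ [a]) \<subseteq> block \<beta>0}"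
    have eq: "the_run u \<omega> !! n = a \<longleftrightarrow> (\<exists>xs\<in>?J. pre (u @ concat (xs @ [a])) \<omega>)" if g: "\<omega> \<in> good u" for \<omega>
    proof
      assume a: "the_run u \<omega> !! n = a"
      have "stake (Suc n) (the_run u \<omega>) = stake n (the_run u \<omega>) @ [a]" using stake_Suc a by metis
      then show "\<exists>xs\<in>?J. pre (u @ concat (xs @ [a])) \<omega>"
        using the_run[OF g] run_set_stake[OF the_run[OF g], of "Suc n"]
        by (intro bexI[of _ "stake n (the_run u \<omega>)"]) (metis run_def, simp)
    next
      assume "\<exists>xs\<in>?J. pre (u @ concat (xs @ [a])) \<omega>"
      then obtain xs where xs: "length xs = n" "set (xs @ [a]) \<subseteq> block \<beta>0" "pre (u @ concat (xs @ [a])) \<omega>" by blast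
      from run_stake[OF the_run[OF g] xs(2,3)] have "stake (Suc n) (the_run u \<omega>) = xs @ [a]" using xs(1) by simp
      then show "the_run u \<omega> !! n = a" unfolding stake_Suc by simp
    qed
    have "(\<lambda>\<omega>. the_run u \<omega> !! n) -` {a} \<inter> space (\<nu> \<alpha>) =
      (good u \<inter> (\<Union>xs\<in>?J. {\<omega>\<in>boundary I. pre (u @ concat (xs @ [a])) \<omega>})) \<union> (if a = [] then boundary I - good u else {})"
    proof (rule Set.set_eqI)
      fix \<omega>
      show "\<omega> \<in> (\<lambda>\<omega>. the_run u \<omega> !! n) -` {a} \<inter> space (\<nu> \<alpha>) \<longleftrightarrow>
       \<omega> \<in> (good u \<inter> (\<Union>xs\<in>?J. {\<omega>\<in>boundary I. pre (u @ concat (xs @ [a])) \<omega>})) \<union> (if a = [] then boundary I - good u else {})"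
      proof (cases "\<omega> \<in> good u")
        case True
        then have "\<omega> \<in> boundary I" by (simp add: good_def)
        then show ?thesis using eq[OF True] True by (simp add: space_\<nu>)
      next
        case False
        then show ?thesis by (auto simp: the_run_def space_\<nu>)
      qed
    qed
    also have "\<dots> \<in> sets (\<nu> \<alpha>)"
    proof (intro sets.Un sets.Int sets_good)
      show "(\<Union>xs\<in>?J. {\<omega>\<in>boundary I. pre (u @ concat (xs @ [a])) \<omega>}) \<in> sets (\<nu> \<alpha>)"
        by (rule sets.countable_UN'') (use sets_pre in auto)
      show "(if a = [] then boundary I - good u else {}) \<in> sets (\<nu> \<alpha>)"
        using sets.compl_sets[OF sets_good[of u \<alpha>]] by (simp add: space_\<nu>)
    qed
    finally show "(\<lambda>\<omega>. the_run u \<omega> !! n) -` {a} \<inter> space (\<nu> \<alpha>) \<in> sets (\<nu> \<alpha>)" .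
  qed simp
  then show "(\<lambda>\<omega>. the_run u \<omega> !! n) \<in> measurable (\<nu> \<alpha>) (measure_pmf block_pmf)" by simp
qed

text \<open>
Given that \<open>u\<close> is below \<open>\<omega>\<close>, the blocks after \<open>u\<close> are i.i.d.: the probability that they start with \<open>xs\<close>
is \<open>f \<alpha> (u @ concat xs) / f \<alpha> u\<close>, and by the chain rule this is the product of the block probabilities.
\<close>
lemma distr_the_run:
  assumes state: "state \<alpha> u = Some \<beta>0"
  shows "distr (uniform_measure (\<nu> \<alpha>) {\<omega>\<in>boundary I. pre u \<omega>}) blocks.SS (the_run u) = blocks.SS"
proof -
  let ?A = "{\<omega>\<in>boundary I. pre u \<omega>}"
  let ?N = "uniform_measure (\<nu> \<alpha>) ?A"
  have f0: "f \<alpha> u > 0" using state by (simp add: f_pos_iff)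
  have A: "emeasure (\<nu> \<alpha>) ?A = ennreal (f \<alpha> u)" by (rule emeasure_pre)
  interpret N: prob_space ?N
    by (rule prob_space_uniform_measure) (use f0 in \<open>simp_all add: A\<close>)
  have mN: "the_run u \<in> measurable ?N blocks.SS"
    using measurable_the_run[of u \<alpha>] by (simp cong: measurable_cong_sets)
  interpret DD: prob_space "distr ?N blocks.SS (the_run u)" by (rule N.prob_space_distr[OF mN])
  show ?thesis
  proof (rule stream_space_eq_sstart[of UNIV])
    fix xs :: "'a list list"
    have vN: "the_run u -` sstart UNIV xs \<inter> space (\<nu> \<alpha>) \<in> sets (\<nu> \<alpha>)"
      by (rule measurable_sets[OF measurable_the_run blocks.sets_sstart_SS])
    have "emeasure (distr ?N blocks.SS (the_run u)) (sstart UNIV xs) = emeasure ?N (the_run u -` sstart UNIV xs \<inter> space ?N)"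
      by (rule emeasure_distr[OF mN blocks.sets_sstart_SS])
    also have "\<dots> = emeasure (\<nu> \<alpha>) (?A \<inter> (the_run u -` sstart UNIV xs \<inter> space (\<nu> \<alpha>))) / emeasure (\<nu> \<alpha>) ?A"
      using vN by (subst emeasure_uniform_measure) (simp_all add: sets_pre)
    also have "emeasure (\<nu> \<alpha>) (?A \<inter> (the_run u -` sstart UNIV xs \<inter> space (\<nu> \<alpha>)))
      = ennreal (f \<alpha> u * (\<Prod>x\<leftarrow>xs. pmf block_pmf x))"
    proof (cases "set xs \<subseteq> block \<beta>0")
      case True
      have "emeasure (\<nu> \<alpha>) (?A \<inter> (the_run u -` sstart UNIV xs \<inter> space (\<nu> \<alpha>))) = emeasure (\<nu> \<alpha>) {\<omega>\<in>boundary I. pre (u @ concat xs) \<omega>}"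
      proof (rule emeasure_eq_AE)
        show "AE \<omega> in \<nu> \<alpha>. \<omega> \<in> ?A \<inter> (the_run u -` sstart UNIV xs \<inter> space (\<nu> \<alpha>)) \<longleftrightarrow> \<omega> \<in> {\<omega>\<in>boundary I. pre (u @ concat xs) \<omega>}"
          using AE_good[OF state] AE_boundary
        proof eventually_elim
          case (elim \<omega>)
          have "the_run u \<omega> \<in> sstart UNIV xs \<longleftrightarrow> pre (u @ concat xs) \<omega>" if "pre u \<omega>"
          proof -
            have r: "run u \<omega> (the_run u \<omega>)" using the_run elim that by blast
            have "the_run u \<omega> \<in> sstart UNIV xs \<longleftrightarrow> stake (length xs) (the_run u \<omega>) = xs"
              by (simp add: sstart_eq list_eq_iff_nth_eq)
            also have "\<dots> \<longleftrightarrow> pre (u @ concat xs) \<omega>"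
              using run_stake[OF r True] r unfolding run_def by metis
            finally show ?thesis .
          qed
          then show ?case using elim pre_appendD by (auto simp: space_\<nu>)
        qed
      qed (use vN sets_pre in auto)
      then show ?thesis by (simp add: emeasure_pre f_blocks[OF state True])
    next
      case False
      then obtain x where x: "x \<in> set xs" "x \<notin> block \<beta>0" by blast
      then have "0 \<in> set (map (pmf block_pmf) xs)" by (auto simp: pmf_block_pmf intro!: image_eqI[of _ _ x])
      then have "(\<Prod>x\<leftarrow>xs. pmf block_pmf x) = 0" by (rule prod_list_zero_iff[THEN iffD2])
      moreover have "emeasure (\<nu> \<alpha>) (?A \<inter> (the_run u -` sstart UNIV xs \<inter> space (\<nu> \<alpha>))) = emeasure (\<nu> \<alpha>) {}"
      proof (rule emeasure_eq_AE)
        show "AE \<omega> in \<nu> \<alpha>. \<omega> \<in> ?A \<inter> (the_run u -` sstart UNIV xs \<inter> space (\<nu> \<alpha>)) \<longleftrightarrow> \<omega> \<in> {}"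
          using AE_good[OF state]
        proof eventually_elim
          case (elim \<omega>)
          have "the_run u \<omega> \<notin> sstart UNIV xs" if "pre u \<omega>"
          proof
            assume "the_run u \<omega> \<in> sstart UNIV xs"
            then have "stake (length xs) (the_run u \<omega>) = xs" by (simp add: sstart_eq list_eq_iff_nth_eq)
            moreover have "run u \<omega> (the_run u \<omega>)" using the_run elim that by blast
            ultimately show False using run_set_stake[of u \<omega> "the_run u \<omega>" "length xs"] False by simp
          qed
          then show ?case by auto
        qed
      qed (use vN sets_pre in auto)
      ultimately show ?thesis by simp
    qed
    also have "ennreal (f \<alpha> u * (\<Prod>x\<leftarrow>xs. pmf block_pmf x)) / emeasure (\<nu> \<alpha>) ?A = emeasure blocks.SS (sstart UNIV xs)"
      unfolding A blocks.emeasure_sstart using f0 by (subst divide_ennreal) (auto intro!: prod_list_nonneg mult_nonneg_nonneg)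
    finally show "emeasure (distr ?N blocks.SS (the_run u)) (sstart UNIV xs) = emeasure blocks.SS (sstart UNIV xs)" .
  qed (simp_all add: DD.prob_space_axioms blocks.SS.prob_space_axioms blocks.sets_SS)
qed

text \<open>
Almost sure properties of i.i.d. streams of blocks hold for the block decomposition of infinite traces,
and \<open>AE_run_converse\<close> transports properties back.
\<close>
lemma AE_run:
  assumes state: "state \<alpha> u = Some \<beta>0" and P: "AE s in blocks.SS. P s"
  shows "AE \<omega> in \<nu> \<alpha>. pre u \<omega> \<longrightarrow> (\<exists>s. run u \<omega> s \<and> P s)"
proof -
  let ?A = "{\<omega>\<in>boundary I. pre u \<omega>}"
  let ?N = "uniform_measure (\<nu> \<alpha>) ?A"
  have f0: "f \<alpha> u > 0" using state by (simp add: f_pos_iff)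
  have mN: "the_run u \<in> measurable ?N blocks.SS"
    using measurable_the_run[of u \<alpha>] by (simp cong: measurable_cong_sets)
  have "AE s in distr ?N blocks.SS (the_run u). P s" unfolding distr_the_run[OF state] by (rule P)
  then have "AE \<omega> in ?N. P (the_run u \<omega>)" by (rule AE_distrD[OF mN])
  then have "AE \<omega> in \<nu> \<alpha>. \<omega> \<in> ?A \<longrightarrow> P (the_run u \<omega>)"
    by (subst (asm) AE_uniform_measure) (use f0 in \<open>simp_all add: emeasure_pre\<close>)
  with AE_good[OF state] AE_boundary show ?thesis
    by eventually_elim (use the_run in blast)
qed

lemma AE_run_converse:
  assumes state: "state \<alpha> u = Some \<beta>0" and Q: "{s. Q s} \<in> sets blocks.SS"
    and AE: "AE \<omega> in \<nu> \<alpha>. pre u \<omega> \<longrightarrow> (\<forall>s. run u \<omega> s \<longrightarrow> Q s)"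
  shows "AE s in blocks.SS. Q s"
proof -
  let ?A = "{\<omega>\<in>boundary I. pre u \<omega>}"
  let ?N = "uniform_measure (\<nu> \<alpha>) ?A"
  have f0: "f \<alpha> u > 0" using state by (simp add: f_pos_iff)
  have mN: "the_run u \<in> measurable ?N blocks.SS"
    using measurable_the_run[of u \<alpha>] by (simp cong: measurable_cong_sets)
  have "AE \<omega> in \<nu> \<alpha>. \<omega> \<in> ?A \<longrightarrow> Q (the_run u \<omega>)"
    using AE AE_good[OF state] by eventually_elim (use the_run in blast)
  then have "AE \<omega> in ?N. Q (the_run u \<omega>)"
    by (subst AE_uniform_measure) (use f0 in \<open>simp_all add: emeasure_pre\<close>)
  then have "AE s in distr ?N blocks.SS (the_run u). Q s"
    by (subst AE_distr_iff[OF mN]) (use Q in simp_all)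
  then show ?thesis unfolding distr_the_run[OF state] .
qed

end

section \<open>Convergence of the ergodic means\<close>

context trace_alphabet begin

text \<open>
Convergence of the ergodic means to \<open>k\<close> at a single infinite trace, stated for words.
\<close>
definition ergodic_at :: "('s \<Rightarrow> 'a trace \<Rightarrow> real) \<Rightarrow> real \<Rightarrow> 's \<Rightarrow> (nat \<Rightarrow> 'a set) \<Rightarrow> bool" where
  "ergodic_at \<phi> k \<alpha> \<omega> \<longleftrightarrow> (\<forall>\<epsilon>>0. \<exists>x. pre x \<omega> \<and>
     (\<forall>y. x \<preceq> y \<longrightarrow> pre y \<omega> \<longrightarrow> y \<noteq> [] \<longrightarrow> \<bar>\<phi> \<alpha> (trace_of I y) / real (length y) - k\<bar> < \<epsilon>))"

end

lemma tendsto_div_n: "(\<lambda>n. (c :: real) / real n) \<longlonglongrightarrow> 0" by real_asymp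

lemma ratio_cancel: "n \<noteq> 0 \<Longrightarrow> m \<noteq> 0 \<Longrightarrow> x / n * (n / m) / (y / m) = x / y" for x y n m :: real
  by simp

lemma ratio_cancel2: "y \<noteq> 0 \<Longrightarrow> x / y * (y / n) = x / n" for x y n :: real
  by simp

lemma LIMSEQ_iff_inverse_Suc:
  fixes X :: "nat \<Rightarrow> real"
  shows "X \<longlonglongrightarrow> L \<longleftrightarrow> (\<forall>i::nat. \<exists>N. \<forall>n\<ge>N. \<bar>X n - L\<bar> < 1 / real (Suc i))"
proof
  assume "X \<longlonglongrightarrow> L"
  then show "\<forall>i::nat. \<exists>N. \<forall>n\<ge>N. \<bar>X n - L\<bar> < 1 / real (Suc i)"
    unfolding LIMSEQ_iff real_norm_def by (intro allI) (drule spec, erule mp, simp)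
next
  assume A: "\<forall>i::nat. \<exists>N. \<forall>n\<ge>N. \<bar>X n - L\<bar> < 1 / real (Suc i)"
  show "X \<longlonglongrightarrow> L"
    unfolding LIMSEQ_iff real_norm_def
  proof (intro allI impI)
    fix r :: real assume "0 < r"
    then obtain i where i: "1 / real (Suc i) < r" using reals_Archimedean[of r] by (auto simp: inverse_eq_divide)
    from A obtain N where "\<forall>n\<ge>N. \<bar>X n - L\<bar> < 1 / real (Suc i)" by blast
    then show "\<exists>N. \<forall>n\<ge>N. \<bar>X n - L\<bar> < r" using i by (intro exI[of _ N]) (auto intro: less_trans)
  qed
qed

context markov_system begin

lemma msub_nonneg: "monotone_subadditive_fun I act \<phi> \<Longrightarrow> state \<alpha> u \<noteq> None \<Longrightarrow> 0 \<le> \<phi> \<alpha> (trace_of I u)"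
  unfolding monotone_subadditive_fun_def using traces_from_iff by blast

lemma msub_step:
  assumes "monotone_subadditive_fun I act \<phi>" "state \<alpha> u = Some \<beta>" "state \<beta> v \<noteq> None"
  shows "\<phi> \<alpha> (trace_of I u) \<le> \<phi> \<alpha> (trace_of I (u @ v))"
    and "\<phi> \<alpha> (trace_of I (u @ v)) \<le> \<phi> \<alpha> (trace_of I u) + \<phi> \<beta> (trace_of I v)"
proof -
  have "trace_of I u \<in> traces_from I act \<alpha>" "trace_of I v \<in> traces_from I act (next_state act \<alpha> (trace_of I u))"
    using assms(2,3) next_state_eq[OF assms(2)] by (simp_all add: traces_from_iff)
  then have "\<phi> \<alpha> (trace_of I u) \<le> \<phi> \<alpha> (trace_of I u \<cdot>\<^bsub>I\<^esub> trace_of I v) \<and>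
    \<phi> \<alpha> (trace_of I u \<cdot>\<^bsub>I\<^esub> trace_of I v) \<le> \<phi> \<alpha> (trace_of I u) + \<phi> (next_state act \<alpha> (trace_of I u)) (trace_of I v)"
    using assms(1) unfolding monotone_subadditive_fun_def by blast
  then show "\<phi> \<alpha> (trace_of I u) \<le> \<phi> \<alpha> (trace_of I (u @ v))"
    and "\<phi> \<alpha> (trace_of I (u @ v)) \<le> \<phi> \<alpha> (trace_of I u) + \<phi> \<beta> (trace_of I v)"
    using next_state_eq[OF assms(2)] by simp_all
qed

lemma msub_mono:
  assumes "monotone_subadditive_fun I act \<phi>" "u \<preceq> v" "state \<alpha> v \<noteq> None"
  shows "\<phi> \<alpha> (trace_of I u) \<le> \<phi> \<alpha> (trace_of I v)"
proof -
  obtain z where z: "u @ z \<simeq> v" using assms(2) by (rule pleE)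
  then have "state \<alpha> (u @ z) \<noteq> None" using state_teq[OF z] assms(3) by simp
  then obtain \<beta> where "state \<alpha> u = Some \<beta>" "state \<beta> z \<noteq> None" using state_prefix by blast
  from msub_step(1)[OF assms(1) this] have "\<phi> \<alpha> (trace_of I u) \<le> \<phi> \<alpha> (trace_of I (u @ z))" .
  also have "trace_of I (u @ z) = trace_of I v" using z by (simp add: trace_of_eq_iff)
  finally show ?thesis .
qed

text \<open>
Subadditivity reduces the bound to single letters.
\<close>
lemma msub_linear_bound:
  assumes ms: "monotone_subadditive_fun I act \<phi>"
  obtains K where "0 \<le> K" "\<And>\<alpha> u. state \<alpha> u \<noteq> None \<Longrightarrow> u \<noteq> [] \<Longrightarrow> \<phi> \<alpha> (trace_of I u) \<le> K * real (length u)"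
proof -
  define K where "K = (\<Sum>\<alpha>\<in>UNIV. \<Sum>a\<in>UNIV. \<bar>\<phi> \<alpha> (trace_of I [a])\<bar>)"
  have K: "\<phi> \<alpha> (trace_of I [a]) \<le> K" for \<alpha> a
  proof -
    have "\<phi> \<alpha> (trace_of I [a]) \<le> \<bar>\<phi> \<alpha> (trace_of I [a])\<bar>" by simp
    also have "\<dots> \<le> (\<Sum>a\<in>UNIV. \<bar>\<phi> \<alpha> (trace_of I [a])\<bar>)" by (rule member_le_sum) auto
    also have "\<dots> \<le> K" unfolding K_def by (rule member_le_sum) (auto intro: sum_nonneg)
    finally show ?thesis .
  qed
  have "\<phi> \<alpha> (trace_of I u) \<le> K * real (length u)" if "state \<alpha> u \<noteq> None" "u \<noteq> []" for \<alpha> u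
    using that
  proof (induction u rule: rev_induct)
    case (snoc a u)
    then obtain \<beta> where \<beta>: "state \<alpha> u = Some \<beta>" "state \<beta> [a] \<noteq> None" using state_prefix by blast
    show ?case
    proof (cases "u = []")
      case True
      then show ?thesis using K[of \<alpha> a] by simp
    next
      case False
      have "\<phi> \<alpha> (trace_of I (u @ [a])) \<le> \<phi> \<alpha> (trace_of I u) + \<phi> \<beta> (trace_of I [a])" by (rule msub_step(2)[OF ms \<beta>])
      moreover have "\<phi> \<alpha> (trace_of I u) \<le> K * real (length u)" using snoc.IH \<beta>(1) False by simp
      ultimately have "\<phi> \<alpha> (trace_of I (u @ [a])) \<le> K * real (length u) + K" using K[of \<beta> a] by linarith
      then show ?thesis by (simp add: distrib_left)
    qed
  qed simp
  moreover have "0 \<le> K" unfolding K_def by (intro sum_nonneg) auto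
  ultimately show ?thesis using that by blast
qed

lemma msub_length: "monotone_subadditive_fun I act (\<lambda>_ x. real (trace_length x))"
  unfolding monotone_subadditive_fun_def
  by (auto elim!: traces_fromE simp: trace_length_trace_of)

end

context regeneration begin

text \<open>
If \<open>y\<close> does not contain the first \<open>n + 1\<close> blocks, then by \<open>regeneration_cut\<close> it lies below the first \<open>n + 2\<close>.
\<close>
lemma run_enabled_step:
  assumes b: "\<omega> \<in> boundary I" and r: "run u \<omega> s" and y: "pre y \<omega>"
    and n: "\<not> u @ concat (stake (Suc n) s) \<preceq> y"
  shows "y \<preceq> u @ concat (stake (Suc (Suc n)) s)"
proof -
  let ?R = "u @ concat (stake n s)"
  have "pre (u @ concat (stake (Suc (Suc n)) s)) \<omega>" using r unfolding run_def by blast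
  then have "pre (?R @ s !! n @ s !! Suc n) \<omega>" by (simp add: stake_Suc del: stake.simps)
  with y obtain z where z: "y \<preceq> z" "?R @ s !! n @ s !! Suc n \<preceq> z" by (rule pre_directed)
  have "s !! Suc n \<in> block \<beta>0" using r unfolding run_def by blast
  moreover have "\<not> ?R @ s !! n \<preceq> y" using n by (simp add: stake_Suc del: stake.simps)
  ultimately have "y \<preceq> ?R @ s !! n @ s !! Suc n" using regeneration_cut z by blast
  then show ?thesis by (simp add: stake_Suc del: stake.simps)
qed

lemma run_length: assumes "run u \<omega> s" shows "n \<le> length (u @ concat (stake n s))"
proof (induction n)
  case (Suc n)
  have "s !! n \<noteq> []" using assms block_nonempty unfolding run_def by blast
  then have "1 \<le> length (s !! n)" by (cases "s !! n") simp_all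
  moreover have "length (u @ concat (stake (Suc n) s)) = length (u @ concat (stake n s)) + length (s !! n)"
    by (simp add: stake_Suc del: stake.simps)
  ultimately show ?case using Suc by linarith
qed simp

lemma run_prefix:
  assumes "\<omega> \<in> boundary I" "run u \<omega> s" "pre y \<omega>"
  shows "y \<preceq> u @ concat (stake (Suc (Suc (length y))) s)"
proof (rule run_enabled_step[OF assms])
  show "\<not> u @ concat (stake (Suc (length y)) s) \<preceq> y"
    using ple_length run_length[OF assms(2), of "Suc (length y)"] by (metis not_less_eq_eq order_trans)
qed

lemma run_mono: "m \<le> n \<Longrightarrow> u @ concat (stake m s) \<preceq> u @ concat (stake n s)"
proof -
  assume "m \<le> n"
  then have "stake n s = stake m s @ stake (n - m) (sdrop m s)" by (metis le_add_diff_inverse stake_add)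
  then have "u @ concat (stake n s) = (u @ concat (stake m s)) @ concat (stake (n - m) (sdrop m s))"
    by (simp only: concat_append append_assoc)
  then show ?thesis using ple_append by metis
qed

text \<open>
Let \<open>R n\<close> be \<open>u\<close> followed by the first \<open>n\<close> blocks, and let \<open>n\<close> be maximal with \<open>R n \<preceq> y\<close>. Then
\<open>y \<preceq> R (n + 2)\<close> and, by monotonicity, the ergodic mean of \<open>y\<close> lies between
\<open>\<phi> (R n) / length (R (n + 2))\<close> and \<open>\<phi> (R (n + 2)) / length (R n)\<close>. Both tend to \<open>\<kappa> / l\<close>.
\<close>
lemma sandwich:
  assumes ms: "monotone_subadditive_fun I act \<phi>"
    and b: "\<omega> \<in> boundary I" and en: "\<And>y. pre y \<omega> \<Longrightarrow> state \<alpha> y \<noteq> None" and r: "run u \<omega> s"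
    and A: "(\<lambda>n. \<phi> \<alpha> (trace_of I (u @ concat (stake n s))) / real n) \<longlonglongrightarrow> \<kappa>"
    and L: "(\<lambda>n. real (length (u @ concat (stake n s))) / real n) \<longlonglongrightarrow> l"
    and l: "l > 0"
  shows "ergodic_at \<phi> (\<kappa> / l) \<alpha> \<omega>"
proof -
  define R where "R = (\<lambda>n. u @ concat (stake n s))"
  define a where "a = (\<lambda>n. \<phi> \<alpha> (trace_of I (R n)))"
  define L' where "L' = (\<lambda>n. real (length (R n)))"
  have A: "(\<lambda>n. a n / real n) \<longlonglongrightarrow> \<kappa>" using A by (simp add: a_def R_def)
  have L: "(\<lambda>n. L' n / real n) \<longlonglongrightarrow> l" using L by (simp add: L'_def R_def)
  have q: "(\<lambda>n. real n / real (n + 2)) \<longlonglongrightarrow> 1" "(\<lambda>n. real (n + 2) / real n) \<longlonglongrightarrow> 1" by real_asymp+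
  have A2: "(\<lambda>n. a (n + 2) / real (n + 2)) \<longlonglongrightarrow> \<kappa>" by (rule LIMSEQ_ignore_initial_segment[OF A])
  have L2: "(\<lambda>n. L' (n + 2) / real (n + 2)) \<longlonglongrightarrow> l" by (rule LIMSEQ_ignore_initial_segment[OF L])
  have lim1: "(\<lambda>n. a n / L' (n + 2)) \<longlonglongrightarrow> \<kappa> / l"
  proof -
    have "(\<lambda>n. (a n / real n) * (real n / real (n + 2)) / (L' (n + 2) / real (n + 2))) \<longlonglongrightarrow> \<kappa> * 1 / l"
      by (intro tendsto_divide tendsto_mult A q L2) (use l in simp)
    then have "(\<lambda>n. (a n / real n) * (real n / real (n + 2)) / (L' (n + 2) / real (n + 2))) \<longlonglongrightarrow> \<kappa> / l"
      by (simp only: mult_1_right)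
    moreover have "eventually (\<lambda>n. (a n / real n) * (real n / real (n + 2)) / (L' (n + 2) / real (n + 2)) = a n / L' (n + 2)) sequentially"
      using eventually_gt_at_top[of 0] by eventually_elim (rule ratio_cancel, simp_all)
    ultimately show ?thesis by (rule Lim_transform_eventually)
  qed
  have lim2: "(\<lambda>n. a (n + 2) / L' n) \<longlonglongrightarrow> \<kappa> / l"
  proof -
    have "(\<lambda>n. (a (n + 2) / real (n + 2)) * (real (n + 2) / real n) / (L' n / real n)) \<longlonglongrightarrow> \<kappa> * 1 / l"
      by (intro tendsto_divide tendsto_mult A2 q L) (use l in simp)
    then have "(\<lambda>n. (a (n + 2) / real (n + 2)) * (real (n + 2) / real n) / (L' n / real n)) \<longlonglongrightarrow> \<kappa> / l"
      by (simp only: mult_1_right)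
    moreover have "eventually (\<lambda>n. (a (n + 2) / real (n + 2)) * (real (n + 2) / real n) / (L' n / real n) = a (n + 2) / L' n) sequentially"
      using eventually_gt_at_top[of 0] by eventually_elim (rule ratio_cancel, simp_all)
    ultimately show ?thesis by (rule Lim_transform_eventually)
  qed
  show ?thesis
    unfolding ergodic_at_def
  proof (intro allI impI)
    fix \<epsilon> :: real assume \<epsilon>: "0 < \<epsilon>"
    have "eventually (\<lambda>n. dist (a n / L' (n + 2)) (\<kappa> / l) < \<epsilon> \<and> dist (a (n + 2) / L' n) (\<kappa> / l) < \<epsilon> \<and> n \<ge> 1) sequentially"
      using tendstoD[OF lim1 \<epsilon>] tendstoD[OF lim2 \<epsilon>] eventually_ge_at_top[of 1] by eventually_elim simp
    then obtain N where N: "\<And>n. n \<ge> N \<Longrightarrow> \<bar>a n / L' (n + 2) - \<kappa> / l\<bar> < \<epsilon>"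
      "\<And>n. n \<ge> N \<Longrightarrow> \<bar>a (n + 2) / L' n - \<kappa> / l\<bar> < \<epsilon>" "\<And>n. n \<ge> N \<Longrightarrow> n \<ge> 1"
      unfolding eventually_sequentially dist_real_def by blast
    show "\<exists>x. pre x \<omega> \<and> (\<forall>y. x \<preceq> y \<longrightarrow> pre y \<omega> \<longrightarrow> y \<noteq> [] \<longrightarrow> \<bar>\<phi> \<alpha> (trace_of I y) / real (length y) - \<kappa> / l\<bar> < \<epsilon>)"
    proof (intro exI[of _ "R N"] conjI allI impI)
      show "pre (R N) \<omega>" using r by (simp add: run_def R_def)
      fix y assume y: "R N \<preceq> y" "pre y \<omega>" "y \<noteq> []"
      define n where "n = Max {n. R n \<preceq> y}"
      have sub: "{n. R n \<preceq> y} \<subseteq> {..length y}"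
        using ple_length run_length[OF r] unfolding R_def by (fastforce intro: order_trans)
      then have fin: "finite {n. R n \<preceq> y}" by (rule finite_subset) simp
      have n: "R n \<preceq> y" using Max_in[OF fin] y(1) unfolding n_def by blast
      have "N \<le> n" unfolding n_def using y(1) by (intro Max_ge fin) simp
      have "\<not> R (Suc n) \<preceq> y"
      proof
        assume "R (Suc n) \<preceq> y"
        then have "Suc n \<le> n" unfolding n_def by (intro Max_ge fin) simp
        then show False by simp
      qed
      then have n2: "y \<preceq> R (n + 2)" using run_enabled_step[OF b r y(2), of n] by (simp add: R_def)
      have pR: "pre (R m) \<omega>" for m using r by (simp add: run_def R_def)
      have f1: "a n \<le> \<phi> \<alpha> (trace_of I y)" unfolding a_def by (rule msub_mono[OF ms n en[OF y(2)]])
      have f2: "\<phi> \<alpha> (trace_of I y) \<le> a (n + 2)" unfolding a_def by (rule msub_mono[OF ms n2 en[OF pR]])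
      have g1: "L' n \<le> real (length y)" unfolding L'_def using ple_length[OF n] by simp
      have g2: "real (length y) \<le> L' (n + 2)" unfolding L'_def using ple_length[OF n2] by simp
      have a0: "0 \<le> a n" unfolding a_def by (rule msub_nonneg[OF ms en[OF pR]])
      have L0: "0 < L' n"
      proof -
        have "1 \<le> n" using N(3) \<open>N \<le> n\<close> by blast
        also have "n \<le> length (R n)" using run_length[OF r, of n] by (simp add: R_def)
        finally have "0 < length (R n)" by linarith
        then show ?thesis unfolding L'_def by (simp only: of_nat_0_less_iff)
      qed
      have "a n / L' (n + 2) \<le> \<phi> \<alpha> (trace_of I y) / real (length y)"
        using f1 g2 a0 L0 g1 by (intro frac_le) auto
      moreover have "\<phi> \<alpha> (trace_of I y) / real (length y) \<le> a (n + 2) / L' n"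
        using f2 g1 a0 f1 L0 by (intro frac_le) auto
      ultimately show "\<bar>\<phi> \<alpha> (trace_of I y) / real (length y) - \<kappa> / l\<bar> < \<epsilon>"
        using N(1,2)[OF \<open>N \<le> n\<close>] by linarith
    qed
  qed
qed

text \<open>
Replaces words that are not blocks by a block, so that every stream, and not only almost every one,
yields an enabled concatenation. The subadditive ergodic theorem asks for its inequalities at every
stream.
\<close>
definition clean :: "'a list \<Rightarrow> 'a list" where
  "clean v = (if v \<in> block \<beta>0 then v else (SOME v. v \<in> block \<beta>0))"

lemma clean_block: "clean v \<in> block \<beta>0"
proof -
  have "\<exists>v. v \<in> block \<beta>0" using set_pmf_not_empty[of block_pmf] set_block_pmf by blast
  then show ?thesis unfolding clean_def using someI_ex[of "\<lambda>v. v \<in> block \<beta>0"] by auto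
qed

definition blocks_word :: "nat \<Rightarrow> 'a list stream \<Rightarrow> 'a list" where
  "blocks_word n s = concat (map clean (stake n s))"

lemma blocks_word_run: assumes "run u \<omega> s" shows "blocks_word n s = concat (stake n s)"
proof -
  have "map clean (stake n s) = stake n s"
    using run_set_stake[OF assms, of n] by (intro map_idI) (auto simp: clean_def)
  then show ?thesis by (simp add: blocks_word_def)
qed

lemma blocks_word_add: "blocks_word (m + n) s = blocks_word m s @ blocks_word n (sdrop m s)"
  unfolding blocks_word_def stake_add[symmetric] by (simp only: map_append concat_append)

lemma state_blocks_word: "state \<alpha> u = Some \<beta>0 \<Longrightarrow> state \<alpha> (u @ blocks_word n s) = Some \<beta>0"
  unfolding blocks_word_def by (rule state_blocks) (use clean_block in auto)

lemma state_cat0: "state \<beta>0 (blocks_word n s) = Some \<beta>0"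
  using state_blocks_word[of \<beta>0 "[]"] by simp

lemma measurable_blocks_word: "(\<lambda>s. h (blocks_word n s)) \<in> borel_measurable blocks.SS" for h :: "'a list \<Rightarrow> real"
proof -
  have "stake n \<in> measurable (stream_space (count_space (UNIV :: 'a list set))) (count_space UNIV)"
    by (rule measurable_stake)
  then have "(\<lambda>s. h (concat (map clean (stake n s)))) \<in> borel_measurable (stream_space (count_space UNIV))"
    by (rule measurable_compose) simp
  then show ?thesis unfolding blocks_word_def by (simp cong: measurable_cong_sets add: blocks.sets_SS)
qed

lemma integrable_shd:
  fixes h :: "'a list \<Rightarrow> real"
  assumes "integrable (measure_pmf block_pmf) h" shows "integrable blocks.SS (\<lambda>s. h (shd s))"
proof -
  have m: "(\<lambda>s. h (shd s)) \<in> borel_measurable blocks.SS"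
    by (rule measurable_compose[OF measurable_shd]) simp
  have "(\<integral>\<^sup>+s. ennreal (norm (h (shd s))) \<partial>blocks.SS) = (\<integral>\<^sup>+x. \<integral>\<^sup>+s. ennreal (norm (h x)) \<partial>blocks.SS \<partial>measure_pmf block_pmf)"
    by (subst prob_space.nn_integral_stream_space[OF measure_pmf.prob_space_axioms])
      (use m in \<open>simp_all add: measurable_compose[OF measurable_shd]\<close>)
  also have "\<dots> = (\<integral>\<^sup>+x. ennreal (norm (h x)) \<partial>measure_pmf block_pmf)"
    by (simp add: blocks.SS.emeasure_space_1[simplified])
  also have "\<dots> < \<infinity>" using assms by (simp add: integrable_iff_bounded)
  finally show ?thesis using m by (intro integrableI_bounded) auto
qed

text \<open>
The process \<open>\<phi> \<beta>0\<close> of the first \<open>n\<close> blocks is monotone and subadditive since each block leads back to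
\<open>\<beta>0\<close>, and it is integrable since \<open>\<phi>\<close> is bounded by a multiple of the length and blocks have finite mean
length.
\<close>
lemma block_limit:
  assumes ms: "monotone_subadditive_fun I act \<phi>"
  obtains \<kappa> where "AE s in blocks.SS. (\<lambda>n. \<phi> \<beta>0 (trace_of I (blocks_word n s)) / real n) \<longlonglongrightarrow> \<kappa>"
proof -
  let ?F = "\<lambda>n s. \<phi> \<beta>0 (trace_of I (blocks_word n s))"
  have en: "state \<beta>0 (blocks_word n s) \<noteq> None" for n s by (simp add: state_cat0)
  obtain K where K: "0 \<le> K" "\<And>\<alpha> u. state \<alpha> u \<noteq> None \<Longrightarrow> u \<noteq> [] \<Longrightarrow> \<phi> \<alpha> (trace_of I u) \<le> K * real (length u)"
    by (rule msub_linear_bound[OF ms]) blast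
  have int1: "integrable blocks.SS (?F 1)"
  proof (rule Bochner_Integration.integrable_bound)
    show "integrable blocks.SS (\<lambda>s. K * real (length (shd s)))"
      by (intro integrable_mult_right integrable_shd integrable_block_length)
    show "?F 1 \<in> borel_measurable blocks.SS" by (rule measurable_blocks_word)
    have "AE s in blocks.SS. shd s \<in> block \<beta>0"
    proof (subst prob_space.AE_stream_space[OF measure_pmf.prob_space_axioms])
      have "(\<lambda>s. shd s) -` (block \<beta>0) \<inter> space blocks.SS \<in> sets blocks.SS"
        by (rule measurable_sets[OF measurable_shd]) simp
      then show "Measurable.pred blocks.SS (\<lambda>s. shd s \<in> block \<beta>0)" by (simp add: pred_def vimage_def)
      show "AE x in measure_pmf block_pmf. AE X in blocks.SS. shd (x ## X) \<in> block \<beta>0"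
        by (simp add: AE_measure_pmf_iff set_block_pmf)
    qed
    then show "AE s in blocks.SS. norm (?F 1 s) \<le> norm (K * real (length (shd s)))"
    proof eventually_elim
      case (elim s)
      then have c: "blocks_word 1 s = shd s" by (simp add: blocks_word_def clean_def)
      have "?F 1 s \<le> K * real (length (shd s))"
        using K(2)[of \<beta>0 "shd s"] block_state[OF elim] block_nonempty[OF elim] c by simp
      then show ?case using msub_nonneg[OF ms en, of 1 s] K(1) by (simp add: abs_mult)
    qed
  qed
  show ?thesis
  proof (rule blocks.subadditive_ergodic[of ?F])
    show "?F n \<in> borel_measurable blocks.SS" for n by (rule measurable_blocks_word)
    show "0 \<le> ?F n s" for n s by (rule msub_nonneg[OF ms en])
    show "?F m s \<le> ?F (m + n) s" for m n s
      unfolding blocks_word_add by (rule msub_step(1)[OF ms state_cat0]) (simp add: state_cat0)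
    show "?F (m + n) s \<le> ?F m s + ?F n (sdrop m s)" for m n s
      unfolding blocks_word_add by (rule msub_step(2)[OF ms state_cat0]) (simp add: state_cat0)
    show "integrable blocks.SS (?F 1)" by (rule int1)
  qed (rule that)
qed

text \<open>
From \<open>\<beta>0\<close> the claim is \<open>block_limit\<close> and \<open>sandwich\<close>. For another initial state \<open>\<alpha>\<close> let \<open>v\<close> be the first
block from \<open>\<alpha>\<close> and \<open>r\<close> a trace from \<open>\<beta>0\<close> to \<open>\<alpha>\<close>. Up to bounded terms, \<open>\<phi> \<alpha>\<close> of \<open>v\<close> followed by \<open>n\<close> blocks
is at most \<open>\<phi> \<beta>0\<close> of the \<open>n\<close> blocks and at least \<open>\<phi> \<beta>0\<close> of \<open>r @ v\<close> followed by the \<open>n\<close> blocks. The former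
grows like \<open>\<kappa> * n\<close> by \<open>block_limit\<close>. For the latter this is obtained from the result for the initial
state \<open>\<beta>0\<close>, applied to the infinite traces above \<open>r @ v\<close>.
\<close>
theorem ergodic_from_blocks:
  assumes ms: "monotone_subadditive_fun I act \<phi>"
  shows "\<exists>k. \<forall>\<alpha>. AE \<omega> in \<nu> \<alpha>. ergodic_at \<phi> k \<alpha> \<omega>"
proof -
  obtain \<kappa> where \<kappa>: "AE s in blocks.SS. (\<lambda>n. \<phi> \<beta>0 (trace_of I (blocks_word n s)) / real n) \<longlonglongrightarrow> \<kappa>"
    by (rule block_limit[OF ms])
  obtain l where "AE s in blocks.SS. (\<lambda>n. real (trace_length (trace_of I (blocks_word n s))) / real n) \<longlonglongrightarrow> l"
    by (rule block_limit[OF msub_length])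
  then have l: "AE s in blocks.SS. (\<lambda>n. real (length (blocks_word n s)) / real n) \<longlonglongrightarrow> l"
    by (simp add: trace_length_trace_of)
  \<comment> \<open>Every block is nonempty, so \<open>l \<ge> 1\<close>, and dividing by \<open>l\<close> is safe.\<close>
  have blocks_word_len: "n \<le> length (blocks_word n s)" for n s
  proof (induction n)
    case (Suc n)
    have "clean (s !! n) \<noteq> []" using block_nonempty clean_block by blast
    then have "1 \<le> length (clean (s !! n))" by (cases "clean (s !! n)") simp_all
    moreover have "length (blocks_word (Suc n) s) = length (blocks_word n s) + length (clean (s !! n))"
      by (simp add: blocks_word_def stake_Suc del: stake.simps)
    ultimately show ?case using Suc by linarith
  qed (simp add: blocks_word_def)
  have "AE s in blocks.SS. 1 \<le> l"
    using l
  proof eventually_elim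
    case (elim s)
    show ?case
    proof (rule LIMSEQ_le_const[OF elim], intro exI allI impI)
      fix n :: nat assume "1 \<le> n"
      then show "1 \<le> real (length (blocks_word n s)) / real n" using blocks_word_len[of n s] by (simp add: le_divide_eq)
    qed
  qed
  then have l1: "1 \<le> l" by simp
  define k where "k = \<kappa> / l"
  have len_lim: "(\<lambda>n. real (length (u @ blocks_word n s)) / real n) \<longlonglongrightarrow> l"
    if "(\<lambda>n. real (length (blocks_word n s)) / real n) \<longlonglongrightarrow> l" for u s
  proof -
    have "(\<lambda>n. real (length u) / real n + real (length (blocks_word n s)) / real n) \<longlonglongrightarrow> 0 + l"
      by (intro tendsto_add tendsto_div_n that)
    then show ?thesis by (simp add: add_divide_distrib)
  qed
  have step1: "AE \<omega> in \<nu> \<beta>0. ergodic_at \<phi> k \<beta>0 \<omega>"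
  proof -
    have "AE s in blocks.SS. (\<lambda>n. \<phi> \<beta>0 (trace_of I (blocks_word n s)) / real n) \<longlonglongrightarrow> \<kappa> \<and> (\<lambda>n. real (length (blocks_word n s)) / real n) \<longlonglongrightarrow> l"
      using \<kappa> l by eventually_elim simp
    from AE_run[OF state_Nil this] AE_boundary AE_enabled show ?thesis
    proof eventually_elim
      case (elim \<omega>)
      then obtain s where s: "run [] \<omega> s" "(\<lambda>n. \<phi> \<beta>0 (trace_of I (blocks_word n s)) / real n) \<longlonglongrightarrow> \<kappa>"
        "(\<lambda>n. real (length (blocks_word n s)) / real n) \<longlonglongrightarrow> l" by auto
      show ?case unfolding k_def
        by (rule sandwich[OF ms elim(2) _ s(1)]) (use elim(3) s(2,3) l1 blocks_word_run[OF s(1)] in auto)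
    qed
  qed
  have "AE \<omega> in \<nu> \<alpha>. ergodic_at \<phi> k \<alpha> \<omega>" for \<alpha>
  proof -
    obtain r where r: "state \<beta>0 r = Some \<alpha>" by (rule transitive)
    have "AE \<omega> in \<nu> \<alpha>. pre v \<omega> \<longrightarrow> ergodic_at \<phi> k \<alpha> \<omega>" if v: "v \<in> block \<alpha>" for v
    proof -
      have sv: "state \<alpha> v = Some \<beta>0" by (rule block_state[OF v])
      then have srv: "state \<beta>0 (r @ v) = Some \<beta>0" using state_append_Some[OF r, of v] by simp
      \<comment> \<open>The process seen from \<open>\<beta>0\<close> when the blocks are preceded by \<open>r @ v\<close>.\<close>
      let ?h = "\<lambda>n s. \<phi> \<beta>0 (trace_of I ((r @ v) @ blocks_word n s)) / real n"
      have "AE s in blocks.SS. (\<lambda>n. ?h n s) \<longlonglongrightarrow> \<kappa>"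
      proof (rule AE_run_converse[OF srv])
        have "{s\<in>space blocks.SS. \<forall>i::nat. \<exists>N. \<forall>n\<ge>N. \<bar>?h n s - \<kappa>\<bar> < 1 / real (Suc i)} \<in> sets blocks.SS"
          using measurable_blocks_word[of "\<lambda>u. \<phi> \<beta>0 (trace_of I ((r @ v) @ u)) / real _"] by measurable
        then show "{s. (\<lambda>n. ?h n s) \<longlonglongrightarrow> \<kappa>} \<in> sets blocks.SS"
          unfolding LIMSEQ_iff_inverse_Suc by simp
        show "AE \<omega> in \<nu> \<beta>0. pre (r @ v) \<omega> \<longrightarrow> (\<forall>s. run (r @ v) \<omega> s \<longrightarrow> (\<lambda>n. ?h n s) \<longlonglongrightarrow> \<kappa>)"
          using step1 AE_run[OF srv l] AE_boundary
        proof eventually_elim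
          case (elim \<omega>)
          show ?case
          proof (intro impI allI)
            fix s assume p: "pre (r @ v) \<omega>" and s: "run (r @ v) \<omega> s"
            have L: "(\<lambda>n. real (length (blocks_word n s)) / real n) \<longlonglongrightarrow> l"
              using elim(2) p run_unique[OF s] by blast
            let ?R = "\<lambda>n. (r @ v) @ blocks_word n s"
            have q: "(\<lambda>n. \<phi> \<beta>0 (trace_of I (?R n)) / real (length (?R n))) \<longlonglongrightarrow> k"
            proof (rule LIMSEQ_I)
              fix e :: real assume "0 < e"
              then obtain x where x: "pre x \<omega>" "\<And>y. x \<preceq> y \<Longrightarrow> pre y \<omega> \<Longrightarrow> y \<noteq> [] \<Longrightarrow> \<bar>\<phi> \<beta>0 (trace_of I y) / real (length y) - k\<bar> < e"
                using elim(1) unfolding ergodic_at_def by blast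
              have "norm (\<phi> \<beta>0 (trace_of I (?R n)) / real (length (?R n)) - k) < e" if n: "Suc (Suc (length x)) \<le> n" for n
                unfolding real_norm_def
              proof (rule x(2))
                have "x \<preceq> (r @ v) @ concat (stake (Suc (Suc (length x))) s)" by (rule run_prefix[OF elim(3) s x(1)])
                also have "\<dots> \<preceq> (r @ v) @ concat (stake n s)" by (rule run_mono[OF n])
                finally show "x \<preceq> ?R n" by (simp add: blocks_word_run[OF s])
                show "pre (?R n) \<omega>" using s unfolding blocks_word_run[OF s] run_def by blast
                show "?R n \<noteq> []" using blocks_word_len[of n s] n by auto
              qed
              then show "\<exists>no. \<forall>n\<ge>no. norm (\<phi> \<beta>0 (trace_of I (?R n)) / real (length (?R n)) - k) < e" by blast
            qed
            have "(\<lambda>n. \<phi> \<beta>0 (trace_of I (?R n)) / real (length (?R n)) * (real (length (?R n)) / real n)) \<longlonglongrightarrow> k * l"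
              by (intro tendsto_mult q len_lim L)
            moreover have "k * l = \<kappa>" using l1 by (simp add: k_def)
            ultimately have "(\<lambda>n. \<phi> \<beta>0 (trace_of I (?R n)) / real (length (?R n)) * (real (length (?R n)) / real n)) \<longlonglongrightarrow> \<kappa>"
              by (simp only:)
            moreover have "eventually (\<lambda>n. \<phi> \<beta>0 (trace_of I (?R n)) / real (length (?R n)) * (real (length (?R n)) / real n) = ?h n s) sequentially"
              using eventually_gt_at_top[of 0]
            proof eventually_elim
              case (elim n)
              have "length (?R n) \<noteq> 0" unfolding length_append using blocks_word_len[of n s] elim by linarith
              then show ?case by (intro ratio_cancel2) (simp only: of_nat_eq_0_iff not_False_eq_True)
            qed
            ultimately show "(\<lambda>n. ?h n s) \<longlonglongrightarrow> \<kappa>" by (rule Lim_transform_eventually)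
          qed
        qed
      qed
      with \<kappa> l have "AE s in blocks.SS. (\<lambda>n. \<phi> \<alpha> (trace_of I (v @ blocks_word n s)) / real n) \<longlonglongrightarrow> \<kappa> \<and> (\<lambda>n. real (length (blocks_word n s)) / real n) \<longlonglongrightarrow> l"
      proof eventually_elim
        case (elim s)
        have "(\<lambda>n. \<phi> \<alpha> (trace_of I (v @ blocks_word n s)) / real n) \<longlonglongrightarrow> \<kappa>"
        proof (rule tendsto_sandwich)
          have "state \<alpha> (v @ blocks_word n s) \<noteq> None" for n using state_blocks_word[OF sv] by simp
          from msub_step(2)[OF ms r this]
          show "\<forall>\<^sub>F n in sequentially. ?h n s - \<phi> \<beta>0 (trace_of I r) / real n \<le> \<phi> \<alpha> (trace_of I (v @ blocks_word n s)) / real n"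
            by (intro always_eventually allI) (simp add: diff_divide_distrib[symmetric] divide_right_mono algebra_simps)
          have "state \<beta>0 (blocks_word n s) \<noteq> None" for n by (simp add: state_cat0)
          from msub_step(2)[OF ms sv this]
          show "\<forall>\<^sub>F n in sequentially. \<phi> \<alpha> (trace_of I (v @ blocks_word n s)) / real n \<le> \<phi> \<alpha> (trace_of I v) / real n + \<phi> \<beta>0 (trace_of I (blocks_word n s)) / real n"
            by (intro always_eventually allI) (simp add: add_divide_distrib[symmetric] divide_right_mono)
          show "(\<lambda>n. ?h n s - \<phi> \<beta>0 (trace_of I r) / real n) \<longlonglongrightarrow> \<kappa>"
            using tendsto_diff[OF elim(3) tendsto_div_n[of "\<phi> \<beta>0 (trace_of I r)"]] by simp
          show "(\<lambda>n. \<phi> \<alpha> (trace_of I v) / real n + \<phi> \<beta>0 (trace_of I (blocks_word n s)) / real n) \<longlonglongrightarrow> \<kappa>"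
            using tendsto_add[OF tendsto_div_n[of "\<phi> \<alpha> (trace_of I v)"] elim(1)] by simp
        qed
        then show ?case using elim(2) by simp
      qed
      from AE_run[OF sv this] AE_boundary AE_enabled show ?thesis
      proof eventually_elim
        case (elim \<omega>)
        show ?case
        proof
          assume "pre v \<omega>"
          then obtain s where s: "run v \<omega> s" "(\<lambda>n. \<phi> \<alpha> (trace_of I (v @ blocks_word n s)) / real n) \<longlonglongrightarrow> \<kappa>"
            "(\<lambda>n. real (length (blocks_word n s)) / real n) \<longlonglongrightarrow> l" using elim(1) by blast
          show "ergodic_at \<phi> k \<alpha> \<omega>" unfolding k_def
            by (rule sandwich[OF ms elim(2) _ s(1)])
              (use elim(3) s(2) len_lim[OF s(3)] l1 blocks_word_run[OF s(1)] in auto)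
        qed
      qed
    qed
    then have "AE \<omega> in \<nu> \<alpha>. v \<in> block \<alpha> \<longrightarrow> pre v \<omega> \<longrightarrow> ergodic_at \<phi> k \<alpha> \<omega>" for v
      by (cases "v \<in> block \<alpha>") auto
    then have "AE \<omega> in \<nu> \<alpha>. \<forall>v. v \<in> block \<alpha> \<longrightarrow> pre v \<omega> \<longrightarrow> ergodic_at \<phi> k \<alpha> \<omega>"
      unfolding AE_all_countable by blast
    with AE_block[of \<alpha>] show ?thesis by eventually_elim blast
  qed
  then show ?thesis by blast
qed

end

context markov_system begin

theorem ergodic_monotone_subadditive:
  assumes ms: "monotone_subadditive_fun I act \<phi>"
  shows "\<exists>k. \<forall>\<alpha>. AE \<omega> in \<nu> \<alpha>. ergodic_at \<phi> k \<alpha> \<omega>"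
proof -
  obtain \<alpha>0 :: 's where True by blast
  obtain w t where w: "state \<alpha>0 w \<noteq> None" "strong_top t w" "\<forall>b. \<exists>u1 u2. w = u1 @ u2 \<and> strong_top b u1"
    using cutting_word_exists[of \<alpha>0] by blast
  then obtain \<beta>0 where "state \<alpha>0 w = Some \<beta>0" by blast
  then interpret regeneration I act \<nu> \<alpha>0 w t \<beta>0
    by unfold_locales (use w in auto)
  show ?thesis by (rule ergodic_from_blocks[OF ms])
qed

lemma additive_step:
  assumes "additive_fun I act \<phi>" "state \<alpha> u = Some \<beta>" "state \<beta> v \<noteq> None"
  shows "\<phi> \<alpha> (trace_of I (u @ v)) = \<phi> \<alpha> (trace_of I u) + \<phi> \<beta> (trace_of I v)"
proof -
  have "trace_of I u \<in> traces_from I act \<alpha>" "trace_of I v \<in> traces_from I act (next_state act \<alpha> (trace_of I u))"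
    using assms(2,3) next_state_eq[OF assms(2)] by (simp_all add: traces_from_iff)
  then have "\<phi> \<alpha> (trace_of I u \<cdot>\<^bsub>I\<^esub> trace_of I v) = \<phi> \<alpha> (trace_of I u) + \<phi> (next_state act \<alpha> (trace_of I u)) (trace_of I v)"
    using assms(1) unfolding additive_fun_def by blast
  then show ?thesis using next_state_eq[OF assms(2)] by simp
qed

lemma additive_bound:
  assumes ad: "additive_fun I act \<phi>"
  obtains K where "0 \<le> K" "\<And>\<alpha> u. state \<alpha> u \<noteq> None \<Longrightarrow> \<bar>\<phi> \<alpha> (trace_of I u)\<bar> \<le> K * real (length u)"
proof -
  define K where "K = (\<Sum>\<alpha>\<in>UNIV. \<Sum>a\<in>UNIV. \<bar>\<phi> \<alpha> (trace_of I [a])\<bar>)"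
  have K: "\<bar>\<phi> \<alpha> (trace_of I [a])\<bar> \<le> K" for \<alpha> a
  proof -
    have "\<bar>\<phi> \<alpha> (trace_of I [a])\<bar> \<le> (\<Sum>a\<in>UNIV. \<bar>\<phi> \<alpha> (trace_of I [a])\<bar>)" by (rule member_le_sum) auto
    also have "\<dots> \<le> K" unfolding K_def by (rule member_le_sum) (auto intro: sum_nonneg)
    finally show ?thesis .
  qed
  have "\<bar>\<phi> \<alpha> (trace_of I u)\<bar> \<le> K * real (length u)" if "state \<alpha> u \<noteq> None" for \<alpha> u
    using that
  proof (induction u rule: rev_induct)
    case Nil
    show ?case using additive_step[OF ad state_Nil, of \<alpha> "[]"] by simp
  next
    case (snoc a u)
    then obtain \<beta> where \<beta>: "state \<alpha> u = Some \<beta>" "state \<beta> [a] \<noteq> None" using state_prefix by blast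
    have "\<bar>\<phi> \<alpha> (trace_of I u)\<bar> \<le> K * real (length u)" using snoc.IH \<beta>(1) by simp
    then have "\<bar>\<phi> \<alpha> (trace_of I (u @ [a]))\<bar> \<le> K * real (length u) + K"
      using K[of \<beta> a] additive_step[OF ad \<beta>] by linarith
    then show ?case by (simp add: distrib_left)
  qed
  moreover have "0 \<le> K" unfolding K_def by (intro sum_nonneg) auto
  ultimately show ?thesis using that by blast
qed

text \<open>
An additive function is bounded by \<open>K\<close> times the length. Adding \<open>K\<close> times the length makes it nonnegative,
hence monotone, and adds the constant \<open>K\<close> to all ergodic means.
\<close>
theorem ergodic_test_function:
  assumes "test_function I act \<phi>"
  shows "\<exists>k. \<forall>\<alpha>. AE \<omega> in \<nu> \<alpha>. ergodic_at \<phi> k \<alpha> \<omega>"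
proof (cases "monotone_subadditive_fun I act \<phi>")
  case True
  then show ?thesis by (rule ergodic_monotone_subadditive)
next
  case False
  then have ad: "additive_fun I act \<phi>" using assms by (simp add: test_function_def)
  obtain K where K: "0 \<le> K" "\<And>\<alpha> u. state \<alpha> u \<noteq> None \<Longrightarrow> \<bar>\<phi> \<alpha> (trace_of I u)\<bar> \<le> K * real (length u)"
    by (rule additive_bound[OF ad]) blast
  define \<psi> where "\<psi> = (\<lambda>\<alpha> x. \<phi> \<alpha> x + K * real (trace_length x))"
  have nn: "0 \<le> \<psi> \<alpha> (trace_of I u)" if "state \<alpha> u \<noteq> None" for \<alpha> u
    using K(2)[OF that] by (simp add: \<psi>_def trace_length_trace_of abs_le_iff)
  have "monotone_subadditive_fun I act \<psi>"
    unfolding monotone_subadditive_fun_def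
  proof (intro conjI allI ballI)
    fix \<alpha> x assume "x \<in> traces_from I act \<alpha>"
    then show "0 \<le> \<psi> \<alpha> x" by (elim traces_fromE) (simp add: nn)
  next
    fix \<alpha> x y assume x: "x \<in> traces_from I act \<alpha>" and y: "y \<in> traces_from I act (next_state act \<alpha> x)"
    obtain u where u: "x = trace_of I u" "state \<alpha> u \<noteq> None" using x by (rule traces_fromE)
    then obtain \<beta> where \<beta>: "state \<alpha> u = Some \<beta>" by blast
    obtain v where v: "y = trace_of I v" "state \<beta> v \<noteq> None"
      using y next_state_eq[OF \<beta>] unfolding u(1) by (auto elim: traces_fromE)
    have eq: "\<psi> \<alpha> (x \<cdot>\<^bsub>I\<^esub> y) = \<psi> \<alpha> x + \<psi> \<beta> y"
      using additive_step[OF ad \<beta> v(2)] by (simp add: \<psi>_def u(1) v(1) trace_length_trace_of algebra_simps)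
    show "\<psi> \<alpha> x \<le> \<psi> \<alpha> (x \<cdot>\<^bsub>I\<^esub> y)" using eq nn[OF v(2)] v(1) by simp
    show "\<psi> \<alpha> (x \<cdot>\<^bsub>I\<^esub> y) \<le> \<psi> \<alpha> x + \<psi> (next_state act \<alpha> x) y" using eq next_state_eq[OF \<beta>] u(1) by simp
  qed
  then obtain k where k: "\<And>\<alpha>. AE \<omega> in \<nu> \<alpha>. ergodic_at \<psi> k \<alpha> \<omega>" using ergodic_monotone_subadditive by blast
  have "ergodic_at \<phi> (k - K) \<alpha> \<omega>" if "ergodic_at \<psi> k \<alpha> \<omega>" for \<alpha> \<omega>
  proof -
    have eq: "\<bar>\<phi> \<alpha> (trace_of I y) / real (length y) - (k - K)\<bar> = \<bar>\<psi> \<alpha> (trace_of I y) / real (length y) - k\<bar>"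
      if "y \<noteq> []" for y
      using that by (simp add: \<psi>_def trace_length_trace_of add_divide_distrib)
    show ?thesis using that unfolding ergodic_at_def by (simp add: eq cong: imp_cong)
  qed
  then have "AE \<omega> in \<nu> \<alpha>. ergodic_at \<phi> (k - K) \<alpha> \<omega>" for \<alpha> using k[of \<alpha>] by (auto elim: eventually_mono)
  then show ?thesis by blast
qed

theorem ergodic_means:
  assumes "\<forall>\<alpha>. AE \<omega> in \<nu> \<alpha>. ergodic_at \<phi> k \<alpha> \<omega>"
  shows "ergodic_means_converge I act \<nu> \<phi> (\<lambda>\<alpha> \<omega>. k)"
  unfolding ergodic_means_converge_def
proof
  fix \<alpha>
  from assms have "AE \<omega> in \<nu> \<alpha>. ergodic_at \<phi> k \<alpha> \<omega>" by blast
  then show "AE \<omega> in \<nu> \<alpha>. \<forall>\<epsilon>>0. \<exists>x\<in>traces_from I act \<alpha>. le_inf I x \<omega> \<and>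
        (\<forall>y\<in>traces_from I act \<alpha>. y \<noteq> \<one>\<^bsub>trace_monoid I\<^esub> \<and> trace_le I x y \<and> le_inf I y \<omega> \<longrightarrow>
           \<bar>ergodic_mean \<phi> \<alpha> y - k\<bar> < \<epsilon>)"
    using AE_enabled
  proof eventually_elim
    case (elim \<omega>)
    show ?case
    proof (intro allI impI)
      fix \<epsilon> :: real assume "0 < \<epsilon>"
      then obtain x where x: "pre x \<omega>" "\<And>y. x \<preceq> y \<Longrightarrow> pre y \<omega> \<Longrightarrow> y \<noteq> [] \<Longrightarrow> \<bar>\<phi> \<alpha> (trace_of I y) / real (length y) - k\<bar> < \<epsilon>"
        using elim(1) unfolding ergodic_at_def by blast
      show "\<exists>x\<in>traces_from I act \<alpha>. le_inf I x \<omega> \<and>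
        (\<forall>y\<in>traces_from I act \<alpha>. y \<noteq> \<one>\<^bsub>trace_monoid I\<^esub> \<and> trace_le I x y \<and> le_inf I y \<omega> \<longrightarrow>
           \<bar>ergodic_mean \<phi> \<alpha> y - k\<bar> < \<epsilon>)"
      proof (intro bexI[of _ "trace_of I x"] conjI ballI impI)
        show "le_inf I (trace_of I x) \<omega>" using x(1) by (simp add: pre_def)
        show "trace_of I x \<in> traces_from I act \<alpha>" unfolding traces_from_iff using elim(2) x(1) by blast
        fix y assume y: "y \<in> traces_from I act \<alpha>" and *: "y \<noteq> \<one>\<^bsub>trace_monoid I\<^esub> \<and> trace_le I (trace_of I x) y \<and> le_inf I y \<omega>"
        obtain v where v: "y = trace_of I v" using y by (rule traces_fromE)
        have "v \<noteq> []" "x \<preceq> v" "pre v \<omega>" using * v by (auto simp: one_trace_monoid trace_le_iff pre_def)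
        then show "\<bar>ergodic_mean \<phi> \<alpha> y - k\<bar> < \<epsilon>"
          using x(2)[of v] by (simp add: ergodic_mean_def v trace_length_trace_of)
      qed
    qed
  qed
qed

end

section \<open>Invariant distributions of irreducible stochastic matrices\<close>

text \<open>
A zero of a nonnegative invariant vector spreads backwards along positive entries.
\<close>
lemma invariant_zero:
  fixes c :: "'v \<Rightarrow> real"
  assumes fin: "finite J" and Q0: "\<And>u v. u \<in> J \<Longrightarrow> v \<in> J \<Longrightarrow> 0 \<le> Q u v"
    and irr: "\<And>u v. u \<in> J \<Longrightarrow> v \<in> J \<Longrightarrow> (u, v) \<in> {(x, y). x \<in> J \<and> y \<in> J \<and> 0 < Q x y}\<^sup>*"
    and c0: "\<And>v. v \<in> J \<Longrightarrow> 0 \<le> c v" and inv: "\<And>v. v \<in> J \<Longrightarrow> (\<Sum>u\<in>J. c u * Q u v) = c v"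
    and v0: "v0 \<in> J" "c v0 = 0" and u: "u \<in> J"
  shows "c u = 0"
  using irr[OF u v0(1)]
proof (induction rule: converse_rtrancl_induct)
  case base
  show ?case by (rule v0(2))
next
  case (step x y)
  then have xy: "x \<in> J" "y \<in> J" "0 < Q x y" by auto
  have "(\<Sum>u\<in>J. c u * Q u y) = 0" using inv[OF xy(2)] step.IH by simp
  then have "\<forall>u\<in>J. c u * Q u y = 0"
    using sum_nonneg_eq_0_iff[OF fin, of "\<lambda>u. c u * Q u y"] c0 Q0 xy(2) by simp
  then have "c x * Q x y = 0" using xy(1) by blast
  then show ?case using xy(3) by simp
qed

text \<open>
Subtract from \<open>b\<close> the largest multiple \<open>t\<close> of \<open>a\<close> that keeps the difference nonnegative. The difference is
invariant and has a zero, so it vanishes; comparing the total masses gives \<open>t = 1\<close>.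
\<close>
lemma invariant_unique:
  fixes a b :: "'v \<Rightarrow> real"
  assumes fin: "finite J" and ne: "J \<noteq> {}" and Q0: "\<And>u v. u \<in> J \<Longrightarrow> v \<in> J \<Longrightarrow> 0 \<le> Q u v"
    and irr: "\<And>u v. u \<in> J \<Longrightarrow> v \<in> J \<Longrightarrow> (u, v) \<in> {(x, y). x \<in> J \<and> y \<in> J \<and> 0 < Q x y}\<^sup>*"
    and a: "\<And>v. v \<in> J \<Longrightarrow> 0 \<le> a v" "\<And>v. v \<in> J \<Longrightarrow> (\<Sum>u\<in>J. a u * Q u v) = a v" "(\<Sum>v\<in>J. a v) = 1"
    and b: "\<And>v. v \<in> J \<Longrightarrow> 0 \<le> b v" "\<And>v. v \<in> J \<Longrightarrow> (\<Sum>u\<in>J. b u * Q u v) = b v" "(\<Sum>v\<in>J. b v) = 1"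
    and v: "v \<in> J"
  shows "a v = b v"
proof -
  have apos: "0 < a v" if "v \<in> J" for v
  proof (rule ccontr)
    assume "\<not> 0 < a v"
    then have "a v = 0" using a(1)[OF that] by simp
    have "a u = 0" if u: "u \<in> J" for u
      by (rule invariant_zero[OF fin Q0 irr a(1) a(2) \<open>v \<in> J\<close> \<open>a v = 0\<close> u])
    then show False using a(3) by simp
  qed
  define t where "t = Min ((\<lambda>v. b v / a v) ` J)"
  have "t \<in> (\<lambda>v. b v / a v) ` J" unfolding t_def using fin ne by (intro Min_in) auto
  then obtain v0 where v0: "v0 \<in> J" "t = b v0 / a v0" by blast
  define c where "c = (\<lambda>v. b v - t * a v)"
  have c0: "0 \<le> c v" if "v \<in> J" for v
  proof -
    have "t \<le> b v / a v" unfolding t_def using fin that by (intro Min_le) auto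
    then show ?thesis using apos[OF that] by (simp add: c_def le_divide_eq)
  qed
  have cv0: "c v0 = 0" using apos[OF v0(1)] by (simp add: c_def v0(2))
  have cinv: "(\<Sum>u\<in>J. c u * Q u v) = c v" if "v \<in> J" for v
  proof -
    have "(\<Sum>u\<in>J. c u * Q u v) = (\<Sum>u\<in>J. b u * Q u v) - t * (\<Sum>u\<in>J. a u * Q u v)"
      by (simp add: c_def left_diff_distrib sum_subtractf sum_distrib_left mult.assoc)
    then show ?thesis using a(2)[OF that] b(2)[OF that] by (simp add: c_def)
  qed
  have c_zero: "c u = 0" if u: "u \<in> J" for u
    by (rule invariant_zero[OF fin Q0 irr c0 cinv v0(1) cv0 u])
  have "(\<Sum>v\<in>J. c v) = (\<Sum>v\<in>J. b v) - t * (\<Sum>v\<in>J. a v)"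
    by (simp add: c_def sum_subtractf sum_distrib_left)
  then have "t = 1" using c_zero a(3) b(3) by simp
  then show ?thesis using c_zero[OF v] by (simp add: c_def)
qed

text \<open>
Brouwer's fixed point theorem on the simplex of probability vectors on \<open>J\<close>.
\<close>
lemma invariant_exists:
  fixes Q :: "'v::finite \<Rightarrow> 'v \<Rightarrow> real"
  assumes ne: "J \<noteq> {}" and Q0: "\<And>u v. u \<in> J \<Longrightarrow> v \<in> J \<Longrightarrow> 0 \<le> Q u v"
    and stoch: "\<And>u. u \<in> J \<Longrightarrow> (\<Sum>v\<in>J. Q u v) = 1"
  shows "\<exists>a. (\<forall>v. 0 \<le> a v) \<and> (\<forall>v. v \<notin> J \<longrightarrow> a v = 0) \<and> (\<Sum>v\<in>J. a v) = 1 \<and> (\<forall>v\<in>J. (\<Sum>u\<in>J. a u * Q u v) = a v)"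
proof -
  define S where "S = {x :: real^'v. (\<forall>i. 0 \<le> x $ i) \<and> (\<forall>i. i \<notin> J \<longrightarrow> x $ i = 0) \<and> (\<Sum>i\<in>J. x $ i) = 1}"
  define T where "T = (\<lambda>x :: real^'v. \<chi> v. if v \<in> J then (\<Sum>u\<in>J. x $ u * Q u v) else 0)"
  have Sum: "(\<Sum>i\<in>UNIV. \<bar>x $ i\<bar>) = 1" if "x \<in> S" for x
  proof -
    have "(\<Sum>i\<in>UNIV. \<bar>x $ i\<bar>) = (\<Sum>i\<in>J. \<bar>x $ i\<bar>)"
      using that by (intro sum.mono_neutral_right) (auto simp: S_def)
    also have "\<dots> = (\<Sum>i\<in>J. x $ i)" using that by (intro sum.cong) (auto simp: S_def)
    finally show ?thesis using that by (simp add: S_def)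
  qed
  have "closed S"
  proof -
    have "S = (\<Inter>i. {x. 0 \<le> x $ i}) \<inter> (\<Inter>i\<in>-J. {x. x $ i = 0}) \<inter> {x. (\<Sum>i\<in>J. x $ i) = 1}"
      by (auto simp: S_def)
    also have "closed \<dots>"
      by (intro closed_Int closed_INT ballI closed_Collect_le closed_Collect_eq continuous_intros)
    finally show ?thesis .
  qed
  moreover have "bounded S"
  proof (rule boundedI)
    fix x assume "x \<in> S"
    then show "norm x \<le> 1" using norm_le_l1_cart[of x] Sum[of x] by simp
  qed
  ultimately have "compact S" by (simp add: compact_eq_bounded_closed)
  moreover have "convex S"
    unfolding convex_def
  proof (intro ballI allI impI)
    fix x y :: "real^'v" and s r :: real
    assume *: "x \<in> S" "y \<in> S" "0 \<le> s" "0 \<le> r" "s + r = 1"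
    have "(\<Sum>i\<in>J. (s *\<^sub>R x + r *\<^sub>R y) $ i) = s * (\<Sum>i\<in>J. x $ i) + r * (\<Sum>i\<in>J. y $ i)"
      by (simp add: sum.distrib sum_distrib_left)
    also have "\<dots> = 1" using * by (simp add: S_def)
    finally show "s *\<^sub>R x + r *\<^sub>R y \<in> S" using * by (simp add: S_def)
  qed
  moreover have "S \<noteq> {}"
  proof -
    obtain j where "j \<in> J" using ne by blast
    then have "axis j 1 \<in> S" by (auto simp: S_def axis_def)
    then show ?thesis by blast
  qed
  moreover have "continuous_on S T"
  proof -
    have "continuous_on S (\<lambda>x. if v \<in> J then (\<Sum>u\<in>J. x $ u * Q u v) else 0)" for v
      by (cases "v \<in> J") (auto intro!: continuous_intros)
    then show ?thesis unfolding T_def by (intro continuous_on_vec_lambda)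
  qed
  moreover have "T x \<in> S" if "x \<in> S" for x
  proof -
    have "(\<Sum>v\<in>J. T x $ v) = (\<Sum>v\<in>J. \<Sum>u\<in>J. x $ u * Q u v)" by (simp add: T_def)
    also have "\<dots> = (\<Sum>u\<in>J. x $ u * (\<Sum>v\<in>J. Q u v))" by (subst sum.swap) (simp add: sum_distrib_left)
    also have "\<dots> = 1" using that stoch by (simp add: S_def)
    finally show ?thesis using that Q0 by (auto simp: S_def T_def intro!: sum_nonneg)
  qed
  ultimately obtain x where x: "x \<in> S" "T x = x"
    using brouwer[of S T] by blast
  have "\<forall>v\<in>J. (\<Sum>u\<in>J. x $ u * Q u v) = x $ v"
  proof
    fix v assume "v \<in> J"
    have "T x $ v = x $ v" using x(2) by simp
    then show "(\<Sum>u\<in>J. x $ u * Q u v) = x $ v" using \<open>v \<in> J\<close> by (simp add: T_def)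
  qed
  then show ?thesis using x(1) by (intro exI[of _ "\<lambda>v. x $ v"]) (simp add: S_def)
qed

lemma ex1_invariant_distribution:
  fixes Q :: "'v::finite \<Rightarrow> 'v \<Rightarrow> real"
  assumes ne: "J \<noteq> {}" and Q0: "\<And>u v. u \<in> J \<Longrightarrow> v \<in> J \<Longrightarrow> 0 \<le> Q u v"
    and stoch: "\<And>u. u \<in> J \<Longrightarrow> (\<Sum>v\<in>J. Q u v) = 1"
    and irr: "\<And>u v. u \<in> J \<Longrightarrow> v \<in> J \<Longrightarrow> (u, v) \<in> {(x, y). x \<in> J \<and> y \<in> J \<and> 0 < Q x y}\<^sup>*"
  shows "\<exists>!\<pi>. invariant_distribution Q J \<pi>"
proof (rule ex_ex1I)
  obtain a where a: "\<And>v. 0 \<le> a v" "\<And>v. v \<notin> J \<Longrightarrow> a v = 0" "(\<Sum>v\<in>J. a v) = 1" "\<And>v. v \<in> J \<Longrightarrow> (\<Sum>u\<in>J. a u * Q u v) = a v"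
    using invariant_exists[where J = J and Q = Q, OF ne Q0 stoch] by metis
  have "(\<integral>\<^sup>+v. ennreal (a v) \<partial>count_space UNIV) = 1"
  proof -
    have "(\<integral>\<^sup>+v. ennreal (a v) \<partial>count_space UNIV) = (\<Sum>v\<in>UNIV. ennreal (a v))"
      by (rule nn_integral_count_space_finite) simp
    also have "\<dots> = ennreal (\<Sum>v\<in>UNIV. a v)" using a(1) by (intro sum_ennreal) auto
    also have "(\<Sum>v\<in>UNIV. a v) = (\<Sum>v\<in>J. a v)" using a(2) by (intro sum.mono_neutral_right) auto
    finally show ?thesis using a(3) by simp
  qed
  then have pm: "pmf (embed_pmf a) v = a v" for v by (intro pmf_embed_pmf a(1))
  then have "invariant_distribution Q J (embed_pmf a)"
    unfolding invariant_distribution_def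
  proof (intro conjI subsetI ballI)
    fix v assume "v \<in> set_pmf (embed_pmf a)"
    then have "a v \<noteq> 0" by (simp only: set_pmf_iff pm not_False_eq_True)
    then show "v \<in> J" using a(2) by blast
  next
    fix v assume "v \<in> J"
    then show "(\<Sum>u\<in>J. pmf (embed_pmf a) u * Q u v) = pmf (embed_pmf a) v" unfolding pm by (rule a(4))
  qed
  then show "\<exists>\<pi>. invariant_distribution Q J \<pi>" ..
next
  fix \<pi> \<rho> assume p: "invariant_distribution Q J \<pi>" and r: "invariant_distribution Q J \<rho>"
  have s: "(\<Sum>v\<in>J. pmf \<pi> v) = 1" "(\<Sum>v\<in>J. pmf \<rho> v) = 1"
    using p r by (auto simp: invariant_distribution_def intro!: sum_pmf_eq_1)
  show "\<pi> = \<rho>"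
  proof (rule pmf_eqI)
    fix v show "pmf \<pi> v = pmf \<rho> v"
    proof (cases "v \<in> J")
      case True
      show ?thesis
        by (rule invariant_unique[where J = J and Q = Q])
          (use ne Q0 irr p r s True in \<open>auto simp: invariant_distribution_def\<close>)
    next
      case False
      then have "v \<notin> set_pmf \<pi>" "v \<notin> set_pmf \<rho>" using p r by (auto simp: invariant_distribution_def)
      then show ?thesis by (simp add: set_pmf_iff)
    qed
  qed
qed

section \<open>Stable state-and-cliques and the chain of layers\<close>

context markov_system begin

abbreviation H :: "'s \<Rightarrow> 'a set \<Rightarrow> real" where "H \<equiv> h_val I \<nu>"

lemma measure_atom_single: "clique I c \<Longrightarrow> measure (\<nu> \<alpha>) (atom [c]) = H \<alpha> c"
  by (simp add: h_val_alt atom_def)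

lemma H_le_f: assumes "clique I c" shows "H \<alpha> c \<le> f \<alpha> (cw c)"
proof -
  have "{\<omega>\<in>boundary I. \<omega> 0 = c} \<subseteq> {\<omega>\<in>boundary I. pre (cw c) \<omega>}"
  proof
    fix \<omega> assume "\<omega> \<in> {\<omega>\<in>boundary I. \<omega> 0 = c}"
    then show "\<omega> \<in> {\<omega>\<in>boundary I. pre (cw c) \<omega>}" using pre_layers[of \<omega> 1] by (simp add: layers_Suc)
  qed
  then show ?thesis unfolding h_val_alt[OF assms] f_eq by (rule \<nu>.finite_measure_mono) (rule sets_pre)
qed

lemma H_empty: "H \<alpha> {} = 0"
proof -
  have "{\<omega>\<in>boundary I. \<omega> 0 = {}} = {}" using boundaryD(2) by blast
  moreover have "clique I {}" by (simp add: clique_def)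
  ultimately show ?thesis using h_val_alt[of "{}" \<alpha>] by (simp only: measure_empty)
qed

lemma H_pos: assumes "clique I c" "H \<alpha> c > 0" shows "c \<noteq> {}" "state \<alpha> (cw c) \<noteq> None"
  using assms H_empty[of \<alpha>] H_le_f[OF assms(1), of \<alpha>] f_eq_0[of \<alpha> "cw c"] by auto

lemma in_cliques_from: "c \<in> cliques_from I act \<alpha> \<longleftrightarrow> clique I c \<and> state \<alpha> (cw c) \<noteq> None"
  by (simp add: cliques_from_def clique_trace_cw traces_from_iff)

lemma in_pverts: "(\<alpha>, c) \<in> pverts (DSC I act) \<longleftrightarrow> c \<noteq> {} \<and> clique I c \<and> state \<alpha> (cw c) \<noteq> None"
  by (simp add: DSC_def Let_def in_cliques_from)

text \<open>
If \<open>u\<close> protects \<open>(\<alpha>, c)\<close>, then almost every infinite trace above \<open>u\<close> has first layer \<open>c\<close>, so the weight of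
\<open>c\<close> is at least \<open>f \<alpha> u > 0\<close>. Conversely \<open>h_pos_protection\<close> provides a protection that contains all
letters.
\<close>
lemma stable_iff: "stable I act (\<alpha>, c) \<longleftrightarrow> clique I c \<and> H \<alpha> c > 0"
proof
  assume s: "stable I act (\<alpha>, c)"
  then have c: "clique I c" by (simp add: stable_def in_pverts)
  obtain x where x: "x \<in> traces_from I act \<alpha>" "\<And>z. z \<in> traces_from I act \<alpha> \<Longrightarrow> trace_le I x z \<Longrightarrow> layer I z 0 = c"
    using s by (auto simp: stable_def)
  then obtain u where u: "x = trace_of I u" "state \<alpha> u \<noteq> None" by (auto elim: traces_fromE)
  have "0 < f \<alpha> u" using u(2) by (simp add: f_pos_iff)
  also have "f \<alpha> u = measure (\<nu> \<alpha>) {\<omega>\<in>boundary I. pre u \<omega>}" by (rule f_eq)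
  also have "\<dots> \<le> measure (\<nu> \<alpha>) {\<omega>\<in>boundary I. \<omega> 0 = c}"
  proof (rule \<nu>.finite_measure_mono_AE)
    show "AE \<omega> in \<nu> \<alpha>. \<omega> \<in> {\<omega>\<in>boundary I. pre u \<omega>} \<longrightarrow> \<omega> \<in> {\<omega>\<in>boundary I. \<omega> 0 = c}"
      using AE_enabled
    proof eventually_elim
      case (elim \<omega>)
      show ?case
      proof
        assume "\<omega> \<in> {\<omega>\<in>boundary I. pre u \<omega>}"
        then have b: "\<omega> \<in> boundary I" and "pre u \<omega>" by simp_all
        then obtain n where "u \<preceq> layers \<omega> n" by (auto simp: pre_iff)
        also have "layers \<omega> n \<preceq> layers \<omega> (Suc n)" by (rule layers_mono) simp
        finally have le: "u \<preceq> layers \<omega> (Suc n)" .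
        have "layer I (trace_of I (layers \<omega> (Suc n))) 0 = c"
          by (rule x(2)) (use elim pre_layers le in \<open>auto simp: traces_from_iff u(1) trace_le_iff\<close>)
        then have "heads (layers \<omega> (Suc n)) = c" by (simp add: layer_0)
        moreover have "heads (layers \<omega> (Suc n)) = \<omega> 0"
          unfolding layers_def using heads_cws[OF normal_map[OF b, of 0 "Suc n"]] by (simp add: hd_map del: upt_Suc)
        ultimately show "\<omega> \<in> {\<omega>\<in>boundary I. \<omega> 0 = c}" using b by simp
      qed
    qed
    show "{\<omega>\<in>boundary I. \<omega> 0 = c} \<in> sets (\<nu> \<alpha>)" using sets_atom[of "[c]" \<alpha>] by (simp add: atom_def)
  qed
  also have "\<dots> = H \<alpha> c" by (rule h_val_alt[OF c, symmetric])
  finally show "clique I c \<and> H \<alpha> c > 0" using c by simp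
next
  assume "clique I c \<and> H \<alpha> c > 0"
  then have c: "clique I c" "H \<alpha> c > 0" by auto
  obtain y where y: "state \<alpha> y \<noteq> None" "set y = UNIV" "heads y = c" by (rule h_pos_protection[OF c])
  have "layer I z 0 = c" if z: "z \<in> traces_from I act \<alpha>" "trace_le I (trace_of I y) z" for z
  proof -
    obtain v where v: "z = trace_of I v" using z(1) by (rule traces_fromE)
    then have "y \<preceq> v" using z(2) by (simp add: trace_le_iff)
    then show ?thesis using heads_all_letters[OF _ y(2)] y(3) by (simp add: v layer_0)
  qed
  moreover have "trace_of I y \<in> traces_from I act \<alpha>" using y(1) by (simp add: traces_from_iff)
  ultimately show "stable I act (\<alpha>, c)" using H_pos[OF c] c(1) unfolding stable_def by (auto simp: in_pverts)
qed

lemma edge_iff: "u \<rightarrow>\<^bsub>DSC_plus I act\<^esub> v \<longleftrightarrow> stable I act u \<and> stable I act v \<and> (u, v) \<in> parcs (DSC I act)"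
  by (auto simp: DSC_plus_def arcs_ends_conv induce_subgraph_def image_iff)

lemma in_parcs: "((\<alpha>, c), (\<beta>, d)) \<in> parcs (DSC I act) \<longleftrightarrow>
   (\<alpha>, c) \<in> pverts (DSC I act) \<and> (\<beta>, d) \<in> pverts (DSC I act) \<and> state \<alpha> (cw c) = Some \<beta> \<and> clique_arrow I c d"
  by (auto simp: DSC_def Let_def clique_trace_cw state_def)

subsection \<open>Markov property of the layers\<close>

text \<open>
The Markov property of the layers.
\<close>
lemma measure_atom_Cons:
  assumes c: "clique I c" "c \<noteq> {}" and state: "state \<alpha> (cw c) = Some \<beta>"
  shows "measure (\<nu> \<alpha>) (atom (c # d # ds)) = (if clique_arrow I c d then f \<alpha> (cw c) * measure (\<nu> \<beta>) (atom (d # ds)) else 0)"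
proof (cases "normal (c # d # ds)")
  case False
  then have "measure (\<nu> \<alpha>) (atom (c # d # ds)) = 0" using atom_not_normal by simp
  moreover have "\<not> clique_arrow I c d \<or> measure (\<nu> \<beta>) (atom (d # ds)) = 0"
    using False c atom_not_normal[of "d # ds"] by (cases "normal (d # ds)") auto
  ultimately show ?thesis by auto
next
  case True
  obtain xs y where xy: "d # ds = xs @ [y]" by (metis append_butlast_last_id list.distinct(1))
  have n: "normal ((c # xs) @ [y])" using True xy by simp
  have n': "normal (xs @ [y])" using True xy by simp
  have eq: "measure (\<nu> \<alpha>) (atom (c # xs @ [y])) = f \<alpha> (cw c) * measure (\<nu> \<beta>) (atom (xs @ [y]))"
  proof (cases "state \<beta> (cws xs)")
    case None
    then have "state \<beta> (cws (xs @ [y])) = None" "state \<alpha> (cws (c # xs @ [y])) = None"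
      by (simp_all add: state_append state)
    then show ?thesis using measure_atom_disabled by simp
  next
    case (Some \<gamma>)
    then have "state \<alpha> (cws (c # xs)) = Some \<gamma>" by (simp add: state_append state)
    from measure_atom[OF n this] measure_atom[OF n' Some] show ?thesis
      using f_append[OF state, of "cws xs"] by simp
  qed
  moreover have "clique_arrow I c d" using True by simp
  ultimately show ?thesis by (simp only: xy if_True)
qed

text \<open>
An atom is the disjoint union of its refinements by \<open>n\<close> further layers.
\<close>
lemma sum_atoms:
  "(\<Sum>ds | length ds = n. measure (\<nu> \<alpha>) (atom (cs @ ds)) ) = measure (\<nu> \<alpha>) (atom cs)"
proof -
  have fin: "finite {ds :: 'a set list. length ds = n}"
    by (rule finite_lists_length)
  have "atom cs = (\<Union>ds\<in>{ds. length ds = n}. atom (cs @ ds))"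
  proof (rule Set.set_eqI, rule iffI)
    fix \<omega> assume \<omega>: "\<omega> \<in> atom cs"
    have "map \<omega> [0..<length cs + n] = map \<omega> [0..<length cs] @ map \<omega> [length cs..<length cs + n]"
      unfolding map_append[symmetric] by (subst upt_add_eq_append) simp_all
    then have "map \<omega> [0..<length cs + n] = cs @ map \<omega> [length cs..<length cs + n]" using \<omega> by (simp add: atom_def)
    then have "\<omega> \<in> atom (cs @ map \<omega> [length cs..<length cs + n])" using \<omega> by (simp add: atom_def)
    then show "\<omega> \<in> (\<Union>ds\<in>{ds. length ds = n}. atom (cs @ ds))" by (intro UN_I) simp_all
  next
    fix \<omega> assume "\<omega> \<in> (\<Union>ds\<in>{ds. length ds = n}. atom (cs @ ds))"
    then obtain ds where "\<omega> \<in> atom (cs @ ds)" by blast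
    then have "\<omega> \<in> boundary I" "map \<omega> [0..<length cs + length ds] = cs @ ds" by (simp_all add: atom_def)
    moreover have "map \<omega> [0..<length cs] = take (length cs) (map \<omega> [0..<length cs + length ds])"
      by (simp add: take_map)
    ultimately show "\<omega> \<in> atom cs" by (simp add: atom_def)
  qed
  moreover have "measure (\<nu> \<alpha>) (\<Union>ds\<in>{ds. length ds = n}. atom (cs @ ds)) = (\<Sum>ds | length ds = n. measure (\<nu> \<alpha>) (atom (cs @ ds)))"
  proof (rule \<nu>.finite_measure_finite_Union[OF fin])
    show "disjoint_family_on (\<lambda>ds. atom (cs @ ds)) {ds. length ds = n}"
      unfolding disjoint_family_on_def
    proof (intro ballI impI, rule ccontr)
      fix ds es assume d: "ds \<in> {ds. length ds = n}" "es \<in> {ds. length ds = n}" "ds \<noteq> es"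
        and "atom (cs @ ds) \<inter> atom (cs @ es) \<noteq> {}"
      then obtain \<omega> where "map \<omega> [0..<length (cs @ ds)] = cs @ ds" "map \<omega> [0..<length (cs @ es)] = cs @ es"
        unfolding atom_def by blast
      moreover have "length (cs @ ds) = length (cs @ es)" using d by simp
      ultimately have "cs @ ds = cs @ es" by metis
      then show False using d(3) by simp
    qed
  qed (use sets_atom in auto)
  ultimately show ?thesis by simp
qed

text \<open>
Sum the Markov property over the possible second layers.
\<close>
lemma h_eq_f_g:
  assumes c: "clique I c" "c \<noteq> {}" and state: "state \<alpha> (cw c) = Some \<beta>"
  shows "H \<alpha> c = f \<alpha> (cw c) * g_val I act \<nu> \<beta> c"
proof -
  have "H \<alpha> c = (\<Sum>ds | length ds = 1. measure (\<nu> \<alpha>) (atom ([c] @ ds)))"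
    unfolding sum_atoms measure_atom_single[OF c(1)] ..
  also have "\<dots> = (\<Sum>d\<in>UNIV. measure (\<nu> \<alpha>) (atom [c, d]))"
    by (rule sum.reindex_bij_witness[of _ "\<lambda>d. [d]" hd]) (auto simp: length_Suc_conv)
  also have "\<dots> = (\<Sum>d\<in>UNIV. if clique_arrow I c d then f \<alpha> (cw c) * measure (\<nu> \<beta>) (atom [d]) else 0)"
    by (simp only: measure_atom_Cons[OF c state])
  also have "\<dots> = (\<Sum>d | d \<in> cliques_from I act \<beta> \<and> clique_arrow I c d. f \<alpha> (cw c) * H \<beta> d)"
  proof (rule sum.mono_neutral_cong_right)
    show "\<forall>d\<in>UNIV - {d. d \<in> cliques_from I act \<beta> \<and> clique_arrow I c d}.
      (if clique_arrow I c d then f \<alpha> (cw c) * measure (\<nu> \<beta>) (atom [d]) else 0) = 0"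
    proof
      fix d assume d: "d \<in> UNIV - {d. d \<in> cliques_from I act \<beta> \<and> clique_arrow I c d}"
      show "(if clique_arrow I c d then f \<alpha> (cw c) * measure (\<nu> \<beta>) (atom [d]) else 0) = 0"
      proof (cases "clique_arrow I c d")
        case True
        then have "\<not> clique I d \<or> state \<beta> (cw d) = None" using d by (auto simp: in_cliques_from)
        then have "measure (\<nu> \<beta>) (atom [d]) = 0"
          using atom_not_normal[of "[d]"] measure_atom_disabled[of \<beta> "[d]"] by auto
        then show ?thesis by simp
      qed simp
    qed
  qed (auto simp: in_cliques_from measure_atom_single)
  also have "\<dots> = f \<alpha> (cw c) * g_val I act \<nu> \<beta> c" by (simp add: g_val_def sum_distrib_left)
  finally show ?thesis .
qed

subsection \<open>The stationary average\<close>

text \<open>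
The value of \<open>\<phi> - k * length\<close> on the product of the cliques \<open>cs\<close>. If \<open>k\<close> is the limit of the ergodic
means, then this is \<open>o(n)\<close> along the layers.
\<close>
definition centred :: "('s \<Rightarrow> 'a trace \<Rightarrow> real) \<Rightarrow> real \<Rightarrow> 's \<Rightarrow> 'a set list \<Rightarrow> real" where
  "centred \<phi> k \<alpha> cs = \<phi> \<alpha> (trace_of I (cws cs)) - k * real (length (cws cs))"

text \<open>
The integral of \<open>centred\<close> over the first \<open>n + 1\<close> layers on the event that the first layer is \<open>c\<close>. It is not
divided by the probability \<open>H \<alpha> c\<close> of this event, so that the recursion in \<open>n\<close> also holds where this
probability is 0.
\<close>
definition mean_centred :: "('s \<Rightarrow> 'a trace \<Rightarrow> real) \<Rightarrow> real \<Rightarrow> nat \<Rightarrow> 's \<Rightarrow> 'a set \<Rightarrow> real" where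
  "mean_centred \<phi> k n \<alpha> c = (\<Sum>cs | length cs = n. measure (\<nu> \<alpha>) (atom (c # cs)) * centred \<phi> k \<alpha> (c # cs))"

lemma mean_centred_0: "clique I c \<Longrightarrow> mean_centred \<phi> k 0 \<alpha> c = H \<alpha> c * centred \<phi> k \<alpha> [c]"
  by (simp add: mean_centred_def measure_atom_single)

lemma sum_length_Suc: "(\<Sum>cs | length cs = Suc n. g cs) = (\<Sum>d\<in>UNIV. \<Sum>cs | length cs = n. g (d # cs))"
  for g :: "'a set list \<Rightarrow> real"
proof -
  have fin: "finite {ds :: 'a set list. length ds = n}"
    by (rule finite_lists_length)
  have "(\<Sum>d\<in>UNIV. \<Sum>cs | length cs = n. g (d # cs)) = (\<Sum>(d, cs)\<in>UNIV \<times> {cs. length cs = n}. g (d # cs))"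
    by (rule sum.cartesian_product)
  also have "\<dots> = (\<Sum>cs | length cs = Suc n. g cs)"
    by (rule sum.reindex_bij_witness[of _ "\<lambda>cs. (hd cs, tl cs)" "\<lambda>(d, cs). d # cs"]) (auto simp: length_Suc_conv)
  finally show ?thesis by simp
qed

text \<open>
Split off the first layer: its contribution is additive, and by the Markov property the remaining layers
behave as if started in \<open>\<beta>\<close>.
\<close>
lemma mean_centred_Suc:
  assumes ad: "additive_fun I act \<phi>" and c: "clique I c" "c \<noteq> {}" and state: "state \<alpha> (cw c) = Some \<beta>"
  shows "mean_centred \<phi> k (Suc n) \<alpha> c = H \<alpha> c * centred \<phi> k \<alpha> [c] + f \<alpha> (cw c) * (\<Sum>d | clique_arrow I c d. mean_centred \<phi> k n \<beta> d)"
proof -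
  have trm: "measure (\<nu> \<alpha>) (atom (c # d # cs)) * centred \<phi> k \<alpha> (c # d # cs) =
      measure (\<nu> \<alpha>) (atom (c # d # cs)) * centred \<phi> k \<alpha> [c] +
      (if clique_arrow I c d then f \<alpha> (cw c) * (measure (\<nu> \<beta>) (atom (d # cs)) * centred \<phi> k \<beta> (d # cs)) else 0)" for d cs
  proof (cases "state \<beta> (cws (d # cs)) = None")
    case True
    then have "measure (\<nu> \<beta>) (atom (d # cs)) = 0" by (rule measure_atom_disabled)
    then show ?thesis by (simp add: measure_atom_Cons[OF c state])
  next
    case False
    then have "centred \<phi> k \<alpha> (c # d # cs) = centred \<phi> k \<alpha> [c] + centred \<phi> k \<beta> (d # cs)"
      using additive_step[OF ad state False] by (simp add: centred_def algebra_simps)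
    then show ?thesis by (simp add: measure_atom_Cons[OF c state] algebra_simps)
  qed
  have "mean_centred \<phi> k (Suc n) \<alpha> c = (\<Sum>d\<in>UNIV. \<Sum>cs | length cs = n. measure (\<nu> \<alpha>) (atom (c # d # cs)) * centred \<phi> k \<alpha> (c # d # cs))"
    unfolding mean_centred_def by (rule sum_length_Suc)
  also have "\<dots> = (\<Sum>d\<in>UNIV. \<Sum>cs | length cs = n. measure (\<nu> \<alpha>) (atom (c # d # cs)) * centred \<phi> k \<alpha> [c]) +
     (\<Sum>d\<in>UNIV. \<Sum>cs | length cs = n. (if clique_arrow I c d then f \<alpha> (cw c) * (measure (\<nu> \<beta>) (atom (d # cs)) * centred \<phi> k \<beta> (d # cs)) else 0))"
    unfolding trm sum.distrib ..
  also have "(\<Sum>d\<in>UNIV. \<Sum>cs | length cs = n. measure (\<nu> \<alpha>) (atom (c # d # cs)) * centred \<phi> k \<alpha> [c]) = H \<alpha> c * centred \<phi> k \<alpha> [c]"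
  proof -
    have "(\<Sum>d\<in>UNIV. \<Sum>cs | length cs = n. measure (\<nu> \<alpha>) (atom (c # d # cs)) * centred \<phi> k \<alpha> [c]) =
      (\<Sum>cs | length cs = Suc n. measure (\<nu> \<alpha>) (atom ([c] @ cs)) * centred \<phi> k \<alpha> [c])"
      unfolding sum_length_Suc by simp
    also have "\<dots> = H \<alpha> c * centred \<phi> k \<alpha> [c]"
      unfolding sum_distrib_right[symmetric] sum_atoms measure_atom_single[OF c(1)] ..
    finally show ?thesis .
  qed
  also have "(\<Sum>d\<in>UNIV. \<Sum>cs | length cs = n. (if clique_arrow I c d then f \<alpha> (cw c) * (measure (\<nu> \<beta>) (atom (d # cs)) * centred \<phi> k \<beta> (d # cs)) else 0))
    = f \<alpha> (cw c) * (\<Sum>d | clique_arrow I c d. mean_centred \<phi> k n \<beta> d)"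
  proof -
    have "(\<Sum>d\<in>UNIV. \<Sum>cs | length cs = n. (if clique_arrow I c d then f \<alpha> (cw c) * (measure (\<nu> \<beta>) (atom (d # cs)) * centred \<phi> k \<beta> (d # cs)) else 0))
      = (\<Sum>d\<in>UNIV. if clique_arrow I c d then f \<alpha> (cw c) * mean_centred \<phi> k n \<beta> d else 0)"
      by (rule sum.cong) (simp_all add: mean_centred_def sum_distrib_left)
    also have "\<dots> = (\<Sum>d | clique_arrow I c d. f \<alpha> (cw c) * mean_centred \<phi> k n \<beta> d)"
      by (simp add: sum.If_cases)
    finally show ?thesis by (simp add: sum_distrib_left)
  qed
  finally show ?thesis .
qed

lemma mean_centred_eq_0: assumes "\<not> stable I act (\<beta>, d)" shows "mean_centred \<phi> k n \<beta> d = 0"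
proof -
  have m0: "measure (\<nu> \<beta>) (atom [d]) = 0"
  proof (cases "clique I d")
    case True
    then show ?thesis using assms h_val_nonneg[OF True, of \<beta>] by (simp add: stable_iff measure_atom_single)
  qed (use atom_not_normal[of "[d]"] in simp)
  have "measure (\<nu> \<beta>) (atom (d # cs)) = 0" for cs
  proof -
    have "atom (d # cs) \<subseteq> atom [d]"
    proof
      fix \<omega> assume "\<omega> \<in> atom (d # cs)"
      then have "\<omega> \<in> boundary I" "map \<omega> [0..<length (d # cs)] = d # cs" unfolding atom_def by blast+
      moreover have "map \<omega> [0..<length (d # cs)] = \<omega> 0 # map \<omega> [1..<length (d # cs)]"
        by (simp add: upt_conv_Cons del: upt_Suc)
      ultimately show "\<omega> \<in> atom [d]" by (simp add: atom_def)
    qed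
    then have "measure (\<nu> \<beta>) (atom (d # cs)) \<le> measure (\<nu> \<beta>) (atom [d])"
      by (rule \<nu>.finite_measure_mono) (rule sets_atom)
    then show ?thesis using m0 by (simp add: measure_le_0_iff)
  qed
  then show ?thesis by (simp add: mean_centred_def)
qed

text \<open>
The almost sure convergence of the ergodic means gives convergence of the integrals by dominated
convergence: \<open>n + 1\<close> layers contain between \<open>n + 1\<close> and \<open>(n + 1) * CARD('a)\<close> letters, and an additive
function is bounded by a multiple of the length.
\<close>
lemma mean_centred_limit:
  assumes ad: "additive_fun I act \<phi>" and erg: "AE \<omega> in \<nu> \<alpha>. ergodic_at \<phi> k \<alpha> \<omega>"
  shows "(\<lambda>n. mean_centred \<phi> k n \<alpha> c / real (Suc n)) \<longlonglongrightarrow> 0"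
proof -
  obtain K where K: "0 \<le> K" "\<And>\<alpha> u. state \<alpha> u \<noteq> None \<Longrightarrow> \<bar>\<phi> \<alpha> (trace_of I u)\<bar> \<le> K * real (length u)"
    by (rule additive_bound[OF ad]) blast
  \<comment> \<open>The centred mean over the first layers on the event that the first one is \<open>c\<close>, written as a finite sum
    over atoms to make its integral \<open>mean_centred\<close> visible.\<close>
  define G where "G = (\<lambda>n \<omega>. (\<Sum>cs | length cs = n. indicator (atom (c # cs)) \<omega> * centred \<phi> k \<alpha> (c # cs)) / real (Suc n))"
  have G_eq: "G n \<omega> = (if \<omega> 0 = c then centred \<phi> k \<alpha> (map \<omega> [0..<Suc n]) / real (Suc n) else 0)" if b: "\<omega> \<in> boundary I" for n \<omega>
  proof -
    have fin: "finite {ds :: 'a set list. length ds = n}"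
    by (rule finite_lists_length)
    let ?ds = "map \<omega> [1..<Suc n]"
    have m: "map \<omega> [0..<Suc n] = \<omega> 0 # ?ds" by (simp add: upt_conv_Cons del: upt_Suc)
    have at: "indicator (atom (c # cs)) \<omega> = (if \<omega> 0 = c \<and> cs = ?ds then 1 else 0 :: real)" if "length cs = n" for cs
      using b that m unfolding atom_def by (auto split: split_indicator simp del: upt_Suc)
    have "(\<Sum>cs | length cs = n. indicator (atom (c # cs)) \<omega> * centred \<phi> k \<alpha> (c # cs))
      = (\<Sum>cs | length cs = n. if cs = ?ds then (if \<omega> 0 = c then centred \<phi> k \<alpha> (c # cs) else 0) else 0)"
      by (rule sum.cong) (auto simp: at simp del: upt_Suc)
    also have "\<dots> = (if \<omega> 0 = c then centred \<phi> k \<alpha> (c # ?ds) else 0)"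
      using fin by (subst sum.delta) (auto simp del: upt_Suc)
    finally show ?thesis unfolding G_def m by (simp del: upt_Suc)
  qed
  have fin: "finite {ds :: 'a set list. length ds = n}" for n
    by (rule finite_lists_length)
  have int: "(\<integral>\<omega>. G n \<omega> \<partial>\<nu> \<alpha>) = mean_centred \<phi> k n \<alpha> c / real (Suc n)" for n
  proof -
    have "(\<integral>\<omega>. G n \<omega> \<partial>\<nu> \<alpha>) = (\<integral>\<omega>. (\<Sum>cs | length cs = n. indicator (atom (c # cs)) \<omega> * centred \<phi> k \<alpha> (c # cs)) \<partial>\<nu> \<alpha>) / real (Suc n)"
      unfolding G_def by (rule integral_divide_zero)
    also have "(\<integral>\<omega>. (\<Sum>cs | length cs = n. indicator (atom (c # cs)) \<omega> * centred \<phi> k \<alpha> (c # cs)) \<partial>\<nu> \<alpha>)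
      = (\<Sum>cs | length cs = n. \<integral>\<omega>. indicator (atom (c # cs)) \<omega> * centred \<phi> k \<alpha> (c # cs) \<partial>\<nu> \<alpha>)"
      using sets_atom \<nu>.emeasure_finite by (intro Bochner_Integration.integral_sum integrable_mult_left) (auto simp: less_top[symmetric])
    also have "\<dots> = mean_centred \<phi> k n \<alpha> c"
      unfolding mean_centred_def using sets_atom by (intro sum.cong) (auto simp: Int_absorb2 sets.sets_into_space)
    finally show ?thesis .
  qed
  \<comment> \<open>The dominating constant: the centred function is at most \<open>K + \<bar>k\<bar>\<close> times the length, and \<open>n + 1\<close>
    layers have at most \<open>(n + 1) * CARD('a)\<close> letters.\<close>
  define B where "B = (K + \<bar>k\<bar>) * real (CARD('a))"
  have "(\<lambda>n. \<integral>\<omega>. G n \<omega> \<partial>\<nu> \<alpha>) \<longlonglongrightarrow> (\<integral>\<omega>. 0 \<partial>\<nu> \<alpha>)"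
  proof (rule integral_dominated_convergence[where w = "\<lambda>_. B"])
    show "G n \<in> borel_measurable (\<nu> \<alpha>)" for n
      unfolding G_def using sets_atom by (intro borel_measurable_divide borel_measurable_sum borel_measurable_times borel_measurable_indicator) auto
    show "AE \<omega> in \<nu> \<alpha>. norm (G n \<omega>) \<le> B" for n
      using AE_boundary AE_enabled
    proof eventually_elim
      case (elim \<omega>)
      let ?u = "layers \<omega> (Suc n)"
      have "\<bar>centred \<phi> k \<alpha> (map \<omega> [0..<Suc n])\<bar> \<le> \<bar>\<phi> \<alpha> (trace_of I ?u)\<bar> + \<bar>k\<bar> * real (length ?u)"
        unfolding centred_def layers_def[symmetric] by (rule order_trans[OF abs_triangle_ineq4]) (simp add: abs_mult)
      also have "\<dots> \<le> (K + \<bar>k\<bar>) * real (length ?u)"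
        using K(2)[of \<alpha> ?u] elim(2) pre_layers by (simp add: distrib_right)
      also have "\<dots> \<le> (K + \<bar>k\<bar>) * real (Suc n * CARD('a))"
        using K(1) length_layers_le[of \<omega> "Suc n"] by (intro mult_left_mono of_nat_mono) auto
      also have "\<dots> = B * real (Suc n)" by (simp only: B_def of_nat_mult ac_simps)
      finally have "\<bar>centred \<phi> k \<alpha> (map \<omega> [0..<Suc n])\<bar> / real (Suc n) \<le> B" by (simp only: pos_divide_le_eq of_nat_0_less_iff zero_less_Suc)
      moreover have "0 \<le> B" using K(1) by (simp add: B_def)
      ultimately show ?case unfolding G_eq[OF elim(1)] by (simp del: upt_Suc)
    qed
    show "AE \<omega> in \<nu> \<alpha>. (\<lambda>n. G n \<omega>) \<longlonglongrightarrow> 0"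
      using AE_boundary AE_enabled erg
    proof eventually_elim
      case (elim \<omega>)
      show ?case
      proof (rule LIMSEQ_I)
        fix r :: real assume "0 < r"
        \<comment> \<open>The same bound on the number of letters per layer turns an error \<open>\<epsilon>\<close> per letter
          into \<open>r\<close> per layer.\<close>
        define \<epsilon> where "\<epsilon> = r / real (CARD('a))"
        have \<epsilon>: "0 < \<epsilon>" using \<open>0 < r\<close> by (simp add: \<epsilon>_def)
        then obtain x where x: "pre x \<omega>" "\<And>y. x \<preceq> y \<Longrightarrow> pre y \<omega> \<Longrightarrow> y \<noteq> [] \<Longrightarrow> \<bar>\<phi> \<alpha> (trace_of I y) / real (length y) - k\<bar> < \<epsilon>"
          using elim(3) unfolding ergodic_at_def by blast
        have "norm (G n \<omega> - 0) < r" if n: "length x \<le> n" for n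
        proof (cases "\<omega> 0 = c")
          case True
          let ?u = "layers \<omega> (Suc n)"
          have l: "Suc n \<le> length ?u" by (rule length_layers_ge[OF elim(1)])
          then have ne: "?u \<noteq> []" by auto
          have l0: "0 < real (length ?u)" unfolding of_nat_0_less_iff using l by linarith
          have "x \<preceq> layers \<omega> (length x)" by (rule pre_length[OF elim(1) x(1)])
          also have "\<dots> \<preceq> ?u" using n by (intro layers_mono) simp
          finally have e: "\<bar>\<phi> \<alpha> (trace_of I ?u) / real (length ?u) - k\<bar> < \<epsilon>" using x(2) pre_layers ne by blast
          have "centred \<phi> k \<alpha> (map \<omega> [0..<Suc n]) = (\<phi> \<alpha> (trace_of I ?u) / real (length ?u) - k) * real (length ?u)"
            unfolding centred_def layers_def[symmetric] using l0 by (simp only: left_diff_distrib nonzero_eq_divide_eq[symmetric]) simp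
          then have "\<bar>centred \<phi> k \<alpha> (map \<omega> [0..<Suc n])\<bar> < \<epsilon> * real (length ?u)"
            using e l0 by (simp only: abs_mult abs_of_pos mult_strict_right_mono)
          also have "\<dots> \<le> \<epsilon> * real (Suc n * CARD('a))"
            using \<epsilon> length_layers_le[of \<omega> "Suc n"] by (intro mult_left_mono of_nat_mono) auto
          also have "\<dots> = r * real (Suc n)" unfolding \<epsilon>_def of_nat_mult by simp
          finally have "\<bar>centred \<phi> k \<alpha> (map \<omega> [0..<Suc n])\<bar> / real (Suc n) < r" by (simp only: pos_divide_less_eq of_nat_0_less_iff zero_less_Suc)
          then show ?thesis unfolding G_eq[OF elim(1)] using True by (simp del: upt_Suc)
        next
          case False
          then show ?thesis unfolding G_eq[OF elim(1)] using \<open>0 < r\<close> by simp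
        qed
        then show "\<exists>no. \<forall>n\<ge>no. norm (G n \<omega> - 0) < r" by blast
      qed
    qed
  qed auto
  then show ?thesis by (simp add: int del: of_nat_Suc)
qed

end

section \<open>Final components and the value of the limit\<close>

text \<open>
The vertex \<open>v\<close> lies in a strongly connected component, and an edge leads to it from \<open>J\<close>. As \<open>J\<close> is final,
this component is \<open>J\<close>.
\<close>
lemma final_component_closed:
  assumes fc: "final_component G J" and u: "u \<in> J" and e: "u \<rightarrow>\<^bsub>G\<^esub> v" and v: "v \<in> verts G"
  shows "v \<in> J"
proof -
  define J' where "J' = {x. v \<rightarrow>\<^sup>*\<^bsub>G\<^esub> x \<and> x \<rightarrow>\<^sup>*\<^bsub>G\<^esub> v}"
  have tr: "x \<rightarrow>\<^sup>*\<^bsub>G\<^esub> y \<Longrightarrow> y \<rightarrow>\<^sup>*\<^bsub>G\<^esub> z \<Longrightarrow> x \<rightarrow>\<^sup>*\<^bsub>G\<^esub> z" for x y z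
    unfolding reachable_def by (rule rtrancl_on_trans)
  have vJ: "v \<in> J'" using v by (simp add: J'_def reachable_def)
  have "J' \<in> pre_digraph.sccs_verts G"
    unfolding pre_digraph.sccs_verts_def
  proof (intro CollectI conjI ballI allI impI)
    show "J' \<noteq> {}" using vJ by blast
    show "x \<rightarrow>\<^sup>*\<^bsub>G\<^esub> y" if "x \<in> J'" "y \<in> J'" for x y using that tr unfolding J'_def by blast
    show "\<not> x \<rightarrow>\<^sup>*\<^bsub>G\<^esub> y \<or> \<not> y \<rightarrow>\<^sup>*\<^bsub>G\<^esub> x" if "x \<in> J'" "y \<notin> J'" for x y
    proof (rule ccontr)
      assume "\<not> ?thesis"
      then have "x \<rightarrow>\<^sup>*\<^bsub>G\<^esub> y" "y \<rightarrow>\<^sup>*\<^bsub>G\<^esub> x" by simp_all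
      then have "y \<in> J'" using that(1) tr unfolding J'_def by blast
      then show False using that(2) by simp
    qed
  qed
  then have "J' = J" using fc u e vJ unfolding final_component_def by blast
  then show ?thesis using vJ by simp
qed

context markov_system begin

abbreviation P :: "'s \<times> 'a set \<Rightarrow> 's \<times> 'a set \<Rightarrow> real" where
  "P \<equiv> transition_matrix I act \<nu>"

lemma verts_DSC_plus: "verts (DSC_plus I act) = {v. stable I act v}"
  by (simp add: DSC_plus_def induce_subgraph_def)

lemma final_stable: assumes "final_component (DSC_plus I act) J" "u \<in> J" shows "stable I act u"
proof -
  have "u \<rightarrow>\<^sup>*\<^bsub>DSC_plus I act\<^esub> u"
    using assms unfolding final_component_def pre_digraph.sccs_verts_def by blast
  then have "u \<in> verts (DSC_plus I act)" unfolding reachable_def by (rule in_rtrancl_on_in_F)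
  then show ?thesis by (simp add: verts_DSC_plus)
qed

lemma stableD:
  assumes "stable I act (\<alpha>, c)"
  obtains \<beta> where "clique I c" "c \<noteq> {}" "H \<alpha> c > 0" "state \<alpha> (cw c) = Some \<beta>" "g_val I act \<nu> \<beta> c > 0" "f \<alpha> (cw c) > 0"
proof -
  have c: "clique I c" "H \<alpha> c > 0" using assms by (simp_all add: stable_iff)
  obtain \<beta> where \<beta>: "state \<alpha> (cw c) = Some \<beta>" using H_pos[OF c] by blast
  have fp: "f \<alpha> (cw c) > 0" using \<beta> by (simp add: f_pos_iff)
  have "f \<alpha> (cw c) * g_val I act \<nu> \<beta> c > 0" using h_eq_f_g[OF c(1) H_pos(1)[OF c] \<beta>] c(2) by simp
  then have "g_val I act \<nu> \<beta> c > 0" using fp by (simp add: zero_less_mult_iff)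
  then show ?thesis using that c H_pos[OF c] \<beta> fp by blast
qed

lemma P_eq:
  assumes "state \<alpha> (cw c) = Some \<beta>"
  shows "P (\<alpha>, c) (\<beta>', d) = (if ((\<alpha>, c), (\<beta>', d)) \<in> parcs (DSC I act) then H \<beta>' d / g_val I act \<nu> \<beta> c else 0)"
  using next_state_eq[OF assms] by (simp add: transition_matrix_def clique_trace_cw)

lemma P_nonneg:
  assumes "stable I act u" shows "0 \<le> P u v"
proof -
  obtain \<alpha> c \<beta>' d where uv: "u = (\<alpha>, c)" "v = (\<beta>', d)" by (cases u, cases v)
  obtain \<beta> where \<beta>: "state \<alpha> (cw c) = Some \<beta>" "g_val I act \<nu> \<beta> c > 0"
    using assms unfolding uv by (rule stableD)
  have "clique I d" if "((\<alpha>, c), (\<beta>', d)) \<in> parcs (DSC I act)" using that by (simp add: in_parcs in_pverts)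
  then show ?thesis using P_eq[OF \<beta>(1)] \<beta>(2) h_val_nonneg by (auto simp: uv)
qed

text \<open>
All stable successors of a vertex of \<open>J\<close> are in \<open>J\<close>, and they have the same state \<open>\<beta>\<close>. So a sum over \<open>J\<close>
against a row of the transition matrix is a sum over cliques.
\<close>
lemma sum_P:
  assumes fc: "final_component (DSC_plus I act) J" and u: "(\<alpha>, c) \<in> J" and \<beta>: "state \<alpha> (cw c) = Some \<beta>"
  shows "(\<Sum>v\<in>J. P (\<alpha>, c) v * F v) =
    (\<Sum>d | clique_arrow I c d \<and> stable I act (\<beta>, d). H \<beta> d / g_val I act \<nu> \<beta> c * F (\<beta>, d))"
proof -
  have s: "stable I act (\<alpha>, c)" by (rule final_stable[OF fc u])
  have vc: "(\<alpha>, c) \<in> pverts (DSC I act)" using s by (simp add: stable_def)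
  have pd: "(\<gamma>, d) \<in> pverts (DSC I act)" if "stable I act (\<gamma>, d)" for \<gamma> d using that by (simp add: stable_def)
  have img: "Pair \<beta> ` {d. clique_arrow I c d \<and> stable I act (\<beta>, d)} = {v \<in> J. ((\<alpha>, c), v) \<in> parcs (DSC I act)}"
  proof (rule Set.set_eqI, rule iffI)
    fix v assume "v \<in> Pair \<beta> ` {d. clique_arrow I c d \<and> stable I act (\<beta>, d)}"
    then obtain d where d: "v = (\<beta>, d)" "clique_arrow I c d" "stable I act (\<beta>, d)" by blast
    have a: "((\<alpha>, c), v) \<in> parcs (DSC I act)" using d vc pd \<beta> by (simp add: in_parcs)
    then have "(\<alpha>, c) \<rightarrow>\<^bsub>DSC_plus I act\<^esub> v" using s d by (simp add: edge_iff)
    then have "v \<in> J" by (rule final_component_closed[OF fc u]) (simp add: verts_DSC_plus d)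
    then show "v \<in> {v \<in> J. ((\<alpha>, c), v) \<in> parcs (DSC I act)}" using a by simp
  next
    fix v assume v: "v \<in> {v \<in> J. ((\<alpha>, c), v) \<in> parcs (DSC I act)}"
    obtain \<gamma> d where vv: "v = (\<gamma>, d)" by (cases v)
    have "\<gamma> = \<beta>" "clique_arrow I c d" using v \<beta> by (simp_all add: vv in_parcs)
    moreover have "stable I act (\<gamma>, d)" using v final_stable[OF fc] by (simp add: vv)
    ultimately show "v \<in> Pair \<beta> ` {d. clique_arrow I c d \<and> stable I act (\<beta>, d)}" by (simp add: vv)
  qed
  have "(\<Sum>v\<in>J. P (\<alpha>, c) v * F v) = (\<Sum>v\<in>{v \<in> J. ((\<alpha>, c), v) \<in> parcs (DSC I act)}. P (\<alpha>, c) v * F v)"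
  proof (rule sum.mono_neutral_right)
    show "\<forall>v\<in>J - {v \<in> J. ((\<alpha>, c), v) \<in> parcs (DSC I act)}. P (\<alpha>, c) v * F v = 0"
    proof
      fix v assume "v \<in> J - {v \<in> J. ((\<alpha>, c), v) \<in> parcs (DSC I act)}"
      then have "((\<alpha>, c), v) \<notin> parcs (DSC I act)" by blast
      then have "P (\<alpha>, c) v = 0" using P_eq[OF \<beta>] by (cases v) simp
      then show "P (\<alpha>, c) v * F v = 0" by simp
    qed
  qed auto
  also have "\<dots> = (\<Sum>d | clique_arrow I c d \<and> stable I act (\<beta>, d). P (\<alpha>, c) (\<beta>, d) * F (\<beta>, d))"
    unfolding img[symmetric] by (subst sum.reindex) (auto simp: inj_on_def)
  also have "\<dots> = (\<Sum>d | clique_arrow I c d \<and> stable I act (\<beta>, d). H \<beta> d / g_val I act \<nu> \<beta> c * F (\<beta>, d))"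
  proof (rule sum.cong)
    fix d assume "d \<in> {d. clique_arrow I c d \<and> stable I act (\<beta>, d)}"
    then have "((\<alpha>, c), (\<beta>, d)) \<in> parcs (DSC I act)" using vc pd \<beta> by (simp add: in_parcs)
    then show "P (\<alpha>, c) (\<beta>, d) * F (\<beta>, d) = H \<beta> d / g_val I act \<nu> \<beta> c * F (\<beta>, d)" by (simp add: P_eq[OF \<beta>])
  qed simp
  finally show ?thesis .
qed

text \<open>
Cliques that are not stable have weight 0.
\<close>
lemma g_val_stable:
  "g_val I act \<nu> \<beta> c = (\<Sum>d | clique_arrow I c d \<and> stable I act (\<beta>, d). H \<beta> d)"
  unfolding g_val_def
proof (rule sum.mono_neutral_right)
  show "{d. clique_arrow I c d \<and> stable I act (\<beta>, d)} \<subseteq> {d. d \<in> cliques_from I act \<beta> \<and> clique_arrow I c d}"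
    using H_pos by (auto simp: stable_iff in_cliques_from)
  show "\<forall>d\<in>{d. d \<in> cliques_from I act \<beta> \<and> clique_arrow I c d} - {d. clique_arrow I c d \<and> stable I act (\<beta>, d)}. H \<beta> d = 0"
  proof
    fix d assume "d \<in> {d. d \<in> cliques_from I act \<beta> \<and> clique_arrow I c d} - {d. clique_arrow I c d \<and> stable I act (\<beta>, d)}"
    then have "clique I d" "\<not> 0 < H \<beta> d" by (auto simp: in_cliques_from stable_iff)
    then show "H \<beta> d = 0" using h_val_nonneg[of d \<beta>] by simp
  qed
qed simp

lemma P_stochastic:
  assumes fc: "final_component (DSC_plus I act) J" and u: "u \<in> J"
  shows "(\<Sum>v\<in>J. P u v) = 1"
proof -
  obtain \<alpha> c where uc: "u = (\<alpha>, c)" by (cases u)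
  obtain \<beta> where \<beta>: "state \<alpha> (cw c) = Some \<beta>" "g_val I act \<nu> \<beta> c > 0"
    using final_stable[OF fc u] unfolding uc by (rule stableD)
  have "(\<Sum>v\<in>J. P u v) = (\<Sum>d | clique_arrow I c d \<and> stable I act (\<beta>, d). H \<beta> d / g_val I act \<nu> \<beta> c)"
    using sum_P[OF fc u[unfolded uc] \<beta>(1), of "\<lambda>_. 1"] by (simp add: uc)
  also have "\<dots> = g_val I act \<nu> \<beta> c / g_val I act \<nu> \<beta> c"
    unfolding sum_divide_distrib[symmetric] g_val_stable ..
  finally show ?thesis using \<beta>(2) by simp
qed

lemma P_irreducible:
  assumes fc: "final_component (DSC_plus I act) J" and u: "u \<in> J" and v: "v \<in> J"
  shows "(u, v) \<in> {(x, y). x \<in> J \<and> y \<in> J \<and> 0 < P x y}\<^sup>*"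
proof -
  have "u \<rightarrow>\<^sup>*\<^bsub>DSC_plus I act\<^esub> v"
    using fc u v unfolding final_component_def pre_digraph.sccs_verts_def by blast
  then have "(u, v) \<in> rtrancl_on (verts (DSC_plus I act)) (arcs_ends (DSC_plus I act))" by (simp add: reachable_def)
  then have "v \<in> J \<and> (u, v) \<in> {(x, y). x \<in> J \<and> y \<in> J \<and> 0 < P x y}\<^sup>*"
  proof (induction rule: rtrancl_on_induct)
    case base
    then show ?case using u by simp
  next
    case (step y z)
    have yJ: "y \<in> J" using step by simp
    have zJ: "z \<in> J" by (rule final_component_closed[OF fc yJ step(2,4)])
    obtain \<alpha> c \<beta>' d where yz: "y = (\<alpha>, c)" "z = (\<beta>', d)" by (cases y, cases z)
    have e: "stable I act (\<alpha>, c)" "stable I act (\<beta>', d)" "((\<alpha>, c), (\<beta>', d)) \<in> parcs (DSC I act)"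
      using step(2) unfolding yz edge_iff by auto
    obtain \<beta> where \<beta>: "state \<alpha> (cw c) = Some \<beta>" "g_val I act \<nu> \<beta> c > 0" using e(1) by (rule stableD)
    have "H \<beta>' d > 0" using e(2) by (simp add: stable_iff)
    then have "0 < P y z" unfolding yz P_eq[OF \<beta>(1)] using e(3) \<beta>(2) by simp
    then have "(y, z) \<in> {(x, y). x \<in> J \<and> y \<in> J \<and> 0 < P x y}" using yJ zJ by simp
    then show ?case using step zJ by (auto intro: rtrancl_into_rtrancl)
  qed
  then show ?thesis by simp
qed

theorem ex1_invariant:
  assumes fc: "final_component (DSC_plus I act) J"
  shows "\<exists>!\<pi>. invariant_distribution P J \<pi>"
proof (rule ex1_invariant_distribution)
  show "J \<noteq> {}" using fc unfolding final_component_def pre_digraph.sccs_verts_def by blast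
  show "0 \<le> P u v" if "u \<in> J" "v \<in> J" for u v using P_nonneg final_stable[OF fc that(1)] by blast
qed (rule P_stochastic[OF fc] P_irreducible[OF fc]; assumption)+

text \<open>
Let \<open>Z n u\<close> be the conditional mean of \<open>\<phi> - k * length\<close> over the first \<open>n + 1\<close> layers, given the first
state-and-clique \<open>u\<close>. By \<open>mean_centred_Suc\<close> it satisfies the recursion \<open>ZSuc\<close>, and averaging against the
invariant distribution gives \<open>(n + 1) * m\<close>, where \<open>m\<close> is the \<open>\<pi>\<close>-average of \<open>Z 0\<close>. Since \<open>Z n u / (n + 1)\<close>
tends to 0, \<open>m = 0\<close>. Solving \<open>m = 0\<close> for \<open>k\<close> gives the formula.
\<close>
theorem stationary_average:
  assumes ad: "additive_fun I act \<phi>" and erg: "\<forall>\<alpha>. AE \<omega> in \<nu> \<alpha>. ergodic_at \<phi> k \<alpha> \<omega>"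
    and fc: "final_component (DSC_plus I act) J" and inv: "invariant_distribution P J \<pi>"
  shows "k = inverse (\<Sum>(\<alpha>, c)\<in>J. pmf \<pi> (\<alpha>, c) * real (card c)) *
                (\<Sum>(\<alpha>, c)\<in>J. pmf \<pi> (\<alpha>, c) * \<phi> \<alpha> (clique_trace I c))"
proof -
  define w where "w = (\<lambda>u. centred \<phi> k (fst u) [snd u])"
  define Z where "Z = (\<lambda>n u. mean_centred \<phi> k n (fst u) (snd u) / H (fst u) (snd u))"
  define m where "m = (\<Sum>u\<in>J. pmf \<pi> u * w u)"
  have inv': "(\<Sum>u\<in>J. pmf \<pi> u * P u v) = pmf \<pi> v" if "v \<in> J" for v
    using inv that unfolding invariant_distribution_def by blast
  have Z0: "Z 0 u = w u" if u: "u \<in> J" for u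
  proof -
    obtain \<alpha> c where uc: "u = (\<alpha>, c)" by (cases u)
    have "clique I c" "H \<alpha> c > 0" using final_stable[OF fc u] by (simp_all add: uc stable_iff)
    then show ?thesis by (simp add: Z_def w_def uc mean_centred_0)
  qed
  have ZSuc: "Z (Suc n) u = w u + (\<Sum>v\<in>J. P u v * Z n v)" if u: "u \<in> J" for u n
  proof -
    obtain \<alpha> c where uc: "u = (\<alpha>, c)" by (cases u)
    obtain \<beta> where c: "clique I c" "c \<noteq> {}" "H \<alpha> c > 0" "state \<alpha> (cw c) = Some \<beta>" "g_val I act \<nu> \<beta> c > 0" "f \<alpha> (cw c) > 0"
      using final_stable[OF fc u] unfolding uc by (rule stableD)
    let ?g = "g_val I act \<nu> \<beta> c"
    have "(\<Sum>v\<in>J. P u v * Z n v) = (\<Sum>d | clique_arrow I c d \<and> stable I act (\<beta>, d). H \<beta> d / ?g * Z n (\<beta>, d))"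
      unfolding uc by (rule sum_P[OF fc u[unfolded uc] c(4)])
    also have "\<dots> = (\<Sum>d | clique_arrow I c d \<and> stable I act (\<beta>, d). mean_centred \<phi> k n \<beta> d / ?g)"
      by (rule sum.cong) (auto simp: Z_def stable_iff)
    also have "\<dots> = (\<Sum>d | clique_arrow I c d. mean_centred \<phi> k n \<beta> d) / ?g"
      unfolding sum_divide_distrib[symmetric]
      by (rule arg_cong[where f = "\<lambda>x. x / ?g"], rule sum.mono_neutral_left) (auto simp: mean_centred_eq_0)
    finally have PZ: "(\<Sum>v\<in>J. P u v * Z n v) = (\<Sum>d | clique_arrow I c d. mean_centred \<phi> k n \<beta> d) / ?g" .
    have Hfg: "H \<alpha> c = f \<alpha> (cw c) * ?g" by (rule h_eq_f_g[OF c(1,2,4)])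
    have "Z (Suc n) u = (H \<alpha> c * centred \<phi> k \<alpha> [c] + f \<alpha> (cw c) * (\<Sum>d | clique_arrow I c d. mean_centred \<phi> k n \<beta> d)) / H \<alpha> c"
      by (simp add: Z_def uc mean_centred_Suc[OF ad c(1,2,4)])
    also have "\<dots> = centred \<phi> k \<alpha> [c] + (f \<alpha> (cw c) * (\<Sum>d | clique_arrow I c d. mean_centred \<phi> k n \<beta> d)) / H \<alpha> c"
      using c(3) by (simp add: add_divide_distrib)
    also have "\<dots> = centred \<phi> k \<alpha> [c] + (f \<alpha> (cw c) * (\<Sum>d | clique_arrow I c d. mean_centred \<phi> k n \<beta> d)) / (f \<alpha> (cw c) * ?g)"
      unfolding Hfg ..
    also have "\<dots> = w u + (\<Sum>v\<in>J. P u v * Z n v)" using c(6) by (simp add: w_def uc PZ[unfolded uc])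
    finally show ?thesis .
  qed
  have A: "(\<Sum>u\<in>J. pmf \<pi> u * Z n u) = real (Suc n) * m" for n
  proof (induction n)
    case 0
    then show ?case by (simp add: m_def Z0)
  next
    case (Suc n)
    have "(\<Sum>u\<in>J. pmf \<pi> u * Z (Suc n) u) = m + (\<Sum>u\<in>J. \<Sum>v\<in>J. pmf \<pi> u * P u v * Z n v)"
      by (simp add: ZSuc m_def distrib_left sum.distrib sum_distrib_left mult.assoc)
    also have "(\<Sum>u\<in>J. \<Sum>v\<in>J. pmf \<pi> u * P u v * Z n v) = (\<Sum>v\<in>J. \<Sum>u\<in>J. pmf \<pi> u * P u v * Z n v)"
      by (rule sum.swap)
    also have "\<dots> = (\<Sum>v\<in>J. pmf \<pi> v * Z n v)"
      by (rule sum.cong) (simp_all add: sum_distrib_right[symmetric] inv')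
    also have "m + (\<Sum>v\<in>J. pmf \<pi> v * Z n v) = real (Suc (Suc n)) * m" using Suc by (simp add: algebra_simps)
    finally show ?case .
  qed
  have "(\<lambda>n. (\<Sum>u\<in>J. pmf \<pi> u * (mean_centred \<phi> k n (fst u) (snd u) / real (Suc n) / H (fst u) (snd u)))) \<longlonglongrightarrow> (\<Sum>u\<in>J. pmf \<pi> u * (0 / H (fst u) (snd u)))"
  proof (intro tendsto_sum tendsto_mult tendsto_const tendsto_divide)
    fix u assume u: "u \<in> J"
    show "(\<lambda>n. mean_centred \<phi> k n (fst u) (snd u) / real (Suc n)) \<longlonglongrightarrow> 0" using erg by (intro mean_centred_limit[OF ad]) blast
    show "H (fst u) (snd u) \<noteq> 0" using final_stable[OF fc u] by (cases u) (simp add: stable_iff)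
  qed
  moreover have "(\<Sum>u\<in>J. pmf \<pi> u * (mean_centred \<phi> k n (fst u) (snd u) / real (Suc n) / H (fst u) (snd u))) = m" for n
  proof -
    have "(\<Sum>u\<in>J. pmf \<pi> u * (mean_centred \<phi> k n (fst u) (snd u) / real (Suc n) / H (fst u) (snd u))) = (\<Sum>u\<in>J. pmf \<pi> u * Z n u) / real (Suc n)"
      by (simp only: Z_def sum_divide_distrib times_divide_eq_right divide_divide_eq_left mult.commute[of "real (Suc n)"])
    then show ?thesis by (simp only: A) simp
  qed
  ultimately have "(\<lambda>n :: nat. m) \<longlonglongrightarrow> 0" by simp
  then have m0: "m = 0" by (simp add: LIMSEQ_const_iff)
  define a where "a = (\<Sum>(\<alpha>, c)\<in>J. pmf \<pi> (\<alpha>, c) * real (card c))"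
  define b where "b = (\<Sum>(\<alpha>, c)\<in>J. pmf \<pi> (\<alpha>, c) * \<phi> \<alpha> (clique_trace I c))"
  have "m = b - k * a"
    unfolding m_def a_def b_def sum_distrib_left sum_subtractf[symmetric]
    by (rule sum.cong) (auto simp: w_def centred_def clique_trace_cw length_cw algebra_simps)
  then have bk: "b = k * a" using m0 by simp
  have "1 \<le> a"
  proof -
    have "1 = (\<Sum>u\<in>J. pmf \<pi> u)"
      using inv by (intro sum_pmf_eq_1[symmetric]) (auto simp: invariant_distribution_def)
    also have "\<dots> \<le> (\<Sum>u\<in>J. pmf \<pi> u * real (card (snd u)))"
    proof (rule sum_mono)
      fix u assume u: "u \<in> J"
      have "snd u \<noteq> {}" using final_stable[OF fc u] H_pos(1) by (cases u) (auto simp: stable_iff)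
      then have "1 \<le> card (snd u)" by (simp add: Suc_le_eq card_gt_0_iff)
      then have "pmf \<pi> u * 1 \<le> pmf \<pi> u * real (card (snd u))" by (intro mult_left_mono) auto
      then show "pmf \<pi> u \<le> pmf \<pi> u * real (card (snd u))" by simp
    qed
    also have "\<dots> = a" unfolding a_def by (rule sum.cong) auto
    finally show ?thesis .
  qed
  then have "k = inverse a * b" using bk by (simp add: field_simps)
  then show ?thesis by (simp only: a_def b_def)
qed

end

theorem theorem5p6:
  fixes I :: "('a::finite \<times> 'a) set"
    and act :: "('a, 's::finite) action"
    and \<nu> :: "('a, 's) measure_family"
  assumes "irreducible_system I act"
    and "markov_measure I act \<nu>"
  shows "\<forall>\<phi>. test_function I act \<phi> \<longrightarrow>
    (\<exists>k::real. ergodic_means_converge I act \<nu> \<phi> (\<lambda>\<alpha> \<omega>. k) \<and>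
      (additive_fun I act \<phi> \<longrightarrow>
        (\<forall>J. final_component (DSC_plus I act) J \<longrightarrow>
          (\<exists>!\<pi>. invariant_distribution (transition_matrix I act \<nu>) J \<pi>) \<and>
          (\<forall>\<pi>. invariant_distribution (transition_matrix I act \<nu>) J \<pi> \<longrightarrow>
            k = inverse (\<Sum>(\<alpha>, c)\<in>J. pmf \<pi> (\<alpha>, c) * real (card c)) *
                (\<Sum>(\<alpha>, c)\<in>J. pmf \<pi> (\<alpha>, c) * \<phi> \<alpha> (clique_trace I c))))))"
proof (intro allI impI)
  fix \<phi> :: "('a, 's) trace_fun"
  assume "test_function I act \<phi>"
  interpret markov_system I act \<nu> by unfold_locales (rule assms)+
  obtain k where k: "\<forall>\<alpha>. AE \<omega> in \<nu> \<alpha>. ergodic_at \<phi> k \<alpha> \<omega>"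
    using ergodic_test_function[OF \<open>test_function I act \<phi>\<close>] by blast
  show "\<exists>k::real. ergodic_means_converge I act \<nu> \<phi> (\<lambda>\<alpha> \<omega>. k) \<and>
      (additive_fun I act \<phi> \<longrightarrow>
        (\<forall>J. final_component (DSC_plus I act) J \<longrightarrow>
          (\<exists>!\<pi>. invariant_distribution (transition_matrix I act \<nu>) J \<pi>) \<and>
          (\<forall>\<pi>. invariant_distribution (transition_matrix I act \<nu>) J \<pi> \<longrightarrow>
            k = inverse (\<Sum>(\<alpha>, c)\<in>J. pmf \<pi> (\<alpha>, c) * real (card c)) *
                (\<Sum>(\<alpha>, c)\<in>J. pmf \<pi> (\<alpha>, c) * \<phi> \<alpha> (clique_trace I c)))))"
    by (intro exI[of _ k] conjI impI allI ergodic_means[OF k] ex1_invariant stationary_average[OF _ k])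
qed

end
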